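(* Let $(M,\omega,\theta)$ be a locally conformally symplectic manifold and let $(\pi,\xi)$ be the associated Jacobi structure. Then the skew algebroid $(T^*M,\sharp_{\pi,\xi},[\cdot,\cdot]_{\pi,\xi}^{\theta})$ is a Lie algebroid isomorphic to the tangent algebroid $(TM,\mathrm{Id},[\cdot,\cdot])$ of $M$.
   Context: A locally conformally symplectic structure on a smooth manifold $M$ is a pair $(\omega,\theta)$ of a nondegenerate $2$-form $\omega$ and a closed $1$-form $\theta$ with $d\omega+\theta\wedge\omega=0$. The associated pair $(\pi,\xi)$ is defined by $\pi(\alpha,\beta)=\omega(\sharp_\omega(\alpha),\sharp_\omega(\beta))$ and $\xi=\sharp_\omega(\theta)$, where $\sharp_\omega$ is the inverse of $\flat_\omega:TM\to T^*M$, $\flat_\omega(X)=-i_X\omega$. (It is a Jacobi structure.) For a bivector field $\pi$ and a vector field $\xi$ on $M$, define $\sharp_\pi:T^*M\to TM$ by $\beta(\sharp_\pi(\alpha))=\pi(\alpha,\beta)$; $[\alpha,\beta]_\pi=\mathcal{L}_{\sharp_\pi(\alpha)}\beta-\mathcal{L}_{\sharp_\pi(\beta)}\alpha-d(\pi(\alpha,\beta))$; $\sharp_{\pi,\xi}(\alpha)=\sharp_\pi(\alpha)+\alpha(\xi)\xi$; and, for $\lambda\in\Omega^1(M)$ (here $\lambda=\theta$), $$[\alpha,\beta]_{\pi,\xi}^{\lambda}=[\alpha,\beta]_\pi+\alpha(\xi)(\mathcal{L}_\xi\beta-\beta)-\beta(\xi)(\mathcal{L}_\xi\alpha-\alpha)-\pi(\alpha,\beta)\lambda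 .$$ A skew algebroid on $M$ is a triple $(E,\sharp_E,[\cdot,\cdot]_E)$ where $E\to M$ is a vector bundle, $\sharp_E:E\to TM$ is a vector bundle morphism (the anchor), and $[\cdot,\cdot]_E$ is a skew-symmetric $\mathbb{R}$-bilinear bracket on $\Gamma(E)$ with $[s,\varphi t]_E=\varphi[s,t]_E+\sharp_E(s)(\varphi)t$. It is a Lie algebroid if $[\cdot,\cdot]_E$ satisfies the Jacobi identity. An isomorphism of such algebroids is a vector bundle isomorphism over $\mathrm{Id}_M$ compatible with anchors and brackets. *)

theory Defs
  imports "HOL-Analysis.Analysis" "HOL-Library.Function_Algebras"
begin

section \<open>Functions as a real vector space\<close>

text \<open>Tangent vectors are derivations and covectors are functionals, so both are real-valued
  functions; the fibres of \<open>TM\<close> and \<open>T\<^sup>*M\<close> are subspaces of such function spaces, with pointwise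
  operations.\<close>

instantiation "fun" :: (type, real_vector) real_vector
begin

definition scaleR_fun :: "real \<Rightarrow> ('a \<Rightarrow> 'b) \<Rightarrow> 'a \<Rightarrow> 'b"
  where "scaleR_fun c f = (\<lambda>x. c *\<^sub>R f x)"

instance
  by standard (simp_all add: scaleR_fun_def plus_fun_def fun_eq_iff algebra_simps)

end

definition linear_on_subspace :: "'v::real_vector set \<Rightarrow> ('v \<Rightarrow> 'w::real_vector) \<Rightarrow> bool"
  where "linear_on_subspace V f \<longleftrightarrow>
    (\<forall>u\<in>V. \<forall>v\<in>V. f (u + v) = f u + f v) \<and> (\<forall>c. \<forall>v\<in>V. f (c *\<^sub>R v) = c *\<^sub>R f v)"


section \<open>Smooth manifolds\<close>

text \<open>\<open>Ck_on k S f\<close> is used only for open \<open>S\<close>. All iterated directional derivatives are required to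
  exist and to be continuous; on a Euclidean space this is the class \<open>C\<^sup>k\<close>.\<close>

primrec Ck_on :: "nat \<Rightarrow> 'a::real_normed_vector set \<Rightarrow> ('a \<Rightarrow> 'b::real_normed_vector) \<Rightarrow> bool"
where
  "Ck_on 0 S f \<longleftrightarrow> continuous_on S f"
| "Ck_on (Suc k) S f \<longleftrightarrow>
    (\<forall>x\<in>S. f differentiable (at x)) \<and> (\<forall>v. Ck_on k S (\<lambda>x. frechet_derivative f (at x) v))"

definition smooth_on :: "'a::real_normed_vector set \<Rightarrow> ('a \<Rightarrow> 'b::real_normed_vector) \<Rightarrow> bool"
  where "smooth_on S f \<longleftrightarrow> (\<forall>k. Ck_on k S f)"

text \<open>A manifold is a Hausdorff second countable space (the type \<open>'m\<close>) with a smooth atlas, not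
  necessarily maximal. The Euclidean space \<open>'b\<close> is the model, so the dimension is \<open>DIM('b)\<close>. A chart
  is a pair \<open>(U, \<phi>)\<close>; the values of \<open>\<phi>\<close> outside \<open>U\<close> are irrelevant.\<close>

type_synonym ('m, 'b) atlas = "('m set \<times> ('m \<Rightarrow> 'b)) set"

definition smooth_manifold ::
  "('m::{t2_space, second_countable_topology}, 'b::euclidean_space) atlas \<Rightarrow> bool"
  where "smooth_manifold M \<longleftrightarrow>
    (\<forall>(U, \<phi>)\<in>M. open U \<and> open (\<phi> ` U) \<and> homeomorphism U (\<phi> ` U) \<phi> (inv_into U \<phi>)) \<and>
    (\<forall>p. \<exists>(U, \<phi>)\<in>M. p \<in> U) \<and>
    (\<forall>(U, \<phi>)\<in>M. \<forall>(V, \<psi>)\<in>M. smooth_on (\<phi> ` (U \<inter> V)) (\<lambda>x. \<psi> (inv_into U \<phi> x)))"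

definition smooth_functions_on ::
  "('m::{t2_space, second_countable_topology}, 'b::euclidean_space) atlas \<Rightarrow> 'm set \<Rightarrow> ('m \<Rightarrow> real) set"
  where "smooth_functions_on M W =
    {f. \<forall>(U, \<phi>)\<in>M. smooth_on (\<phi> ` (U \<inter> W)) (\<lambda>x. f (inv_into U \<phi> x))}"

definition smooth_functions ::
  "('m::{t2_space, second_countable_topology}, 'b::euclidean_space) atlas \<Rightarrow> ('m \<Rightarrow> real) set"
  where "smooth_functions M = smooth_functions_on M UNIV"


section \<open>Tangent and cotangent vectors, vector fields, differential forms\<close>

type_synonym 'm tvec = "('m \<Rightarrow> real) \<Rightarrow> real"
type_synonym 'm cvec = "'m tvec \<Rightarrow> real"

text \<open>Tangent vectors at \<open>p\<close> are the derivations of \<open>C\<^sup>\<infinity>(M)\<close> at \<open>p\<close>. They are set to \<open>0\<close> on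
  nonsmooth functions, so that equal derivations are equal as functions; in the same way covectors
  at \<open>p\<close> vanish outside the tangent space at \<open>p\<close>.\<close>

definition tangent_space ::
  "('m::{t2_space, second_countable_topology}, 'b::euclidean_space) atlas \<Rightarrow> 'm \<Rightarrow> 'm tvec set"
  where "tangent_space M p =
    {v. linear_on_subspace (smooth_functions M) v \<and>
        (\<forall>f\<in>smooth_functions M. \<forall>g\<in>smooth_functions M.
            v (\<lambda>q. f q * g q) = f p * v g + g p * v f) \<and>
        (\<forall>f. f \<notin> smooth_functions M \<longrightarrow> v f = 0)}"

definition cotangent_space ::
  "('m::{t2_space, second_countable_topology}, 'b::euclidean_space) atlas \<Rightarrow> 'm \<Rightarrow> 'm cvec set"
  where "cotangent_space M p =
    {a. linear_on_subspace (tangent_space M p) a \<and> (\<forall>v. v \<notin> tangent_space M p \<longrightarrow> a v = 0)}"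

definition vector_fields ::
  "('m::{t2_space, second_countable_topology}, 'b::euclidean_space) atlas \<Rightarrow> ('m \<Rightarrow> 'm tvec) set"
  where "vector_fields M =
    {X. (\<forall>p. X p \<in> tangent_space M p) \<and>
        (\<forall>f\<in>smooth_functions M. (\<lambda>p. X p f) \<in> smooth_functions M)}"

definition one_forms ::
  "('m::{t2_space, second_countable_topology}, 'b::euclidean_space) atlas \<Rightarrow> ('m \<Rightarrow> 'm cvec) set"
  where "one_forms M =
    {\<alpha>. (\<forall>p. \<alpha> p \<in> cotangent_space M p) \<and>
        (\<forall>X\<in>vector_fields M. (\<lambda>p. \<alpha> p (X p)) \<in> smooth_functions M)}"

text \<open>The values \<open>\<omega> p v w\<close> for \<open>v\<close> or \<open>w\<close> outside the tangent space at \<open>p\<close> are irrelevant.\<close>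

definition two_forms ::
  "('m::{t2_space, second_countable_topology}, 'b::euclidean_space) atlas \<Rightarrow>
    ('m \<Rightarrow> 'm tvec \<Rightarrow> 'm tvec \<Rightarrow> real) set"
  where "two_forms M =
    {\<omega>. (\<forall>p. \<forall>v\<in>tangent_space M p. linear_on_subspace (tangent_space M p) (\<omega> p v)) \<and>
        (\<forall>p. \<forall>v\<in>tangent_space M p. \<forall>w\<in>tangent_space M p. \<omega> p v w = - \<omega> p w v) \<and>
        (\<forall>X\<in>vector_fields M. \<forall>Y\<in>vector_fields M. (\<lambda>p. \<omega> p (X p) (Y p)) \<in> smooth_functions M)}"

text \<open>On a nonsmooth \<open>f\<close> the right-hand side is \<open>0\<close> when \<open>X\<close>, \<open>Y\<close> are vector fields, as it should.\<close>

definition lie_bracket :: "('m \<Rightarrow> 'm tvec) \<Rightarrow> ('m \<Rightarrow> 'm tvec) \<Rightarrow> 'm \<Rightarrow> 'm tvec"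
  where "lie_bracket X Y = (\<lambda>p f. X p (\<lambda>q. Y q f) - Y p (\<lambda>q. X q f))"

definition differential ::
  "('m::{t2_space, second_countable_topology}, 'b::euclidean_space) atlas \<Rightarrow>
    ('m \<Rightarrow> real) \<Rightarrow> 'm \<Rightarrow> 'm cvec"
  where "differential M f = (\<lambda>p v. if v \<in> tangent_space M p then v f else 0)"

text \<open>Exterior derivatives of 1-forms and 2-forms, evaluated on vector fields (no factors
  \<open>1/2\<close>, \<open>1/3\<close>), and the wedge product in the matching convention
  \<open>(\<alpha> \<and> \<beta>)(X, Y) = \<alpha>(X) \<beta>(Y) - \<alpha>(Y) \<beta>(X)\<close> for 1-forms.\<close>

definition ext_deriv1 ::
  "('m \<Rightarrow> 'm cvec) \<Rightarrow> ('m \<Rightarrow> 'm tvec) \<Rightarrow> ('m \<Rightarrow> 'm tvec) \<Rightarrow> 'm \<Rightarrow> real"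
  where "ext_deriv1 \<alpha> X Y p =
    X p (\<lambda>q. \<alpha> q (Y q)) - Y p (\<lambda>q. \<alpha> q (X q)) - \<alpha> p (lie_bracket X Y p)"

definition ext_deriv2 ::
  "('m \<Rightarrow> 'm tvec \<Rightarrow> 'm tvec \<Rightarrow> real) \<Rightarrow>
    ('m \<Rightarrow> 'm tvec) \<Rightarrow> ('m \<Rightarrow> 'm tvec) \<Rightarrow> ('m \<Rightarrow> 'm tvec) \<Rightarrow> 'm \<Rightarrow> real"
  where "ext_deriv2 \<omega> X Y Z p =
    X p (\<lambda>q. \<omega> q (Y q) (Z q)) - Y p (\<lambda>q. \<omega> q (X q) (Z q)) + Z p (\<lambda>q. \<omega> q (X q) (Y q))
    - \<omega> p (lie_bracket X Y p) (Z p) + \<omega> p (lie_bracket X Z p) (Y p) - \<omega> p (lie_bracket Y Z p) (X p)"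

definition wedge12 ::
  "('m \<Rightarrow> 'm cvec) \<Rightarrow> ('m \<Rightarrow> 'm tvec \<Rightarrow> 'm tvec \<Rightarrow> real) \<Rightarrow>
    ('m \<Rightarrow> 'm tvec) \<Rightarrow> ('m \<Rightarrow> 'm tvec) \<Rightarrow> ('m \<Rightarrow> 'm tvec) \<Rightarrow> 'm \<Rightarrow> real"
  where "wedge12 \<theta> \<omega> X Y Z p =
    \<theta> p (X p) * \<omega> p (Y p) (Z p) - \<theta> p (Y p) * \<omega> p (X p) (Z p) + \<theta> p (Z p) * \<omega> p (X p) (Y p)"

text \<open>The Lie derivative of a 1-form is the 1-form determined by the Leibniz rule
  \<open>X(\<beta>(Y)) = (\<L>\<^sub>X \<beta>)(Y) + \<beta>([X, Y])\<close>.\<close>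

definition lie_derivative ::
  "('m::{t2_space, second_countable_topology}, 'b::euclidean_space) atlas \<Rightarrow>
    ('m \<Rightarrow> 'm tvec) \<Rightarrow> ('m \<Rightarrow> 'm cvec) \<Rightarrow> 'm \<Rightarrow> 'm cvec"
  where "lie_derivative M X \<beta> =
    (THE \<gamma>. \<gamma> \<in> one_forms M \<and>
      (\<forall>Y\<in>vector_fields M. \<forall>p.
        X p (\<lambda>q. \<beta> q (Y q)) = \<gamma> p (Y p) + \<beta> p (lie_bracket X Y p)))"


section \<open>Vector bundles and algebroids\<close>

text \<open>A vector bundle is presented by its fibres, which are subspaces of one ambient vector space
  \<open>'e\<close> (the ambient space carries no geometric information), and by its global smooth sections.\<close>

record ('m, 'e) vbundle =
  fibre :: "'m \<Rightarrow> 'e set"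
  sections :: "('m \<Rightarrow> 'e) set"

text \<open>Global sections \<open>e 0, \<dots>, e (r - 1)\<close> that form a basis of each fibre over the open set \<open>U\<close>.\<close>

definition local_frame ::
  "('m::topological_space, 'e::real_vector) vbundle \<Rightarrow> 'm set \<Rightarrow> nat \<Rightarrow> (nat \<Rightarrow> 'm \<Rightarrow> 'e) \<Rightarrow> bool"
  where "local_frame E U r e \<longleftrightarrow>
    open U \<and> (\<forall>i<r. e i \<in> sections E) \<and>
    (\<forall>q\<in>U. inj_on (\<lambda>i. e i q) {..<r} \<and> independent ((\<lambda>i. e i q) ` {..<r}) \<and>
            span ((\<lambda>i. e i q) ` {..<r}) = fibre E q)"

text \<open>Local triviality: local frames exist near every point, and a choice of elements of the
  fibres is a smooth section iff its coefficients in all local frames are smooth. In particular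
  changes of frame are smooth. The rank is locally constant.\<close>

definition vector_bundle ::
  "('m::{t2_space, second_countable_topology}, 'b::euclidean_space) atlas \<Rightarrow>
    ('m, 'e::real_vector) vbundle \<Rightarrow> bool"
  where "vector_bundle M E \<longleftrightarrow>
    (\<forall>p. subspace (fibre E p)) \<and>
    (\<forall>p. \<exists>U r e. p \<in> U \<and> local_frame E U r e) \<and>
    (\<forall>s. s \<in> sections E \<longleftrightarrow>
      (\<forall>p. s p \<in> fibre E p) \<and>
      (\<forall>U r e. local_frame E U r e \<longrightarrow>
        (\<exists>c. (\<forall>i<r. c i \<in> smooth_functions_on M U) \<and>
             (\<forall>q\<in>U. s q = (\<Sum>i<r. c i q *\<^sub>R e i q)))))"

text \<open>Smooth vector bundle morphisms over the identity.\<close>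

definition bundle_morphism ::
  "('m, 'e::real_vector) vbundle \<Rightarrow> ('m, 'f::real_vector) vbundle \<Rightarrow> ('m \<Rightarrow> 'e \<Rightarrow> 'f) \<Rightarrow> bool"
  where "bundle_morphism E F h \<longleftrightarrow>
    (\<forall>p. h p ` fibre E p \<subseteq> fibre F p \<and> linear_on_subspace (fibre E p) (h p)) \<and>
    (\<forall>s\<in>sections E. (\<lambda>p. h p (s p)) \<in> sections F)"

definition bundle_isomorphism ::
  "('m, 'e::real_vector) vbundle \<Rightarrow> ('m, 'f::real_vector) vbundle \<Rightarrow> ('m \<Rightarrow> 'e \<Rightarrow> 'f) \<Rightarrow> bool"
  where "bundle_isomorphism E F h \<longleftrightarrow>
    bundle_morphism E F h \<and> (\<forall>p. bij_betw (h p) (fibre E p) (fibre F p)) \<and>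
    bundle_morphism F E (\<lambda>p. inv_into (fibre E p) (h p))"

definition tangent_bundle ::
  "('m::{t2_space, second_countable_topology}, 'b::euclidean_space) atlas \<Rightarrow> ('m, 'm tvec) vbundle"
  where "tangent_bundle M = \<lparr>fibre = tangent_space M, sections = vector_fields M\<rparr>"

definition cotangent_bundle ::
  "('m::{t2_space, second_countable_topology}, 'b::euclidean_space) atlas \<Rightarrow> ('m, 'm cvec) vbundle"
  where "cotangent_bundle M = \<lparr>fibre = cotangent_space M, sections = one_forms M\<rparr>"

type_synonym ('m, 'e) anchor = "'m \<Rightarrow> 'e \<Rightarrow> 'm tvec"
type_synonym ('m, 'e) bracket = "('m \<Rightarrow> 'e) \<Rightarrow> ('m \<Rightarrow> 'e) \<Rightarrow> 'm \<Rightarrow> 'e"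

definition skew_algebroid ::
  "('m::{t2_space, second_countable_topology}, 'b::euclidean_space) atlas \<Rightarrow>
    ('m, 'e::real_vector) vbundle \<Rightarrow> ('m, 'e) anchor \<Rightarrow> ('m, 'e) bracket \<Rightarrow> bool"
  where "skew_algebroid M E \<rho> br \<longleftrightarrow>
    vector_bundle M E \<and> bundle_morphism E (tangent_bundle M) \<rho> \<and>
    (\<forall>s\<in>sections E. \<forall>t\<in>sections E. br s t \<in> sections E) \<and>
    (\<forall>s\<in>sections E. \<forall>t\<in>sections E. br s t = - br t s) \<and>
    (\<forall>s\<in>sections E. linear_on_subspace (sections E) (br s)) \<and>
    (\<forall>t\<in>sections E. linear_on_subspace (sections E) (\<lambda>s. br s t)) \<and>
    (\<forall>s\<in>sections E. \<forall>t\<in>sections E. \<forall>\<phi>\<in>smooth_functions M.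
      br s (\<lambda>p. \<phi> p *\<^sub>R t p) = (\<lambda>p. \<phi> p *\<^sub>R br s t p + \<rho> p (s p) \<phi> *\<^sub>R t p))"

definition lie_algebroid ::
  "('m::{t2_space, second_countable_topology}, 'b::euclidean_space) atlas \<Rightarrow>
    ('m, 'e::real_vector) vbundle \<Rightarrow> ('m, 'e) anchor \<Rightarrow> ('m, 'e) bracket \<Rightarrow> bool"
  where "lie_algebroid M E \<rho> br \<longleftrightarrow>
    skew_algebroid M E \<rho> br \<and>
    (\<forall>s\<in>sections E. \<forall>t\<in>sections E. \<forall>u\<in>sections E.
      br s (br t u) + br t (br u s) + br u (br s t) = 0)"

definition algebroid_isomorphism ::
  "('m, 'e::real_vector) vbundle \<Rightarrow> ('m, 'e) anchor \<Rightarrow> ('m, 'e) bracket \<Rightarrow>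
    ('m, 'f::real_vector) vbundle \<Rightarrow> ('m, 'f) anchor \<Rightarrow> ('m, 'f) bracket \<Rightarrow>
    ('m \<Rightarrow> 'e \<Rightarrow> 'f) \<Rightarrow> bool"
  where "algebroid_isomorphism E \<rho> br F \<sigma> br' h \<longleftrightarrow>
    bundle_isomorphism E F h \<and>
    (\<forall>p. \<forall>u\<in>fibre E p. \<sigma> p (h p u) = \<rho> p u) \<and>
    (\<forall>s\<in>sections E. \<forall>t\<in>sections E.
      (\<lambda>p. h p (br s t p)) = br' (\<lambda>p. h p (s p)) (\<lambda>p. h p (t p)))"


section \<open>The algebroid of a bivector field, a vector field and a 1-form\<close>

text \<open>A bivector field \<open>\<pi>\<close> is given by its values \<open>\<pi> p a b\<close> on covectors \<open>a\<close>, \<open>b\<close> at \<open>p\<close>.\<close>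

definition sharp_biv ::
  "('m::{t2_space, second_countable_topology}, 'b::euclidean_space) atlas \<Rightarrow>
    ('m \<Rightarrow> 'm cvec \<Rightarrow> 'm cvec \<Rightarrow> real) \<Rightarrow> ('m, 'm cvec) anchor"
  where "sharp_biv M \<pi> p a =
    (THE v. v \<in> tangent_space M p \<and> (\<forall>b\<in>cotangent_space M p. b v = \<pi> p a b))"

definition bracket_biv ::
  "('m::{t2_space, second_countable_topology}, 'b::euclidean_space) atlas \<Rightarrow>
    ('m \<Rightarrow> 'm cvec \<Rightarrow> 'm cvec \<Rightarrow> real) \<Rightarrow> ('m, 'm cvec) bracket"
  where "bracket_biv M \<pi> \<alpha> \<beta> =
    lie_derivative M (\<lambda>p. sharp_biv M \<pi> p (\<alpha> p)) \<beta>
    - lie_derivative M (\<lambda>p. sharp_biv M \<pi> p (\<beta> p)) \<alpha>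
    - differential M (\<lambda>p. \<pi> p (\<alpha> p) (\<beta> p))"

definition sharp_biv_vec ::
  "('m::{t2_space, second_countable_topology}, 'b::euclidean_space) atlas \<Rightarrow>
    ('m \<Rightarrow> 'm cvec \<Rightarrow> 'm cvec \<Rightarrow> real) \<Rightarrow> ('m \<Rightarrow> 'm tvec) \<Rightarrow> ('m, 'm cvec) anchor"
  where "sharp_biv_vec M \<pi> \<xi> p a = sharp_biv M \<pi> p a + a (\<xi> p) *\<^sub>R \<xi> p"

definition bracket_biv_vec ::
  "('m::{t2_space, second_countable_topology}, 'b::euclidean_space) atlas \<Rightarrow>
    ('m \<Rightarrow> 'm cvec \<Rightarrow> 'm cvec \<Rightarrow> real) \<Rightarrow> ('m \<Rightarrow> 'm tvec) \<Rightarrow> ('m \<Rightarrow> 'm cvec) \<Rightarrow> ('m, 'm cvec) bracket"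
  where "bracket_biv_vec M \<pi> \<xi> \<eta> \<alpha> \<beta> = (\<lambda>p.
    bracket_biv M \<pi> \<alpha> \<beta> p
    + \<alpha> p (\<xi> p) *\<^sub>R (lie_derivative M \<xi> \<beta> p - \<beta> p)
    - \<beta> p (\<xi> p) *\<^sub>R (lie_derivative M \<xi> \<alpha> p - \<alpha> p)
    - \<pi> p (\<alpha> p) (\<beta> p) *\<^sub>R \<eta> p)"


section \<open>Locally conformally symplectic structures\<close>

definition lcs_structure ::
  "('m::{t2_space, second_countable_topology}, 'b::euclidean_space) atlas \<Rightarrow>
    ('m \<Rightarrow> 'm tvec \<Rightarrow> 'm tvec \<Rightarrow> real) \<Rightarrow> ('m \<Rightarrow> 'm cvec) \<Rightarrow> bool"
  where "lcs_structure M \<omega> \<theta> \<longleftrightarrow>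
    \<omega> \<in> two_forms M \<and>
    (\<forall>p. \<forall>v\<in>tangent_space M p. (\<forall>w\<in>tangent_space M p. \<omega> p v w = 0) \<longrightarrow> v = 0) \<and>
    \<theta> \<in> one_forms M \<and>
    (\<forall>X\<in>vector_fields M. \<forall>Y\<in>vector_fields M. \<forall>p. ext_deriv1 \<theta> X Y p = 0) \<and>
    (\<forall>X\<in>vector_fields M. \<forall>Y\<in>vector_fields M. \<forall>Z\<in>vector_fields M. \<forall>p.
      ext_deriv2 \<omega> X Y Z p + wedge12 \<theta> \<omega> X Y Z p = 0)"

definition flat_form ::
  "('m::{t2_space, second_countable_topology}, 'b::euclidean_space) atlas \<Rightarrow>
    ('m \<Rightarrow> 'm tvec \<Rightarrow> 'm tvec \<Rightarrow> real) \<Rightarrow> 'm \<Rightarrow> 'm tvec \<Rightarrow> 'm cvec"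
  where "flat_form M \<omega> p v = (\<lambda>w. if w \<in> tangent_space M p then - \<omega> p v w else 0)"

definition sharp_form ::
  "('m::{t2_space, second_countable_topology}, 'b::euclidean_space) atlas \<Rightarrow>
    ('m \<Rightarrow> 'm tvec \<Rightarrow> 'm tvec \<Rightarrow> real) \<Rightarrow> ('m, 'm cvec) anchor"
  where "sharp_form M \<omega> p = inv_into (tangent_space M p) (flat_form M \<omega> p)"

definition lcs_bivector ::
  "('m::{t2_space, second_countable_topology}, 'b::euclidean_space) atlas \<Rightarrow>
    ('m \<Rightarrow> 'm tvec \<Rightarrow> 'm tvec \<Rightarrow> real) \<Rightarrow> 'm \<Rightarrow> 'm cvec \<Rightarrow> 'm cvec \<Rightarrow> real"
  where "lcs_bivector M \<omega> p a b = \<omega> p (sharp_form M \<omega> p a) (sharp_form M \<omega> p b)"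

definition lcs_vector_field ::
  "('m::{t2_space, second_countable_topology}, 'b::euclidean_space) atlas \<Rightarrow>
    ('m \<Rightarrow> 'm tvec \<Rightarrow> 'm tvec \<Rightarrow> real) \<Rightarrow> ('m \<Rightarrow> 'm cvec) \<Rightarrow> 'm \<Rightarrow> 'm tvec"
  where "lcs_vector_field M \<omega> \<theta> p = sharp_form M \<omega> p (\<theta> p)"

end

theory Submission
  imports Defs "Jordan_Normal_Form.Determinant"
begin

text \<open>Write \<open>\<flat>(X) = - i\<^sub>X \<omega>\<close> and let \<open>\<sharp>\<close> be its inverse; then \<open>\<sharp>\<^sub>\<pi> = \<sharp>\<close>. For 1-forms \<open>\<alpha> = \<flat>(X)\<close> and
  \<open>\<beta> = \<flat>(Y)\<close> one has \<open>\<pi>(\<alpha>, \<beta>) = \<omega>(X, Y)\<close>, \<open>\<alpha>(\<xi>) = - \<theta>(X)\<close> and \<open>\<theta>(\<xi>) = 0\<close>, so that the anchor sends \<open>\<flat>(X)\<close>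
  to \<open>X - \<theta>(X) \<xi>\<close>. This map is injective on fibres, since it preserves \<open>\<theta>\<close>, and therefore the anchor
  itself is an isomorphism of vector bundles from the cotangent to the tangent bundle. It is also the
  isomorphism of algebroids. To see this, one computes with the Cartan formulas: the equation
  \<open>d\<omega> + \<theta> \<and> \<omega> = 0\<close> gives

    \<open>[\<alpha>, \<beta>]\<^sub>\<pi> - \<pi>(\<alpha>, \<beta>) \<theta> = \<flat>([X, Y]) - \<theta>(X) \<beta> + \<theta>(Y) \<alpha>\<close>   (\<open>bracket_biv_flat\<close>),

  and, together with \<open>d\<theta> = 0\<close>, that \<open>\<xi>\<close> preserves \<open>\<omega>\<close>, hence \<open>\<L>\<^sub>\<xi> \<beta> = \<flat>([\<xi>, Y])\<close>
  (\<open>lie_derivative_\<xi>_flat\<close>). In the full bracket the terms of order zero cancel, and it equals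

    \<open>\<flat>([X, Y] - \<theta>(X) [\<xi>, Y] + \<theta>(Y) [\<xi>, X])\<close>   (\<open>bracket_flat\<close>).

  The anchor maps this to the Lie bracket of \<open>X - \<theta>(X) \<xi>\<close> and \<open>Y - \<theta>(Y) \<xi>\<close>, again because \<open>\<theta>\<close> is closed
  and vanishes on \<open>\<xi>\<close> (\<open>anchor_jacobi_bracket\<close>). A bracket that such an isomorphism maps to the bracket
  of vector fields satisfies all axioms of a Lie algebroid, because vector fields do
  (\<open>lie_algebroid_by_anchor\<close>).

  Most of the text provides the differential geometry behind this computation, for tangent vectors
  that are derivations. Hadamard's lemma and bump functions yield, near each point, global functions
  and vector fields that behave like coordinates and their partial derivatives (\<open>coordinates_exist\<close>).
  Everything else rests on these and on bump functions: the tangent and the cotangent bundle are vector bundles, where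
  Cramer's rule shows that the coefficients of a section are smooth in every frame; a fibrewise
  bijective morphism has a smooth inverse (\<open>bundle_isomorphismI\<close>), which applies to \<open>\<flat>\<close> and to the
  anchor; and a functional on vector fields that is linear over the smooth functions is a 1-form
  (\<open>C_linear_one_form\<close>), which yields the Lie derivative.\<close>

(* The symbol is left to the inner product of a Euclidean space. *)
no_notation scalar_prod (infix \<open>\<bullet>\<close> 70)


section \<open>Calculus of functions of class \<open>C\<^sup>k\<close>\<close>

lemma Ck_on_cong:
  assumes "open S" and "\<And>x. x \<in> S \<Longrightarrow> f x = g x" and "Ck_on k S f"
  shows "Ck_on k S g"
  using assms(2,3)
proof (induction k arbitrary: f g)
  case 0
  then show ?case by (simp cong: continuous_on_cong)
next
  case (Suc k)
  have g: "(g has_derivative frechet_derivative f (at x)) (at x)" if "x \<in> S" for x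
  proof (rule has_derivative_transform_within_open[OF _ \<open>open S\<close> that])
    show "(f has_derivative frechet_derivative f (at x)) (at x)"
      using Suc.prems(2) that by (simp add: frechet_derivative_works[symmetric])
  qed (use Suc.prems(1) in auto)
  show ?case
    unfolding Ck_on.simps
  proof (intro conjI ballI allI)
    fix v
    show "Ck_on k S (\<lambda>x. frechet_derivative g (at x) v)"
      by (rule Suc.IH[of "\<lambda>x. frechet_derivative f (at x) v"])
        (use Suc.prems(2) in \<open>auto simp: frechet_derivative_at[OF g, symmetric]\<close>)
  qed (use g in \<open>auto simp: differentiable_def\<close>)
qed

lemma Ck_on_SucI:
  assumes "open S" and d: "\<And>x. x \<in> S \<Longrightarrow> (f has_derivative f' x) (at x)"
    and "\<And>v. Ck_on k S (\<lambda>x. f' x v)"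
  shows "Ck_on (Suc k) S f"
  unfolding Ck_on.simps
proof (intro conjI ballI allI)
  fix v
  show "Ck_on k S (\<lambda>x. frechet_derivative f (at x) v)"
    by (rule Ck_on_cong[OF assms(1) _ assms(3)[of v]]) (simp add: frechet_derivative_at[OF d, symmetric])
qed (use d in \<open>auto simp: differentiable_def\<close>)

lemma Ck_on_SucD:
  assumes "Ck_on (Suc k) S f" and "x \<in> S"
  shows "(f has_derivative frechet_derivative f (at x)) (at x)"
  using assms by (simp add: frechet_derivative_works[symmetric])

lemma Ck_on_subset: "Ck_on k S f \<Longrightarrow> T \<subseteq> S \<Longrightarrow> Ck_on k T f"
  by (induction k arbitrary: f) (auto intro: continuous_on_subset)

lemma Ck_on_localI:
  assumes "\<And>x. x \<in> S \<Longrightarrow> \<exists>T. open T \<and> x \<in> T \<and> Ck_on k T f"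
  shows "Ck_on k S f"
  using assms
proof (induction k arbitrary: f)
  case 0
  show ?case
    unfolding Ck_on.simps
  proof (rule continuous_at_imp_continuous_on, rule ballI)
    fix x assume "x \<in> S"
    with 0 obtain T where "open T" "x \<in> T" "Ck_on 0 T f" by blast
    then show "continuous (at x) f"
      by (simp add: continuous_on_eq_continuous_at)
  qed
next
  case (Suc k)
  show ?case
    unfolding Ck_on.simps
  proof (intro conjI ballI allI)
    fix v show "Ck_on k S (\<lambda>x. frechet_derivative f (at x) v)"
      by (rule Suc.IH) (use Suc.prems in fastforce)
  qed (use Suc.prems in fastforce)
qed

lemma Ck_on_Suc_imp: "Ck_on (Suc k) S f \<Longrightarrow> Ck_on k S f"
proof (induction k arbitrary: f)
  case 0
  then show ?case
    by (auto intro!: continuous_at_imp_continuous_on differentiable_imp_continuous_within)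
next
  case (Suc k)
  then show ?case by (metis Ck_on.simps(2))
qed

lemma Ck_on_imp_continuous_on: "Ck_on k S f \<Longrightarrow> continuous_on S f"
  by (induction k) (auto dest: Ck_on_Suc_imp simp del: Ck_on.simps(2))

lemma Ck_on_const: "Ck_on k S (\<lambda>x. c)"
  by (induction k arbitrary: c) (auto simp: frechet_derivative_const)

lemma Ck_on_bounded_linear: 
  assumes "bounded_linear L" "open S" shows "Ck_on k S L"
proof (cases k)
  case 0
  then show ?thesis using assms by (simp add: linear_continuous_on)
next
  case (Suc m)
  show ?thesis
    unfolding Suc
    by (rule Ck_on_SucI[where f' = "\<lambda>x. L"])
      (use assms in \<open>auto intro: bounded_linear_imp_has_derivative Ck_on_const\<close>)
qed

lemma Ck_on_bounded_linear_compose: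
  assumes "bounded_linear L" "open S" "Ck_on k S f" shows "Ck_on k S (\<lambda>x. L (f x))"
  using assms(3)
proof (induction k arbitrary: f)
  case 0
  then show ?case using assms(1) by (auto intro: bounded_linear.continuous_on)
next
  case (Suc k)
  show ?case
  proof (rule Ck_on_SucI[where f' = "\<lambda>x v. L (frechet_derivative f (at x) v)", OF \<open>open S\<close>])
    show "((\<lambda>x. L (f x)) has_derivative (\<lambda>v. L (frechet_derivative f (at x) v))) (at x)" if "x \<in> S" for x
      by (rule bounded_linear.has_derivative[OF assms(1) Ck_on_SucD[OF Suc.prems that]])
  qed (use Suc in auto)
qed

lemma Ck_on_add:
  assumes "open S" "Ck_on k S f" "Ck_on k S g" shows "Ck_on k S (\<lambda>x. f x + g x)"
  using assms(2,3)
proof (induction k arbitrary: f g)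
  case 0
  then show ?case by (auto intro: continuous_intros)
next
  case (Suc k)
  show ?case
    by (rule Ck_on_SucI[OF \<open>open S\<close> has_derivative_add[OF Ck_on_SucD[OF Suc.prems(1)] Ck_on_SucD[OF Suc.prems(2)]]])
      (use Suc in auto)
qed

lemma Ck_on_sum:
  assumes "open S" "\<And>i. i \<in> I \<Longrightarrow> Ck_on k S (f i)" shows "Ck_on k S (\<lambda>x. \<Sum>i\<in>I. f i x)"
  using assms(2)
  by (induction I rule: infinite_finite_induct) (auto intro: Ck_on_const Ck_on_add[OF \<open>open S\<close>])

lemma Ck_on_mult:
  fixes f g :: "'a::real_normed_vector \<Rightarrow> real"
  assumes "open S" "Ck_on k S f" "Ck_on k S g" shows "Ck_on k S (\<lambda>x. f x * g x)"
  using assms(2,3)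
proof (induction k arbitrary: f g)
  case 0
  then show ?case by (auto intro: continuous_intros)
next
  case (Suc k)
  note lower = Suc.prems[THEN Ck_on_Suc_imp]
  have d: "Ck_on k S (\<lambda>x. frechet_derivative f (at x) v)" "Ck_on k S (\<lambda>x. frechet_derivative g (at x) v)" for v
    using Suc.prems by simp_all
  show ?case
    by (rule Ck_on_SucI[OF \<open>open S\<close> has_derivative_mult[OF Ck_on_SucD[OF Suc.prems(1)] Ck_on_SucD[OF Suc.prems(2)]]])
      (intro Ck_on_add[OF \<open>open S\<close>] Suc.IH lower d | assumption)+
qed

lemma Ck_on_inverse:
  fixes f :: "'a::real_normed_vector \<Rightarrow> real"
  assumes "open S" "Ck_on k S f" "\<And>x. x \<in> S \<Longrightarrow> f x \<noteq> 0" shows "Ck_on k S (\<lambda>x. inverse (f x))"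
  using assms(2)
proof (induction k)
  case 0
  then show ?case using assms(3) by (auto intro: continuous_intros)
next
  case (Suc k)
  then have i: "Ck_on k S (\<lambda>x. inverse (f x))" by (blast dest: Ck_on_Suc_imp)
  have d: "Ck_on k S (\<lambda>x. frechet_derivative f (at x) v)" for v
    using Suc.prems by simp
  have "Ck_on k S (\<lambda>x. (-1) * (inverse (f x) * frechet_derivative f (at x) v * inverse (f x)))" for v
    by (intro Ck_on_mult \<open>open S\<close> Ck_on_const i d)
  then show ?case
    by (intro Ck_on_SucI[OF \<open>open S\<close> Deriv.has_derivative_inverse[OF _ Ck_on_SucD[OF Suc.prems]]])
      (use assms(3) in auto)
qed

text \<open>The chain rule writes the derivative of a composition in terms of the partial derivatives of
  the outer function, so that composition reduces to sums and products of functions with one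
  derivative less.\<close>

lemma Ck_on_compose:
  fixes g :: "'a::real_normed_vector \<Rightarrow> 'c::euclidean_space" and f :: "'c \<Rightarrow> real"
  assumes "open S" "open T" "g ` S \<subseteq> T" "Ck_on k T f" "Ck_on k S g"
  shows "Ck_on k S (\<lambda>x. f (g x))"
  using assms(4,5)
proof (induction k arbitrary: f)
  case 0
  then show ?case using assms(3) by (auto intro: continuous_on_compose2)
next
  case (Suc k)
  let ?f' = "\<lambda>y. frechet_derivative f (at y)" and ?g' = "\<lambda>x. frechet_derivative g (at x)"
  have expand: "?f' (g x) (?g' x v) = (\<Sum>b\<in>Basis. (?g' x v \<bullet> b) * ?f' (g x) b)" if "x \<in> S" for x v
  proof -
    have "linear (?f' (g x))"
      using Suc.prems(1) that assms(3) by (intro linear_frechet_derivative) auto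
    then have "?f' (g x) (\<Sum>b\<in>Basis. (?g' x v \<bullet> b) *\<^sub>R b) = (\<Sum>b\<in>Basis. (?g' x v \<bullet> b) * ?f' (g x) b)"
      by (simp add: linear_sum linear_scale)
    then show ?thesis by (simp add: euclidean_representation)
  qed
  show ?case
  proof (rule Ck_on_SucI[OF \<open>open S\<close>, where f' = "\<lambda>x v. \<Sum>b\<in>Basis. (?g' x v \<bullet> b) * ?f' (g x) b"])
    fix x assume x: "x \<in> S"
    have "((\<lambda>x. f (g x)) has_derivative (\<lambda>v. ?f' (g x) (?g' x v))) (at x)"
      by (rule has_derivative_compose[OF Ck_on_SucD[OF Suc.prems(2) x] Ck_on_SucD[OF Suc.prems(1)]])
        (use x assms(3) in auto)
    then show "((\<lambda>x. f (g x)) has_derivative (\<lambda>v. \<Sum>b\<in>Basis. (?g' x v \<bullet> b) * ?f' (g x) b)) (at x)"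
      using expand[OF x] by simp
  next
    fix v
    have d: "Ck_on k S (\<lambda>x. ?g' x v)" "\<And>b. Ck_on k T (\<lambda>y. ?f' y b)"
      using Suc.prems unfolding Ck_on.simps by blast+
    have 1: "Ck_on k S (\<lambda>x. ?g' x v \<bullet> b)" for b
      by (rule Ck_on_bounded_linear_compose[OF bounded_linear_inner_left \<open>open S\<close> d(1)])
    have 2: "Ck_on k S (\<lambda>x. ?f' (g x) b)" for b
      by (rule Suc.IH[OF d(2) Ck_on_Suc_imp[OF Suc.prems(2)]])
    show "Ck_on k S (\<lambda>x. \<Sum>b\<in>Basis. (?g' x v \<bullet> b) * ?f' (g x) b)"
      by (intro Ck_on_sum Ck_on_mult \<open>open S\<close> 1 2)
  qed
qed

lemma smooth_on_partial: "smooth_on S f \<Longrightarrow> smooth_on S (\<lambda>x. frechet_derivative f (at x) v)"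
  unfolding smooth_on_def using Ck_on.simps(2) by blast


section \<open>Bump functions on a Euclidean space\<close>

text \<open>The derivatives of \<open>exp (-1/t)\<close> are combinations of the functions \<open>t\<^sup>-\<^sup>n exp (-1/t)\<close>, a
  family with span closed under differentiation; all its members tend to \<open>0\<close> as \<open>t\<close> decreases to \<open>0\<close>.\<close>

definition flat_exp :: "nat \<Rightarrow> real \<Rightarrow> real"
  where "flat_exp n t = (if t > 0 then inverse t ^ n * exp (- inverse t) else 0)"

lemma flat_exp_has_derivative:
  "(flat_exp n has_real_derivative (flat_exp (n + 2) t - n * flat_exp (Suc n) t)) (at t)"
proof -
  consider "t > 0" | "t < 0" | "t = 0" by linarith
  then show ?thesis
  proof cases
    case 1
    have "((\<lambda>t. inverse t ^ n * exp (- inverse t)) has_real_derivative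
        (flat_exp (n + 2) t - n * flat_exp (Suc n) t)) (at t)"
    proof -
      have i: "(inverse has_real_derivative - (inverse t * inverse t)) (at t)"
        using 1 by (auto intro!: derivative_eq_intros simp: power2_eq_square)
      have "real n * inverse t ^ (n - Suc 0) * inverse t = real n * inverse t ^ n"
        by (cases n) auto
      then have "real n * (- (inverse t * inverse t) * inverse t ^ (n - Suc 0)) * exp (- inverse t)
          + exp (- inverse t) * - (- (inverse t * inverse t)) * inverse t ^ n
        = flat_exp (n + 2) t - real n * flat_exp (Suc n) t"
        using 1 by (auto simp: flat_exp_def algebra_simps power2_eq_square)
      then show ?thesis
        by (rule DERIV_cong[OF DERIV_mult[OF DERIV_power[OF i] DERIV_fun_exp[OF DERIV_minus[OF i]]]])
    qed
    then show ?thesis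
      by (rule DERIV_cong_ev[THEN iffD1, rotated -1])
        (use 1 in \<open>auto simp: flat_exp_def intro: eventually_mono[OF eventually_nhds_in_open[of "{0<..}"]]\<close>)
  next
    case 2
    have "((\<lambda>t. 0) has_real_derivative (flat_exp (n + 2) t - n * flat_exp (Suc n) t)) (at t)"
      using 2 by (simp add: flat_exp_def)
    then show ?thesis
      by (rule DERIV_cong_ev[THEN iffD1, rotated -1])
        (use 2 in \<open>auto simp: flat_exp_def intro: eventually_mono[OF eventually_nhds_in_open[of "{..<0}"]]\<close>)
  next
    case 3
    have "((\<lambda>h::real. inverse h ^ Suc n / exp (inverse h)) \<longlongrightarrow> 0) (at_right 0)"
      by (rule filterlim_compose[OF tendsto_power_div_exp_0 filterlim_inverse_at_top_right])
    then have "((\<lambda>h. inverse h ^ n * exp (- inverse h) / h) \<longlongrightarrow> 0) (at_right (0::real))"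
      by (simp add: exp_minus divide_inverse mult_ac)
    then have "((\<lambda>h. flat_exp n h / h) \<longlongrightarrow> 0) (at_right 0)"
      by (rule Lim_transform_eventually) (auto simp: flat_exp_def eventually_at_right_less intro: eventually_mono[OF eventually_at_right_less])
    moreover have "((\<lambda>h. flat_exp n h / h) \<longlongrightarrow> 0) (at_left 0)"
      by (rule Lim_transform_eventually[OF tendsto_const])
        (auto simp: flat_exp_def eventually_at_filter)
    ultimately have "((\<lambda>h. flat_exp n h / h) \<longlongrightarrow> 0) (at 0)"
      by (simp add: filterlim_split_at)
    with 3 show ?thesis by (simp add: DERIV_def flat_exp_def)
  qed
qed

lemma Ck_on_flat_exp: "Ck_on k UNIV (flat_exp n)"
proof (induction k arbitrary: n)
  case 0
  have "continuous (at t) (flat_exp n)" for t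
    by (rule DERIV_isCont[OF flat_exp_has_derivative])
  then show ?case by (auto intro: continuous_at_imp_continuous_on)
next
  case (Suc k)
  show ?case
  proof (rule Ck_on_SucI[OF open_UNIV])
    show "(flat_exp n has_derivative (\<lambda>v. (flat_exp (n + 2) t + (- real n) * flat_exp (Suc n) t) * v)) (at t)" for t
      using flat_exp_has_derivative[of n t] by (simp add: has_field_derivative_def)
    show "Ck_on k UNIV (\<lambda>t. (flat_exp (n + 2) t + (- real n) * flat_exp (Suc n) t) * v)" for v
      by (intro Ck_on_mult Ck_on_add Ck_on_const open_UNIV Suc.IH)
  qed
qed

lemma euclidean_bump:
  fixes a :: "'a::euclidean_space" and r :: real
  assumes "r > 0"
  obtains \<kappa> :: "'a \<Rightarrow> real" where "smooth_on UNIV \<kappa>"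
    "\<And>x. norm (x - a) \<le> r \<Longrightarrow> \<kappa> x = 1" "\<And>x. norm (x - a) \<ge> 2 * r \<Longrightarrow> \<kappa> x = 0"
proof -
  let ?e = "flat_exp 0"
  \<comment> \<open>\<open>s \<mapsto> ?e s / (?e s + ?e (1 - s))\<close> is a smooth step from \<open>0\<close> (for \<open>s \<le> 0\<close>) to \<open>1\<close> (for \<open>s \<ge> 1\<close>);
    \<open>N\<close> is a polynomial that is at least \<open>1\<close> on the small ball and at most \<open>0\<close> outside the large one.\<close>
  define N :: "'a \<Rightarrow> real" where "N = (\<lambda>x. 2 + (- inverse (r\<^sup>2)) * (\<Sum>b\<in>Basis. ((x + (- a)) \<bullet> b) * ((x + (- a)) \<bullet> b)))"
  define M where "M = (\<lambda>x. 1 + (-1) * N x)"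
  have pos: "?e s + ?e (1 + (-1) * s) > 0" for s
    by (cases "s > 0") (auto simp: flat_exp_def add_pos_nonneg)
  have N: "N x = 2 - (norm (x - a))\<^sup>2 / r\<^sup>2" for x
    by (simp add: N_def power2_norm_eq_inner euclidean_inner[of "x - a" "x - a"] divide_inverse)
  have CN: "Ck_on k UNIV N" for k
    unfolding N_def
    by (intro Ck_on_add Ck_on_mult Ck_on_const Ck_on_sum open_UNIV
        Ck_on_bounded_linear_compose[OF bounded_linear_inner_left]
        Ck_on_bounded_linear[OF bounded_linear_ident])
  have CM: "Ck_on k UNIV M" for k
    unfolding M_def by (intro Ck_on_add Ck_on_mult Ck_on_const CN open_UNIV)
  have Ce: "Ck_on k UNIV (\<lambda>x. ?e (G x))" if "Ck_on k UNIV G" for k and G :: "'a \<Rightarrow> real"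
    by (rule Ck_on_compose[OF open_UNIV open_UNIV subset_UNIV Ck_on_flat_exp that])
  let ?\<kappa> = "\<lambda>x. ?e (N x) * inverse (?e (N x) + ?e (M x))"
  show ?thesis
  proof
    show "smooth_on UNIV ?\<kappa>"
      unfolding smooth_on_def
    proof
      fix k
      show "Ck_on k UNIV ?\<kappa>"
        by (intro Ck_on_mult Ck_on_inverse Ck_on_add Ce CN CM open_UNIV) (use pos[of "N _"] in \<open>auto simp: M_def less_le\<close>)
    qed
  next
    fix x assume "norm (x - a) \<le> r"
    then have "(norm (x - a))\<^sup>2 / r\<^sup>2 \<le> 1" using \<open>r > 0\<close> by (simp add: power_mono)
    then have "N x \<ge> 1" by (simp add: N)
    then show "?\<kappa> x = 1" by (simp add: M_def flat_exp_def)
  next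
    fix x assume "norm (x - a) \<ge> 2 * r"
    then have "(2 * r)\<^sup>2 \<le> (norm (x - a))\<^sup>2" using \<open>r > 0\<close> by (intro power_mono) auto
    then have "(norm (x - a))\<^sup>2 / r\<^sup>2 \<ge> 4" using \<open>r > 0\<close> by (simp add: field_simps power2_eq_square)
    then have "N x \<le> 0" by (simp add: N)
    then show "?\<kappa> x = 0" by (simp add: flat_exp_def)
  qed
qed


section \<open>Hadamard's lemma\<close>

lemma ball_radial:
  fixes a :: "'a::real_normed_vector"
  assumes "x \<in> ball a r" "t \<in> {0..1}"
  shows "a + t *\<^sub>R (x - a) \<in> ball a r"
proof -
  have "norm (t *\<^sub>R (x - a)) \<le> norm (x - a)"
    using assms(2) by (simp add: mult_left_le_one_le)
  then show ?thesis using assms(1) by (simp add: dist_norm norm_minus_commute)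
qed

text \<open>Differentiation under the integral sign; the weight \<open>t\<^sup>m\<close> absorbs the factor \<open>t\<close> that the
  chain rule produces.\<close>

lemma Ck_on_radial_integral:
  fixes h :: "'a::euclidean_space \<Rightarrow> real"
  assumes "Ck_on k (ball a r) h"
  shows "Ck_on k (ball a r) (\<lambda>x. integral {0..1} (\<lambda>t. t ^ m * h (a + t *\<^sub>R (x - a))))"
  using assms
proof (induction k arbitrary: h m)
  case 0
  have "continuous_on (ball a r \<times> cbox 0 (1::real)) (\<lambda>(x, t). t ^ m * h (a + t *\<^sub>R (x - a)))"
    unfolding split_beta
    by (intro continuous_intros continuous_on_compose2[OF 0[unfolded Ck_on.simps]])
      (auto intro!: ball_radial simp del: mem_ball)
  then have "continuous_on (ball a r) (\<lambda>x. integral (cbox 0 1) (\<lambda>t. t ^ m * h (a + t *\<^sub>R (x - a))))"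
    by (rule integral_continuous_on_param)
  then show ?case by simp
next
  case (Suc k)
  let ?h' = "\<lambda>y. frechet_derivative h (at y)"
  let ?F = "\<lambda>x t. t ^ m * h (a + t *\<^sub>R (x - a))"
  define D where "D = (\<lambda>x t. Blinfun (\<lambda>v. t ^ Suc m * ?h' (a + t *\<^sub>R (x - a)) v))"
  note in_ball = ball_radial[of _ a r]
  have bl: "bounded_linear (?h' y)" if "y \<in> ball a r" for y
    by (rule has_derivative_bounded_linear[OF Ck_on_SucD[OF Suc.prems that]])
  have D: "blinfun_apply (D x t) = (\<lambda>v. t ^ Suc m * ?h' (a + t *\<^sub>R (x - a)) v)"
    if "x \<in> ball a r" "t \<in> {0..1}" for x t
    unfolding D_def
    by (intro bounded_linear_Blinfun_apply bounded_linear_const_mult bl in_ball that)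
  have der: "((\<lambda>x. ?F x t) has_derivative blinfun_apply (D x t)) (at x)"
    if xt: "x \<in> ball a r" "t \<in> {0..1}" for x t
  proof -
    have "((\<lambda>x. a + t *\<^sub>R (x - a)) has_derivative (\<lambda>v. t *\<^sub>R v)) (at x)"
      by (auto intro!: derivative_eq_intros)
    from has_derivative_compose[OF this Ck_on_SucD[OF Suc.prems in_ball[OF xt]]]
    have "((\<lambda>x. h (a + t *\<^sub>R (x - a))) has_derivative (\<lambda>v. ?h' (a + t *\<^sub>R (x - a)) (t *\<^sub>R v))) (at x)" .
    moreover have "linear (?h' (a + t *\<^sub>R (x - a)))"
      using Suc.prems in_ball[OF xt] by (intro linear_frechet_derivative) auto
    ultimately have "((\<lambda>x. h (a + t *\<^sub>R (x - a))) has_derivative (\<lambda>v. t * ?h' (a + t *\<^sub>R (x - a)) v)) (at x)"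
      by (simp add: linear_scale)
    from has_derivative_mult_right[OF this, of "t ^ m"] show ?thesis
      by (simp add: D[OF xt] algebra_simps)
  qed
  have part: "continuous_on (ball a r) (\<lambda>y. ?h' y i)" for i
    using Suc.prems by (auto intro: Ck_on_imp_continuous_on)
  have cont_D: "continuous_on (ball a r \<times> cbox 0 (1::real)) (\<lambda>(x, t). D x t)"
    unfolding split_beta
  proof (rule continuous_on_blinfun_componentwise)
    fix i
    have "continuous_on (ball a r \<times> cbox 0 (1::real))
        (\<lambda>z. snd z ^ Suc m * ?h' (a + snd z *\<^sub>R (fst z - a)) i)"
      by (intro continuous_intros continuous_on_compose2[OF part])
        (auto intro!: ball_radial simp del: mem_ball)
    then show "continuous_on (ball a r \<times> cbox 0 (1::real)) (\<lambda>z. blinfun_apply (D (fst z) (snd z)) i)"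
      by (rule continuous_on_eq) (auto simp: D simp del: mem_ball)
  qed
  have int_D: "D x integrable_on {0..1}" if "x \<in> ball a r" for x
  proof -
    have "continuous_on (cbox 0 1) (\<lambda>t. (\<lambda>(x, t). D x t) (x, t))"
      by (rule continuous_on_compose2[OF cont_D]) (use that in \<open>auto intro!: continuous_intros\<close>)
    then have "continuous_on (cbox 0 1) (D x)" by simp
    then show ?thesis using integrable_continuous by fastforce
  qed
  have cont_F: "continuous_on {0..1} (?F x)" if "x \<in> ball a r" for x
    by (intro continuous_intros continuous_on_compose2[OF Ck_on_imp_continuous_on[OF Suc.prems]])
      (auto intro!: ball_radial that simp del: mem_ball)
  show ?case
  proof (rule Ck_on_SucI[OF open_ball])
    fix x assume x: "x \<in> ball a r"
    have "((\<lambda>x. integral (cbox 0 1) (?F x)) has_derivative blinfun_apply (integral (cbox 0 1) (D x))) (at x within ball a r)"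
    proof (rule leibniz_rule)
      fix x t assume "x \<in> ball a r" "t \<in> cbox (0::real) 1"
      then show "((\<lambda>x. ?F x t) has_derivative blinfun_apply (D x t)) (at x within ball a r)"
        using der by (auto intro: has_derivative_at_withinI)
    next
      fix x assume "x \<in> ball a r"
      then show "?F x integrable_on cbox 0 1"
        using cont_F integrable_continuous_real by fastforce
    qed (use x cont_D in auto)
    then show "((\<lambda>x. integral {0..1} (?F x)) has_derivative
        (\<lambda>v. integral {0..1} (\<lambda>t. blinfun_apply (D x t) v))) (at x)"
      unfolding blinfun_apply_integral[OF int_D[OF x], symmetric]
      by (simp add: at_within_open[OF x open_ball])
  next
    fix v
    have "Ck_on k (ball a r) (\<lambda>x. integral {0..1} (\<lambda>t. t ^ Suc m * ?h' (a + t *\<^sub>R (x - a)) v))"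
      using Suc.prems by (intro Suc.IH) auto
    then show "Ck_on k (ball a r) (\<lambda>x. integral {0..1} (\<lambda>t. blinfun_apply (D x t) v))"
      by (rule Ck_on_cong[OF open_ball, rotated]) (auto simp: D intro!: integral_cong simp del: mem_ball)
  qed
qed

text \<open>Integrate the derivative of \<open>h\<close> along the segment from \<open>a\<close> to \<open>x\<close>.\<close>

lemma hadamard:
  fixes h :: "'a::euclidean_space \<Rightarrow> real"
  assumes h: "smooth_on (ball a r) h"
  obtains g where "\<And>b. smooth_on (ball a r) (g b)"
    "\<And>x. x \<in> ball a r \<Longrightarrow> h x = h a + (\<Sum>b\<in>Basis. ((x - a) \<bullet> b) * g b x)"
proof
  let ?h' = "\<lambda>y. frechet_derivative h (at y)"
  let ?g = "\<lambda>b x. integral {0..1} (\<lambda>t. t ^ 0 * ?h' (a + t *\<^sub>R (x - a)) b)"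
  have part: "smooth_on (ball a r) (\<lambda>y. ?h' y b)" for b
    by (rule smooth_on_partial[OF h])
  show "smooth_on (ball a r) (?g b)" for b
    unfolding smooth_on_def
    by (intro allI Ck_on_radial_integral part[unfolded smooth_on_def, rule_format])
  fix x assume x: "x \<in> ball a r"
  have C1: "Ck_on (Suc 0) (ball a r) h" using h unfolding smooth_on_def by blast
  note in_ball = ball_radial[OF x]
  have lin: "linear (?h' y)" if "y \<in> ball a r" for y
    using C1 that by (intro linear_frechet_derivative) auto
  have d: "((\<lambda>t. h (a + t *\<^sub>R (x - a))) has_vector_derivative ?h' (a + t *\<^sub>R (x - a)) (x - a)) (at t within {0..1})"
    if t: "t \<in> {0..1}" for t
  proof -
    have "((\<lambda>t. a + t *\<^sub>R (x - a)) has_derivative (\<lambda>s. s *\<^sub>R (x - a))) (at t)"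
      by (auto intro!: derivative_eq_intros)
    from has_derivative_compose[OF this Ck_on_SucD[OF C1 in_ball[OF t]]] show ?thesis
      using lin[OF in_ball[OF t]]
      by (auto simp: has_vector_derivative_def linear_scale intro: has_derivative_at_withinI)
  qed
  have "((\<lambda>t. ?h' (a + t *\<^sub>R (x - a)) (x - a)) has_integral (h (a + 1 *\<^sub>R (x - a)) - h (a + 0 *\<^sub>R (x - a)))) {0..1}"
    by (rule fundamental_theorem_of_calculus) (use d in auto)
  then have "h x - h a = integral {0..1} (\<lambda>t. ?h' (a + t *\<^sub>R (x - a)) (x - a))"
    by (simp add: integral_unique)
  also have "\<dots> = integral {0..1} (\<lambda>t. \<Sum>b\<in>Basis. ((x - a) \<bullet> b) * ?h' (a + t *\<^sub>R (x - a)) b)"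
  proof (rule integral_cong)
    fix t :: real assume "t \<in> {0..1}"
    from lin[OF in_ball[OF this]]
    have "?h' (a + t *\<^sub>R (x - a)) (\<Sum>b\<in>Basis. ((x - a) \<bullet> b) *\<^sub>R b) = (\<Sum>b\<in>Basis. ((x - a) \<bullet> b) * ?h' (a + t *\<^sub>R (x - a)) b)"
      by (simp add: linear_sum linear_scale)
    then show "?h' (a + t *\<^sub>R (x - a)) (x - a) = (\<Sum>b\<in>Basis. ((x - a) \<bullet> b) * ?h' (a + t *\<^sub>R (x - a)) b)"
      by (simp add: euclidean_representation)
  qed
  also have "\<dots> = (\<Sum>b\<in>Basis. integral {0..1} (\<lambda>t. ((x - a) \<bullet> b) * ?h' (a + t *\<^sub>R (x - a)) b))"
  proof (rule integral_sum)
    fix b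
    have part_cont: "continuous_on (ball a r) (\<lambda>y. ?h' y b)"
      using part[of b] unfolding smooth_on_def by (metis Ck_on.simps(1))
    have "continuous_on {0..1} (\<lambda>t. ((x - a) \<bullet> b) * ?h' (a + t *\<^sub>R (x - a)) b)"
      by (intro continuous_intros continuous_on_compose2[OF part_cont])
        (auto intro!: in_ball simp del: mem_ball)
    then show "(\<lambda>t. ((x - a) \<bullet> b) * ?h' (a + t *\<^sub>R (x - a)) b) integrable_on {0..1}"
      by (rule integrable_continuous_real)
  qed simp
  finally show "h x = h a + (\<Sum>b\<in>Basis. ((x - a) \<bullet> b) * ?g b x)" by simp
qed


section \<open>Smooth functions on a manifold\<close>

locale manifold =
  fixes M :: "('m::{t2_space, second_countable_topology}, 'b::euclidean_space) atlas"
  assumes smooth_manifold: "smooth_manifold M"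
begin

abbreviation "C \<equiv> smooth_functions M"
abbreviation "C_on \<equiv> smooth_functions_on M"
abbreviation "T \<equiv> tangent_space M"
abbreviation "T' \<equiv> cotangent_space M"
abbreviation "\<X> \<equiv> vector_fields M"
abbreviation "\<Omega> \<equiv> one_forms M"

lemma chart_homeomorphism:
  assumes "(U, \<phi>) \<in> M"
  shows "open U" "open (\<phi> ` U)" "continuous_on U \<phi>" "continuous_on (\<phi> ` U) (inv_into U \<phi>)"
    "\<And>q. q \<in> U \<Longrightarrow> inv_into U \<phi> (\<phi> q) = q"
proof -
  have "\<forall>(U, \<phi>)\<in>M. open U \<and> open (\<phi> ` U) \<and> homeomorphism U (\<phi> ` U) \<phi> (inv_into U \<phi>)"
    using smooth_manifold unfolding smooth_manifold_def by (rule conjunct1)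
  from bspec[OF this assms]
  have h: "open U" "open (\<phi> ` U)" "homeomorphism U (\<phi> ` U) \<phi> (inv_into U \<phi>)" by auto
  show "open U" "open (\<phi> ` U)" by (rule h)+
  show "continuous_on U \<phi>" "continuous_on (\<phi> ` U) (inv_into U \<phi>)"
    "\<And>q. q \<in> U \<Longrightarrow> inv_into U \<phi> (\<phi> q) = q"
    using h(3) by (auto simp: homeomorphism_def)
qed

lemma chart_at:
  obtains U \<phi> where "(U, \<phi>) \<in> M" "p \<in> U"
  using smooth_manifold unfolding smooth_manifold_def by blast

lemma chart_transition:
  "(U, \<phi>) \<in> M \<Longrightarrow> (V, \<psi>) \<in> M \<Longrightarrow> smooth_on (\<phi> ` (U \<inter> V)) (\<lambda>x. \<psi> (inv_into U \<phi> x))"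
  using smooth_manifold unfolding smooth_manifold_def by fast

lemma open_chart_image:
  assumes "(U, \<phi>) \<in> M" "open W"
  shows "open (\<phi> ` (U \<inter> W))"
proof -
  have "\<phi> ` (U \<inter> W) = \<phi> ` U \<inter> inv_into U \<phi> -` W"
    by (auto simp: chart_homeomorphism(5)[OF assms(1)])
  then show ?thesis
    using continuous_open_preimage[OF chart_homeomorphism(4,2)[OF assms(1)] assms(2)] by simp
qed

lemma open_chart_preimage:
  assumes "(U, \<phi>) \<in> M" "open B"
  shows "open (U \<inter> \<phi> -` B)"
  using continuous_open_preimage[OF chart_homeomorphism(3,1)[OF assms(1)] assms(2)] .

lemma C_onD:
  "f \<in> C_on W \<Longrightarrow> (U, \<phi>) \<in> M \<Longrightarrow> smooth_on (\<phi> ` (U \<inter> W)) (\<lambda>x. f (inv_into U \<phi> x))"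
  unfolding smooth_functions_on_def by blast

lemma C_onI:
  assumes "\<And>U \<phi> k. (U, \<phi>) \<in> M \<Longrightarrow> Ck_on k (\<phi> ` (U \<inter> W)) (\<lambda>x. f (inv_into U \<phi> x))"
  shows "f \<in> C_on W"
  using assms unfolding smooth_functions_on_def smooth_on_def by blast

lemma C_on_Ck:
  "f \<in> C_on W \<Longrightarrow> (U, \<phi>) \<in> M \<Longrightarrow> Ck_on k (\<phi> ` (U \<inter> W)) (\<lambda>x. f (inv_into U \<phi> x))"
  using C_onD unfolding smooth_on_def by blast

lemma C_eq: "C = C_on UNIV"
  by (simp add: smooth_functions_def)

lemma C_on_subset: "f \<in> C_on W \<Longrightarrow> W' \<subseteq> W \<Longrightarrow> f \<in> C_on W'"
  by (rule C_onI) (rule Ck_on_subset[OF C_on_Ck], auto)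

lemma C_imp_C_on: "f \<in> C \<Longrightarrow> f \<in> C_on W"
  unfolding C_eq by (rule C_on_subset) auto

lemma C_on_const: "(\<lambda>q. c) \<in> C_on W"
  by (rule C_onI) (rule Ck_on_const)

lemma C_on_add: "open W \<Longrightarrow> f \<in> C_on W \<Longrightarrow> g \<in> C_on W \<Longrightarrow> (\<lambda>q. f q + g q) \<in> C_on W"
  by (rule C_onI) (intro Ck_on_add open_chart_image C_on_Ck)

lemma C_on_mult: "open W \<Longrightarrow> f \<in> C_on W \<Longrightarrow> g \<in> C_on W \<Longrightarrow> (\<lambda>q. f q * g q) \<in> C_on W"
  by (rule C_onI) (intro Ck_on_mult open_chart_image C_on_Ck)

lemma C_on_minus: "open W \<Longrightarrow> f \<in> C_on W \<Longrightarrow> (\<lambda>q. - f q) \<in> C_on W"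
  using C_on_mult[OF _ C_on_const[of "-1"]] by simp

lemma C_on_diff: "open W \<Longrightarrow> f \<in> C_on W \<Longrightarrow> g \<in> C_on W \<Longrightarrow> (\<lambda>q. f q - g q) \<in> C_on W"
  using C_on_add[OF _ _ C_on_minus] by simp

lemma C_on_sum: "open W \<Longrightarrow> (\<And>i. i \<in> I \<Longrightarrow> f i \<in> C_on W) \<Longrightarrow> (\<lambda>q. \<Sum>i\<in>I. f i q) \<in> C_on W"
  by (induction I rule: infinite_finite_induct) (auto intro: C_on_const C_on_add)

lemma C_on_prod: "open W \<Longrightarrow> (\<And>i. i \<in> I \<Longrightarrow> f i \<in> C_on W) \<Longrightarrow> (\<lambda>q. \<Prod>i\<in>I. f i q) \<in> C_on W"
  by (induction I rule: infinite_finite_induct) (auto intro: C_on_const C_on_mult)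

lemma C_on_inverse:
  assumes "open W" "f \<in> C_on W" "\<And>q. q \<in> W \<Longrightarrow> f q \<noteq> 0"
  shows "(\<lambda>q. inverse (f q)) \<in> C_on W"
  by (rule C_onI, rule Ck_on_inverse[OF open_chart_image C_on_Ck])
    (use assms in \<open>auto simp: chart_homeomorphism(5)\<close>)

lemmas C_const = C_on_const[of _ UNIV, folded C_eq]
  and C_add = C_on_add[OF open_UNIV, folded C_eq]
  and C_mult = C_on_mult[OF open_UNIV, folded C_eq]
  and C_minus = C_on_minus[OF open_UNIV, folded C_eq]
  and C_diff = C_on_diff[OF open_UNIV, folded C_eq]
  and C_sum = C_on_sum[OF open_UNIV, folded C_eq]

lemma C_on_cong:
  assumes "open W" "\<And>q. q \<in> W \<Longrightarrow> f q = g q" "f \<in> C_on W"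
  shows "g \<in> C_on W"
  by (rule C_onI, rule Ck_on_cong[OF open_chart_image _ C_on_Ck[OF assms(3)]])
    (use assms in \<open>auto simp: chart_homeomorphism(5)\<close>)

lemma C_on_localI:
  assumes "\<And>p. p \<in> W \<Longrightarrow> \<exists>W'. open W' \<and> p \<in> W' \<and> f \<in> C_on W'"
  shows "f \<in> C_on W"
proof (rule C_onI, rule Ck_on_localI)
  fix U \<phi> k x assume U: "(U, \<phi>) \<in> M" and "x \<in> \<phi> ` (U \<inter> W)"
  then obtain p where p: "p \<in> U" "p \<in> W" "x = \<phi> p" by blast
  with assms obtain W' where W': "open W'" "p \<in> W'" "f \<in> C_on W'" by blast
  then show "\<exists>S. open S \<and> x \<in> S \<and> Ck_on k S (\<lambda>x. f (inv_into U \<phi> x))"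
    using p by (intro exI[of _ "\<phi> ` (U \<inter> W')"]) (auto intro: open_chart_image U C_on_Ck)
qed

lemma C_localI:
  assumes "\<And>p. \<exists>W g. open W \<and> p \<in> W \<and> g \<in> C_on W \<and> (\<forall>q\<in>W. f q = g q)"
  shows "f \<in> C"
  unfolding C_eq by (rule C_on_localI) (use assms C_on_cong in metis)

lemma chart_pullback_smooth:
  assumes U: "(U, \<phi>) \<in> M" and W: "open W" "W \<subseteq> U" and h: "smooth_on (\<phi> ` W) h"
  shows "(\<lambda>q. h (\<phi> q)) \<in> C_on W"
proof (rule C_onI)
  fix V \<psi> k assume V: "(V, \<psi>) \<in> M"
  show "Ck_on k (\<psi> ` (V \<inter> W)) (\<lambda>x. h (\<phi> (inv_into V \<psi> x)))"
  proof (rule Ck_on_compose[where T = "\<phi> ` W" and f = h])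
    show "open (\<psi> ` (V \<inter> W))" by (rule open_chart_image[OF V W(1)])
    show "open (\<phi> ` W)" using open_chart_image[OF U W(1)] W(2) by (simp add: Int_absorb1)
    show "(\<lambda>x. \<phi> (inv_into V \<psi> x)) ` \<psi> ` (V \<inter> W) \<subseteq> \<phi> ` W"
      using chart_homeomorphism(5)[OF V] by auto
    show "Ck_on k (\<phi> ` W) h" using h unfolding smooth_on_def by blast
    have "Ck_on k (\<psi> ` (V \<inter> U)) (\<lambda>x. \<phi> (inv_into V \<psi> x))"
      using chart_transition[OF V U] unfolding smooth_on_def by blast
    then show "Ck_on k (\<psi> ` (V \<inter> W)) (\<lambda>x. \<phi> (inv_into V \<psi> x))"
      by (rule Ck_on_subset) (use W(2) in blast)
  qed
qed

text \<open>Recording a closed set outside which the bump function vanishes, instead of its support,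
  makes gluing with the zero function immediate.\<close>

lemma bump_function:
  assumes "open W" "p \<in> W"
  obtains \<kappa> K W' where "\<kappa> \<in> C" "closed K" "K \<subseteq> W" "\<And>q. q \<notin> K \<Longrightarrow> \<kappa> q = 0"
    "open W'" "p \<in> W'" "W' \<subseteq> W" "\<And>q. q \<in> W' \<Longrightarrow> \<kappa> q = 1"
proof -
  obtain U \<phi> where U: "(U, \<phi>) \<in> M" "p \<in> U" by (rule chart_at)
  note inv = chart_homeomorphism(5)[OF U(1)]
  have "open (\<phi> ` (U \<inter> W))" by (rule open_chart_image[OF U(1) assms(1)])
  moreover have "\<phi> p \<in> \<phi> ` (U \<inter> W)" using U assms by blast
  ultimately obtain e where e: "e > 0" "cball (\<phi> p) e \<subseteq> \<phi> ` (U \<inter> W)"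
    using open_contains_cball by blast
  define r where "r = e / 2"
  have r: "r > 0" "2 * r = e" using e by (simp_all add: r_def)
  obtain b :: "'b \<Rightarrow> real" where b: "smooth_on UNIV b" "\<And>x. norm (x - \<phi> p) \<le> r \<Longrightarrow> b x = 1"
    "\<And>x. norm (x - \<phi> p) \<ge> 2 * r \<Longrightarrow> b x = 0"
    using euclidean_bump[OF r(1), of "\<phi> p"] by blast
  define K where "K = inv_into U \<phi> ` cball (\<phi> p) e"
  have "compact K"
    unfolding K_def using e(2)
    by (intro compact_continuous_image continuous_on_subset[OF chart_homeomorphism(4)[OF U(1)]]) auto
  then have K: "closed K" by (rule compact_imp_closed)
  have KW: "K \<subseteq> U \<inter> W" using e(2) inv unfolding K_def by fastforce
  define \<kappa> where "\<kappa> = (\<lambda>q. if q \<in> U then b (\<phi> q) else 0)"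
  have off: "\<kappa> q = 0" if "q \<notin> K" for q
  proof (cases "q \<in> U")
    case True
    have "\<phi> q \<notin> cball (\<phi> p) e"
      using that inv[OF True] unfolding K_def by (metis image_eqI)
    then show ?thesis using r b(3)[of "\<phi> q"] by (simp add: \<kappa>_def dist_norm norm_minus_commute)
  qed (simp add: \<kappa>_def)
  have "(\<lambda>q. b (\<phi> q)) \<in> C_on U"
    by (rule chart_pullback_smooth[OF U(1) chart_homeomorphism(1)[OF U(1)] subset_refl])
      (use b(1) in \<open>auto simp: smooth_on_def intro: Ck_on_subset\<close>)
  moreover have "open U" by (rule chart_homeomorphism(1)[OF U(1)])
  ultimately have "\<kappa> \<in> C"
  proof (intro C_localI)
    fix q
    show "\<exists>W g. open W \<and> q \<in> W \<and> g \<in> C_on W \<and> (\<forall>q\<in>W. \<kappa> q = g q)"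
    proof (cases "q \<in> U")
      case True
      then show ?thesis
        using \<open>open U\<close> \<open>_ \<in> C_on U\<close> by (intro exI[of _ U] exI[of _ "\<lambda>q. b (\<phi> q)"]) (auto simp: \<kappa>_def)
    next
      case False
      then show ?thesis
        using K KW off by (intro exI[of _ "- K"] exI[of _ "\<lambda>q. 0"]) (auto intro: C_on_const)
    qed
  qed
  define W' where "W' = (U \<inter> \<phi> -` ball (\<phi> p) r) \<inter> W"
  show ?thesis
  proof (rule that[OF \<open>\<kappa> \<in> C\<close> K _ off])
    show "open W'"
      unfolding W'_def by (intro open_Int open_chart_preimage[OF U(1)] assms(1) open_ball)
    show "\<kappa> q = 1" if "q \<in> W'" for q
      using that b(2)[of "\<phi> q"] by (simp add: W'_def \<kappa>_def dist_norm norm_minus_commute)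
  qed (use KW U assms r in \<open>auto simp: W'_def\<close>)
qed

lemma cutoff_smooth:
  assumes "\<kappa> \<in> C" "closed K" "K \<subseteq> W" "\<And>q. q \<notin> K \<Longrightarrow> \<kappa> q = 0" "open W" "f \<in> C_on W"
  shows "(\<lambda>q. \<kappa> q * f q) \<in> C"
proof (rule C_localI)
  fix p
  show "\<exists>W g. open W \<and> p \<in> W \<and> g \<in> C_on W \<and> (\<forall>q\<in>W. \<kappa> q * f q = g q)"
  proof (cases "p \<in> W")
    case True
    then show ?thesis
      using assms by (intro exI[of _ W] exI[of _ "\<lambda>q. \<kappa> q * f q"]) (auto intro: C_on_mult C_imp_C_on)
  next
    case False
    then show ?thesis
      using assms by (intro exI[of _ "- K"] exI[of _ "\<lambda>q. 0"]) (auto intro: C_on_const)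
  qed
qed

lemma local_extension:
  assumes "open W" "p \<in> W" "\<And>i. i \<in> I \<Longrightarrow> f i \<in> C_on W"
  obtains g W' where "\<And>i. i \<in> I \<Longrightarrow> g i \<in> C" "open W'" "p \<in> W'" "W' \<subseteq> W"
    "\<And>i q. q \<in> W' \<Longrightarrow> g i q = f i q"
proof -
  obtain \<kappa> K W' where k: "\<kappa> \<in> C" "closed K" "K \<subseteq> W" "\<And>q. q \<notin> K \<Longrightarrow> \<kappa> q = 0"
    "open W'" "p \<in> W'" "W' \<subseteq> W" "\<And>q. q \<in> W' \<Longrightarrow> \<kappa> q = 1"
    using bump_function[OF assms(1,2)] by metis
  show ?thesis
  proof (rule that[of "\<lambda>i q. \<kappa> q * f i q", OF _ k(5-7)])
    show "(\<lambda>q. \<kappa> q * f i q) \<in> C" if "i \<in> I" for i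
      by (rule cutoff_smooth[OF k(1-4) assms(1) assms(3)[OF that]])
  qed (simp add: k(8))
qed


section \<open>Tangent vectors and local coordinates\<close>

lemma tangent_iff:
  "v \<in> T p \<longleftrightarrow>
    (\<forall>f\<in>C. \<forall>g\<in>C. v (\<lambda>q. f q + g q) = v f + v g) \<and> (\<forall>c. \<forall>f\<in>C. v (\<lambda>q. c * f q) = c * v f) \<and>
    (\<forall>f\<in>C. \<forall>g\<in>C. v (\<lambda>q. f q * g q) = f p * v g + g p * v f) \<and> (\<forall>f. f \<notin> C \<longrightarrow> v f = 0)"
  unfolding tangent_space_def linear_on_subspace_def plus_fun_def scaleR_fun_def real_scaleR_def
    mem_Collect_eq conj_assoc ..

lemma tangent_add: "v \<in> T p \<Longrightarrow> f \<in> C \<Longrightarrow> g \<in> C \<Longrightarrow> v (\<lambda>q. f q + g q) = v f + v g"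
  unfolding tangent_iff by blast

lemma tangent_scale: "v \<in> T p \<Longrightarrow> f \<in> C \<Longrightarrow> v (\<lambda>q. c * f q) = c * v f"
  unfolding tangent_iff by blast

lemma tangent_mult: "v \<in> T p \<Longrightarrow> f \<in> C \<Longrightarrow> g \<in> C \<Longrightarrow> v (\<lambda>q. f q * g q) = f p * v g + g p * v f"
  unfolding tangent_iff by blast

lemma tangent_nonsmooth: "v \<in> T p \<Longrightarrow> f \<notin> C \<Longrightarrow> v f = 0"
  unfolding tangent_iff by blast

lemma tangentI:
  assumes "\<And>f g. f \<in> C \<Longrightarrow> g \<in> C \<Longrightarrow> v (\<lambda>q. f q + g q) = v f + v g"
    and "\<And>c f. f \<in> C \<Longrightarrow> v (\<lambda>q. c * f q) = c * v f"
    and "\<And>f g. f \<in> C \<Longrightarrow> g \<in> C \<Longrightarrow> v (\<lambda>q. f q * g q) = f p * v g + g p * v f"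
    and "\<And>f. f \<notin> C \<Longrightarrow> v f = 0"
  shows "v \<in> T p"
  unfolding tangent_iff by (intro conjI ballI allI impI assms)

lemma tangent_zero_fun: "v \<in> T p \<Longrightarrow> v (\<lambda>q. 0) = 0"
  using tangent_scale[OF _ C_const, of v p 0 0] by simp

lemma tangent_const: assumes "v \<in> T p" shows "v (\<lambda>q. c) = 0"
  using tangent_mult[OF assms C_const C_const, of 1 1] tangent_scale[OF assms C_const, of c 1] by simp

lemma tangent_minus: "v \<in> T p \<Longrightarrow> f \<in> C \<Longrightarrow> v (\<lambda>q. - f q) = - v f"
  using tangent_scale[of v p f "-1"] by simp

lemma tangent_diff: "v \<in> T p \<Longrightarrow> f \<in> C \<Longrightarrow> g \<in> C \<Longrightarrow> v (\<lambda>q. f q - g q) = v f - v g"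
  using tangent_add[OF _ _ C_minus, of v p f g] tangent_minus[of v p g] by simp

lemma tangent_sum:
  assumes "v \<in> T p" "\<And>i. i \<in> I \<Longrightarrow> f i \<in> C"
  shows "v (\<lambda>q. \<Sum>i\<in>I. f i q) = (\<Sum>i\<in>I. v (f i))"
  using assms(2)
proof (induction I rule: infinite_finite_induct)
  case (insert i I)
  then have "v (\<lambda>q. f i q + (\<Sum>i\<in>I. f i q)) = v (f i) + v (\<lambda>q. \<Sum>i\<in>I. f i q)"
    by (intro tangent_add[OF assms(1)] C_sum) auto
  with insert show ?case by simp
qed (simp_all add: tangent_zero_fun[OF assms(1)])

text \<open>If a bump function \<open>\<kappa>\<close> at \<open>p\<close> lives where \<open>f = g\<close>, then \<open>\<kappa> * (f - g) = 0\<close>, and the Leibniz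
  rule for this product gives \<open>v (f - g) = 0\<close>.\<close>

lemma tangent_local:
  assumes v: "v \<in> T p" and "f \<in> C" "g \<in> C" and W: "open W" "p \<in> W" "\<And>q. q \<in> W \<Longrightarrow> f q = g q"
  shows "v f = v g"
proof -
  obtain \<kappa> K W' where k: "\<kappa> \<in> C" "closed K" "K \<subseteq> W" "\<And>q. q \<notin> K \<Longrightarrow> \<kappa> q = 0"
    "open W'" "p \<in> W'" "W' \<subseteq> W" "\<And>q. q \<in> W' \<Longrightarrow> \<kappa> q = 1"
    using bump_function[OF W(1,2)] by metis
  let ?h = "\<lambda>q. f q - g q"
  have h: "?h \<in> C" using assms by (intro C_diff)
  have "(\<lambda>q. \<kappa> q * ?h q) = (\<lambda>q. 0)"
    using k(3,4) W(3) by (auto simp: fun_eq_iff)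
  moreover have "v (\<lambda>q. \<kappa> q * ?h q) = v ?h"
    using tangent_mult[OF v k(1) h] k(6,8) W by simp
  ultimately show ?thesis
    using tangent_zero_fun[OF v] tangent_diff[OF v assms(2,3)] by simp
qed

lemma sum_fun_eval: "(\<Sum>i\<in>I. c i *\<^sub>R (e i :: 'x \<Rightarrow> real)) x = (\<Sum>i\<in>I. c i * e i x)"
  by (induction I rule: infinite_finite_induct) (auto simp: scaleR_fun_def)

lemma vector_fieldD: "X \<in> \<X> \<Longrightarrow> X p \<in> T p" "X \<in> \<X> \<Longrightarrow> f \<in> C \<Longrightarrow> (\<lambda>p. X p f) \<in> C"
  unfolding vector_fields_def by auto

lemma vector_fieldI:
  "(\<And>p. X p \<in> T p) \<Longrightarrow> (\<And>f. f \<in> C \<Longrightarrow> (\<lambda>p. X p f) \<in> C) \<Longrightarrow> X \<in> \<X>"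
  unfolding vector_fields_def by auto

text \<open>Global functions and vector fields that look like coordinates and coordinate vector fields
  over \<open>W\<close>.\<close>

definition coordinates_on :: "'m set \<Rightarrow> (nat \<Rightarrow> 'm \<Rightarrow> real) \<Rightarrow> (nat \<Rightarrow> 'm \<Rightarrow> 'm tvec) \<Rightarrow> bool"
  where "coordinates_on W x D \<longleftrightarrow> open W \<and>
    (\<forall>i<DIM('b). x i \<in> C \<and> D i \<in> \<X>) \<and>
    (\<forall>q\<in>W. (\<forall>i<DIM('b). \<forall>j<DIM('b). D i q (x j) = (if i = j then 1 else 0)) \<and>
      (\<forall>v\<in>T q. v = (\<Sum>i<DIM('b). v (x i) *\<^sub>R D i q)))"

text \<open>On nonsmooth functions the value is \<open>0\<close>, as it must be for a tangent vector; outside \<open>U\<close> the factor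
  \<open>\<kappa>\<close> will vanish.\<close>

definition cutoff_partial ::
  "('m \<Rightarrow> real) \<Rightarrow> 'm set \<Rightarrow> ('m \<Rightarrow> 'b) \<Rightarrow> 'b \<Rightarrow> 'm \<Rightarrow> 'm tvec"
  where "cutoff_partial \<kappa> U \<phi> b q f =
    (if f \<in> C then \<kappa> q * frechet_derivative (\<lambda>y. f (inv_into U \<phi> y)) (at (\<phi> q)) b else 0)"

lemma chart_has_derivative:
  assumes "(U, \<phi>) \<in> M" "q \<in> U" "f \<in> C"
  shows "((\<lambda>y. f (inv_into U \<phi> y)) has_derivative
    frechet_derivative (\<lambda>y. f (inv_into U \<phi> y)) (at (\<phi> q))) (at (\<phi> q))"
  by (rule Ck_on_SucD[OF C_on_Ck[OF C_imp_C_on[OF assms(3), of UNIV] assms(1), of "Suc 0"]])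
    (use assms(2) in auto)

lemma cutoff_partial_vector_field:
  assumes U: "(U, \<phi>) \<in> M" and k: "\<kappa> \<in> C" "closed K" "K \<subseteq> U" "\<And>q. q \<notin> K \<Longrightarrow> \<kappa> q = 0"
  shows "cutoff_partial \<kappa> U \<phi> b \<in> \<X>"
proof (rule vector_fieldI)
  fix q
  let ?d = "\<lambda>f. frechet_derivative (\<lambda>y. f (inv_into U \<phi> y)) (at (\<phi> q))"
  show "cutoff_partial \<kappa> U \<phi> b q \<in> T q"
  proof (cases "q \<in> U")
    case True
    note der = chart_has_derivative[OF U True]
    have q: "inv_into U \<phi> (\<phi> q) = q" by (rule chart_homeomorphism(5)[OF U True])
    show ?thesis
    proof (rule tangentI)
      fix f g assume f: "f \<in> C" and g: "g \<in> C"
      have "?d (\<lambda>q. f q + g q) = (\<lambda>v. ?d f v + ?d g v)"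
        by (rule frechet_derivative_at[symmetric]) (rule has_derivative_add[OF der[OF f] der[OF g]])
      then show "cutoff_partial \<kappa> U \<phi> b q (\<lambda>q. f q + g q) = cutoff_partial \<kappa> U \<phi> b q f + cutoff_partial \<kappa> U \<phi> b q g"
        using f g by (simp add: cutoff_partial_def C_add algebra_simps)
      have "?d (\<lambda>q. f q * g q) = (\<lambda>v. f (inv_into U \<phi> (\<phi> q)) * ?d g v + ?d f v * g (inv_into U \<phi> (\<phi> q)))"
        by (rule frechet_derivative_at[symmetric]) (rule has_derivative_mult[OF der[OF f] der[OF g]])
      then show "cutoff_partial \<kappa> U \<phi> b q (\<lambda>q. f q * g q) =
          f q * cutoff_partial \<kappa> U \<phi> b q g + g q * cutoff_partial \<kappa> U \<phi> b q f"
        using f g by (simp add: cutoff_partial_def C_mult q algebra_simps)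
    next
      fix c f assume f: "f \<in> C"
      have "?d (\<lambda>q. c * f q) = (\<lambda>v. c * ?d f v)"
        by (rule frechet_derivative_at[symmetric]) (rule has_derivative_mult_right[OF der[OF f]])
      then show "cutoff_partial \<kappa> U \<phi> b q (\<lambda>q. c * f q) = c * cutoff_partial \<kappa> U \<phi> b q f"
        using C_mult[OF C_const f] f by (simp add: cutoff_partial_def)
    qed (simp add: cutoff_partial_def)
  next
    case False
    then have "\<kappa> q = 0" using k(3,4) by blast
    then show ?thesis by (intro tangentI) (auto simp: cutoff_partial_def)
  qed
next
  fix f assume f: "f \<in> C"
  have "(\<lambda>q. frechet_derivative (\<lambda>y. f (inv_into U \<phi> y)) (at (\<phi> q)) b) \<in> C_on U"
    using C_onD[OF C_imp_C_on[OF f, of UNIV] U]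
    by (intro chart_pullback_smooth[OF U chart_homeomorphism(1)[OF U] subset_refl] smooth_on_partial) simp
  from cutoff_smooth[OF k chart_homeomorphism(1)[OF U] this]
  show "(\<lambda>q. cutoff_partial \<kappa> U \<phi> b q f) \<in> C"
    using f by (simp add: cutoff_partial_def)
qed

text \<open>Hadamard's lemma in a chart writes \<open>f\<close> near \<open>q\<close> as \<open>f q + \<Sum>\<^sub>i (x i - x i q) * g i\<close>, and a
  derivation at \<open>q\<close> sees of this only the numbers \<open>g i q\<close>; the coordinate vector fields show what
  these numbers are.\<close>

theorem coordinates_exist:
  obtains W x D where "p \<in> W" "coordinates_on W x D"
proof -
  obtain U \<phi> where U: "(U, \<phi>) \<in> M" "p \<in> U" by (rule chart_at)
  note inv = chart_homeomorphism(5)[OF U(1)] and openU = chart_homeomorphism(1)[OF U(1)]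
  obtain \<kappa> K W where k: "\<kappa> \<in> C" "closed K" "K \<subseteq> U" "\<And>q. q \<notin> K \<Longrightarrow> \<kappa> q = 0"
    and W: "open W" "p \<in> W" "W \<subseteq> U" "\<And>q. q \<in> W \<Longrightarrow> \<kappa> q = 1"
    using bump_function[OF openU U(2)] by metis
  obtain b where "bij_betw b {0..<DIM('b)} (Basis :: 'b set)"
    using ex_bij_betw_nat_finite[OF finite_Basis] by blast
  then have b: "bij_betw b {..<DIM('b)} (Basis :: 'b set)" by (simp add: lessThan_atLeast0)
  define x where "x = (\<lambda>i q. \<kappa> q * (\<phi> q \<bullet> b i))"
  define D where "D = (\<lambda>i. cutoff_partial \<kappa> U \<phi> (b i))"
  have lin: "(\<lambda>q. \<phi> q \<bullet> b i) \<in> C_on U" for i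
  proof (rule chart_pullback_smooth[OF U(1) openU subset_refl])
    show "smooth_on (\<phi> ` U) (\<lambda>y. y \<bullet> b i)"
      unfolding smooth_on_def
      by (auto intro!: Ck_on_bounded_linear bounded_linear_inner_left chart_homeomorphism(2)[OF U(1)])
  qed
  have xC: "x i \<in> C" for i
    unfolding x_def by (rule cutoff_smooth[OF k openU lin])
  have DX: "D i \<in> \<X>" for i
    unfolding D_def by (rule cutoff_partial_vector_field[OF U(1) k])
  have dual: "D i q (x j) = (if i = j then 1 else 0)" if q: "q \<in> W" and ij: "i < DIM('b)" "j < DIM('b)" for q i j
  proof -
    have "((\<lambda>y. y \<bullet> b j) has_derivative (\<lambda>v. v \<bullet> b j)) (at (\<phi> q))"
      by (rule bounded_linear_imp_has_derivative[OF bounded_linear_inner_left])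
    moreover have "open (\<phi> ` (U \<inter> W))" by (rule open_chart_image[OF U(1) W(1)])
    moreover have "\<phi> q \<in> \<phi> ` (U \<inter> W)" using q W(3) by blast
    ultimately have "((\<lambda>y. x j (inv_into U \<phi> y)) has_derivative (\<lambda>v. v \<bullet> b j)) (at (\<phi> q))"
      by (rule has_derivative_transform_within_open) (auto simp: x_def inv W(4))
    from frechet_derivative_at[OF this] have "D i q (x j) = b i \<bullet> b j"
      using W(4)[OF q] xC by (simp add: D_def cutoff_partial_def fun_eq_iff)
    moreover have "b i \<in> Basis" "b j \<in> Basis" "b i = b j \<longleftrightarrow> i = j"
      using b ij by (auto simp: bij_betw_def inj_on_def)
    ultimately show ?thesis by (simp add: inner_Basis)
  qed
  have span: "v = (\<Sum>i<DIM('b). v (x i) *\<^sub>R D i q)" if q: "q \<in> W" and v: "v \<in> T q" for q v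
  proof
    fix f
    show "v f = (\<Sum>i<DIM('b). v (x i) *\<^sub>R D i q) f"
    proof (cases "f \<in> C")
      case False
      then show ?thesis
        using tangent_nonsmooth[OF v] tangent_nonsmooth[OF vector_fieldD(1)[OF DX]]
        by (simp add: sum_fun_eval)
    next
      case f: True
      have "\<phi> q \<in> \<phi> ` (U \<inter> W)" using q W(3) by blast
      with open_chart_image[OF U(1) W(1)] obtain r where r: "r > 0" "ball (\<phi> q) r \<subseteq> \<phi> ` (U \<inter> W)"
        using open_contains_ball by blast
      let ?F = "\<lambda>y. f (inv_into U \<phi> y)"
      have "smooth_on (\<phi> ` (U \<inter> UNIV)) ?F"
        by (rule C_onD[OF C_imp_C_on[OF f] U(1)])
      then have "smooth_on (ball (\<phi> q) r) ?F"
        unfolding smooth_on_def using r(2) by (blast intro: Ck_on_subset)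
      from hadamard[OF this] obtain g where g: "\<And>b. smooth_on (ball (\<phi> q) r) (g b)"
        "\<And>y. y \<in> ball (\<phi> q) r \<Longrightarrow> ?F y = ?F (\<phi> q) + (\<Sum>b\<in>Basis. ((y - \<phi> q) \<bullet> b) * g b y)"
        by metis
      define B where "B = (U \<inter> \<phi> -` ball (\<phi> q) r) \<inter> W"
      have B: "open B" "q \<in> B" "B \<subseteq> W"
        unfolding B_def using open_chart_preimage[OF U(1) open_ball] W(1) q W(3) r(1) by auto
      have gB: "(\<lambda>q. g b (\<phi> q)) \<in> C_on B" for b
        by (rule chart_pullback_smooth[OF U(1) B(1)])
          (use B(3) W(3) g(1)[of b] in \<open>auto simp: B_def smooth_on_def intro: Ck_on_subset simp del: mem_ball\<close>)
      obtain G B' where G: "\<And>b. G b \<in> C" "open B'" "q \<in> B'" "B' \<subseteq> B"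
        "\<And>b q'. q' \<in> B' \<Longrightarrow> G b q' = g b (\<phi> q')"
        using local_extension[OF B(1,2), of UNIV "\<lambda>b q. g b (\<phi> q)"] gB by auto
      let ?rhs = "\<lambda>q'. f q + (\<Sum>i<DIM('b). (x i q' - x i q) * G (b i) q')"
      have eq: "f q' = ?rhs q'" if q': "q' \<in> B'" for q'
      proof -
        have *: "q' \<in> W" "\<phi> q' \<in> ball (\<phi> q) r" "q' \<in> U" "q \<in> U"
          using q' G(4) B(3) W(3) q by (auto simp: B_def simp del: mem_ball)
        have "f q' = f q + (\<Sum>b\<in>Basis. ((\<phi> q' - \<phi> q) \<bullet> b) * g b (\<phi> q'))"
          using g(2)[OF *(2)] by (simp add: inv *)
        also have "(\<Sum>b\<in>Basis. ((\<phi> q' - \<phi> q) \<bullet> b) * g b (\<phi> q'))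
            = (\<Sum>i<DIM('b). ((\<phi> q' - \<phi> q) \<bullet> b i) * g (b i) (\<phi> q'))"
          by (rule sum.reindex_bij_betw[OF b, symmetric])
        finally show ?thesis
          using * q by (simp add: x_def W(4) G(5)[OF q'] inner_diff_left)
      qed
      have xd: "(\<lambda>q'. x i q' - x i q) \<in> C" for i by (intro C_diff xC C_const)
      have summand: "(\<lambda>q'. (x i q' - x i q) * G (b i) q') \<in> C" for i by (intro C_mult xd G(1))
      have derivation: "w f = (\<Sum>i<DIM('b). w (x i) * G (b i) q)" if w: "w \<in> T q" for w
      proof -
        have "w f = w ?rhs"
          by (rule tangent_local[OF w f _ G(2,3) eq]) (intro C_add C_const C_sum summand)
        also have "\<dots> = (\<Sum>i<DIM('b). w (\<lambda>q'. (x i q' - x i q) * G (b i) q'))"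
          by (simp add: tangent_add[OF w C_const C_sum[OF summand]] tangent_const[OF w] tangent_sum[OF w summand])
        also have "\<dots> = (\<Sum>i<DIM('b). w (x i) * G (b i) q)"
          by (simp add: tangent_mult[OF w xd G(1)] tangent_diff[OF w xC C_const] tangent_const[OF w] mult.commute[of "G _ q"])
        finally show ?thesis .
      qed
      have "D i q f = G (b i) q" if "i < DIM('b)" for i
        using derivation[OF vector_fieldD(1)[OF DX]] dual[OF q that] that
        by (simp add: if_distrib[of "\<lambda>c. c * _"] sum.delta cong: if_cong)
      then show ?thesis
        using derivation[OF v] by (simp add: sum_fun_eval mult.commute)
    qed
  qed
  show ?thesis
  proof (rule that[OF W(2)])
    show "coordinates_on W x D"
      unfolding coordinates_on_def by (intro conjI ballI allI impI W(1) xC DX dual span)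
  qed
qed

end


section \<open>Linear systems with smooth coefficients\<close>

context manifold
begin

lemma C_on_det:
  assumes "open W" and A: "\<And>i j. i < n \<Longrightarrow> j < n \<Longrightarrow> A i j \<in> C_on W"
  shows "(\<lambda>q. Determinant.det (Matrix.mat n n (\<lambda>(i, j). A i j q))) \<in> C_on W"
proof -
  have lt: "p i < n" if "p permutes {0..<n}" "i < n" for p i
    using permutes_in_image[OF that(1), of i] that(2) by simp
  have "Determinant.det (Matrix.mat n n (\<lambda>(i, j). A i j q))
      = (\<Sum>p | p permutes {0..<n}. signof p * (\<Prod>i=0..<n. A i (p i) q))" for q
    unfolding det_def'[OF mat_carrier]
    by (intro sum.cong refl arg_cong2[where f = "(*)"] prod.cong) (auto simp: lt)
  then show ?thesis
    using lt by (auto intro!: C_on_sum C_on_mult C_on_prod C_on_const A \<open>open W\<close>)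
qed

text \<open>Cramer's rule expresses the solution as a quotient of determinants.\<close>

lemma smooth_linear_system:
  fixes n k :: nat
  assumes "open W"
    and A: "\<And>i j. i < n \<Longrightarrow> j < n \<Longrightarrow> A i j \<in> C_on W"
    and a: "\<And>i. i < n \<Longrightarrow> a i \<in> C_on W"
    and sol: "\<And>q i. q \<in> W \<Longrightarrow> i < n \<Longrightarrow> (\<Sum>j<n. A i j q * c j q) = a i q"
    and inj: "\<And>q z j. q \<in> W \<Longrightarrow> (\<And>i. i < n \<Longrightarrow> (\<Sum>j<n. A i j q * z j) = 0) \<Longrightarrow> j < n \<Longrightarrow> z j = 0"
    and k: "k < n"
  shows "c k \<in> C_on W"
proof -
  let ?A = "\<lambda>q. Matrix.mat n n (\<lambda>(i, j). A i j q)"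
  let ?B = "\<lambda>q. Matrix.mat n n (\<lambda>(i, j). (if j = k then a i else A i j) q)"
  have dA: "(\<lambda>q. Determinant.det (?A q)) \<in> C_on W" by (rule C_on_det[OF \<open>open W\<close> A])
  have dB: "(\<lambda>q. Determinant.det (?B q)) \<in> C_on W" by (rule C_on_det[OF \<open>open W\<close>]) (use A a in auto)
  have mult: "(?A q *\<^sub>v Matrix.vec n z) = Matrix.vec n (\<lambda>i. \<Sum>j<n. A i j q * z j)" for q z
    by (rule eq_vecI) (auto simp: scalar_prod_def lessThan_atLeast0)
  have nz: "Determinant.det (?A q) \<noteq> 0" if q: "q \<in> W" for q
  proof
    assume "Determinant.det (?A q) = 0"
    then obtain v where v: "v \<in> carrier_vec n" "v \<noteq> 0\<^sub>v n" "?A q *\<^sub>v v = 0\<^sub>v n"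
      using det_0_iff_vec_prod_zero_field[of "?A q" n] by auto
    have vec: "v = Matrix.vec n (\<lambda>j. vec_index v j)" using v(1) by auto
    have zero: "Matrix.vec n (\<lambda>i. \<Sum>j<n. A i j q * (vec_index v j)) = 0\<^sub>v n"
      using v(3) mult[of q "\<lambda>j. vec_index v j"] vec by simp
    have "(\<Sum>j<n. A i j q * (vec_index v j)) = 0" if "i < n" for i
      using arg_cong[OF zero, of "\<lambda>w. vec_index w i"] that by simp
    from inj[OF q this] have "v = 0\<^sub>v n" using v(1) by (intro eq_vecI) auto
    with v(2) show False by simp
  qed
  have "c k q = Determinant.det (?B q) * inverse (Determinant.det (?A q))" if q: "q \<in> W" for q
  proof -
    have "replace_col (?A q) (?A q *\<^sub>v Matrix.vec n (\<lambda>j. c j q)) k = ?B q"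
      unfolding mult replace_col_def by (rule eq_matI) (auto simp: sol[OF q])
    with cramer_lemma_mat[of "?A q" n "Matrix.vec n (\<lambda>j. c j q)" k] k
    have "Determinant.det (?B q) = c k q * Determinant.det (?A q)" by simp
    with nz[OF q] show ?thesis by (simp add: field_simps)
  qed
  moreover have "(\<lambda>q. Determinant.det (?B q) * inverse (Determinant.det (?A q))) \<in> C_on W"
    by (intro C_on_mult C_on_inverse \<open>open W\<close> dA dB nz)
  ultimately show ?thesis by (metis (no_types, lifting) C_on_cong \<open>open W\<close>)
qed

end


section \<open>Bases indexed by numbers\<close>

text \<open>A basis given as a family, so that coefficients depend on an index and not on the basis vector,
  which varies with the base point.\<close>

definition family_basis :: "'e::real_vector set \<Rightarrow> nat \<Rightarrow> (nat \<Rightarrow> 'e) \<Rightarrow> bool"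
  where "family_basis V r e \<longleftrightarrow>
    (\<forall>u. u \<in> V \<longleftrightarrow> (\<exists>z. u = (\<Sum>i<r. z i *\<^sub>R e i))) \<and>
    (\<forall>z. (\<Sum>i<r. z i *\<^sub>R e i) = 0 \<longrightarrow> (\<forall>i<r. z i = 0))"

lemma family_basis_inj:
  fixes e :: "nat \<Rightarrow> 'e::real_vector"
  assumes ind: "\<And>z i. (\<Sum>i<r. z i *\<^sub>R e i) = 0 \<Longrightarrow> i < r \<Longrightarrow> z i = 0"
  shows "inj_on e {..<r}"
proof (rule inj_onI, rule ccontr)
  fix i j assume ij: "i \<in> {..<r}" "j \<in> {..<r}" "e i = e j" "i \<noteq> j"
  let ?z = "\<lambda>k. if k = i then 1 else if k = j then -1 else 0 :: real"
  have "(\<Sum>k<r. ?z k *\<^sub>R e k) = (\<Sum>k\<in>{i, j}. ?z k *\<^sub>R e k)"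
    by (rule sum.mono_neutral_right) (use ij in auto)
  also have "\<dots> = 0" using ij by simp
  finally have "?z i = 0" using ind[of ?z i] ij(1) by auto
  then show False by simp
qed

lemma family_basis_iff:
  "family_basis V r e \<longleftrightarrow> inj_on e {..<r} \<and> independent (e ` {..<r}) \<and> span (e ` {..<r}) = V"
    (is "?L \<longleftrightarrow> ?R")
proof -
  have span: "u \<in> span (e ` {..<r}) \<longleftrightarrow> (\<exists>z. u = (\<Sum>i<r. z i *\<^sub>R e i))" if inj: "inj_on e {..<r}" for u
  proof -
    have "(\<Sum>v\<in>e ` {..<r}. w v *\<^sub>R v) = (\<Sum>i<r. w (e i) *\<^sub>R e i)" for w
      by (simp add: sum.reindex[OF inj])
    moreover have "(\<Sum>i<r. z i *\<^sub>R e i) \<in> span (e ` {..<r})" for z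
      by (intro span_sum span_scale span_base) auto
    ultimately show ?thesis by (auto simp: span_finite)
  qed
  show ?thesis
  proof
    assume L: ?L
    then have ind: "z i = 0" if "(\<Sum>i<r. z i *\<^sub>R e i) = 0" "i < r" for z i
      using that unfolding family_basis_def by blast
    then have inj: "inj_on e {..<r}" by (rule family_basis_inj)
    moreover have "independent (e ` {..<r})"
    proof (rule independent_if_scalars_zero)
      fix w x assume "(\<Sum>v\<in>e ` {..<r}. w v *\<^sub>R v) = 0" "x \<in> e ` {..<r}"
      then show "w x = 0"
        using ind[of "\<lambda>i. w (e i)"] by (auto simp: sum.reindex[OF inj])
    qed simp
    ultimately show ?R
      using L span[OF inj] unfolding family_basis_def by auto
  next
    assume R: ?R
    have "z i = 0" if z: "(\<Sum>i<r. z i *\<^sub>R e i) = 0" and i: "i < r" for z i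
    proof -
      let ?w = "\<lambda>v. z (inv_into {..<r} e v)"
      have "(\<Sum>v\<in>e ` {..<r}. ?w v *\<^sub>R v) = (\<Sum>i<r. ?w (e i) *\<^sub>R e i)"
        using R by (simp add: sum.reindex)
      also have "\<dots> = (\<Sum>i<r. z i *\<^sub>R e i)"
        using R by (intro sum.cong) (auto simp: inv_into_f_f)
      finally have "?w (e i) = 0"
        using R z i by (intro independentD[of "e ` {..<r}" "e ` {..<r}" ?w]) auto
      then show ?thesis using R i by (simp add: inv_into_f_f)
    qed
    then show ?L using R span unfolding family_basis_def by auto
  qed
qed

lemma local_frame_iff:
  "local_frame E U r e \<longleftrightarrow>
    open U \<and> (\<forall>i<r. e i \<in> sections E) \<and> (\<forall>q\<in>U. family_basis (fibre E q) r (\<lambda>i. e i q))"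
  unfolding local_frame_def family_basis_iff by simp

lemma family_basis_expand: "family_basis V r e \<Longrightarrow> u \<in> V \<Longrightarrow> \<exists>z. u = (\<Sum>i<r. z i *\<^sub>R e i)"
  unfolding family_basis_def by blast

lemma family_basis_zero:
  "family_basis V r e \<Longrightarrow> (\<Sum>i<r. z i *\<^sub>R e i) = 0 \<Longrightarrow> i < r \<Longrightarrow> z i = 0"
  unfolding family_basis_def by blast

lemma family_basis_unique:
  assumes "family_basis V r e" "(\<Sum>i<r. y i *\<^sub>R e i) = (\<Sum>i<r. z i *\<^sub>R e i)" "i < r"
  shows "y i = z i"
proof -
  have "(\<Sum>i<r. (y i - z i) *\<^sub>R e i) = 0"
    using assms(2) by (simp add: scaleR_left_diff_distrib sum_subtractf)
  from family_basis_zero[OF assms(1) this assms(3)] have "y i - z i = 0" .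
  then show ?thesis by simp
qed

lemma family_basis_mem: "family_basis V r e \<Longrightarrow> i < r \<Longrightarrow> e i \<in> V"
  unfolding family_basis_iff by (auto intro: span_base)

lemma family_basis_sum_mem: "family_basis V r e \<Longrightarrow> (\<Sum>i<r. z i *\<^sub>R e i) \<in> V"
  unfolding family_basis_def by blast

lemma family_basis_length:
  assumes "family_basis V r e" "family_basis V s d"
  shows "r = s"
proof -
  have "dim V = card (e ` {..<r})" "dim V = card (d ` {..<s})"
    using assms unfolding family_basis_iff by (metis dim_eq_card span_span)+
  moreover have "card (e ` {..<r}) = r" "card (d ` {..<s}) = s"
    using assms unfolding family_basis_iff by (auto simp: card_image)
  ultimately show ?thesis by simp
qed

lemma linear_on_subspace_sum:
  assumes "linear_on_subspace V h" "subspace V" "\<And>i. i \<in> I \<Longrightarrow> e i \<in> V"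
  shows "h (\<Sum>i\<in>I. z i *\<^sub>R e i) = (\<Sum>i\<in>I. z i *\<^sub>R h (e i))"
proof -
  have add: "h (u + v) = h u + h v" if "u \<in> V" "v \<in> V" for u v
    using assms(1) that unfolding linear_on_subspace_def by blast
  have scale: "h (c *\<^sub>R u) = c *\<^sub>R h u" if "u \<in> V" for c u
    using assms(1) that unfolding linear_on_subspace_def by blast
  have zero: "h 0 = 0" using scale[OF subspace_0[OF assms(2)], of 0] by simp
  show ?thesis
    using assms(3)
  proof (induction I rule: infinite_finite_induct)
    case (insert i I)
    have "(\<Sum>i\<in>I. z i *\<^sub>R e i) \<in> V"
      by (intro subspace_sum subspace_scale assms(2)) (use insert.prems in auto)
    then have "h (z i *\<^sub>R e i + (\<Sum>i\<in>I. z i *\<^sub>R e i)) = z i *\<^sub>R h (e i) + h (\<Sum>i\<in>I. z i *\<^sub>R e i)"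
      using insert.prems by (simp add: add scale subspace_scale[OF assms(2)])
    with insert show ?case by simp
  qed (simp_all add: zero)
qed

lemma family_basis_independent_image:
  assumes "family_basis V r e" "subspace V" "linear_on_subspace V h" "inj_on h V"
    and z: "(\<Sum>i<r. z i *\<^sub>R h (e i)) = 0" and "i < r"
  shows "z i = 0"
proof -
  have sum: "h (\<Sum>i<r. y i *\<^sub>R e i) = (\<Sum>i<r. y i *\<^sub>R h (e i))" for y
    by (rule linear_on_subspace_sum[OF assms(3,2)]) (use family_basis_mem[OF assms(1)] in auto)
  have "h (\<Sum>i<r. z i *\<^sub>R e i) = h (\<Sum>i<r. 0 *\<^sub>R e i)"
    unfolding sum z by simp
  then have "(\<Sum>i<r. z i *\<^sub>R e i) = (\<Sum>i<r. 0 *\<^sub>R e i)"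
    by (rule inj_onD[OF assms(4)]) (rule family_basis_sum_mem[OF assms(1)])+
  then show ?thesis using family_basis_unique[OF assms(1) _ assms(6), of z "\<lambda>_. 0"] by simp
qed

lemma family_basis_image:
  assumes "family_basis V r e" "subspace V" "linear_on_subspace V h" "bij_betw h V V'"
  shows "family_basis V' r (\<lambda>i. h (e i))"
  unfolding family_basis_def
proof (intro conjI allI impI)
  have sum: "h (\<Sum>i<r. z i *\<^sub>R e i) = (\<Sum>i<r. z i *\<^sub>R h (e i))" for z
    by (rule linear_on_subspace_sum[OF assms(3,2)]) (use family_basis_mem[OF assms(1)] in auto)
  show "u \<in> V' \<longleftrightarrow> (\<exists>z. u = (\<Sum>i<r. z i *\<^sub>R h (e i)))" for u
  proof -
    have "u \<in> V' \<longleftrightarrow> (\<exists>x\<in>V. u = h x)" using assms(4) by (auto simp: bij_betw_def)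
    also have "\<dots> \<longleftrightarrow> (\<exists>z. u = h (\<Sum>i<r. z i *\<^sub>R e i))"
      using assms(1) unfolding family_basis_def by metis
    finally show ?thesis by (simp add: sum)
  qed
  show "z i = 0" if "(\<Sum>i<r. z i *\<^sub>R h (e i)) = 0" "i < r" for z i
    using family_basis_independent_image[OF assms(1-3) _ that] assms(4) by (simp add: bij_betw_def)
qed

text \<open>A dimension count in ambient spaces of arbitrary dimension.\<close>

lemma injective_imp_bijective:
  assumes e: "family_basis V r e" "subspace V" "linear_on_subspace V h" "inj_on h V"
    and d: "family_basis V' r d" and "h ` V \<subseteq> V'"
  shows "bij_betw h V V'"
proof -
  let ?s = "(\<lambda>i. h (e i)) ` {..<r}" and ?t = "d ` {..<r}"
  note indep = family_basis_independent_image[OF e]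
  have inj: "inj_on (\<lambda>i. h (e i)) {..<r}"
    by (rule family_basis_inj) (rule indep)
  have "family_basis (span ?s) r (\<lambda>i. h (e i))"
    unfolding family_basis_iff
  proof (intro conjI inj refl independent_if_scalars_zero)
    fix w x assume "(\<Sum>v\<in>?s. w v *\<^sub>R v) = 0" "x \<in> ?s"
    then show "w x = 0"
      using indep[of "\<lambda>i. w (h (e i))"] by (auto simp: sum.reindex[OF inj])
  qed simp
  then have s: "independent ?s" unfolding family_basis_iff by simp
  have t: "span ?t = V'" "card ?t = r" using d unfolding family_basis_iff by (auto simp: card_image)
  have st: "?s \<subseteq> span ?t"
    using assms(6) family_basis_mem[OF e(1)] unfolding t(1) by blast
  have V': "V' \<subseteq> span ?s"
  proof (rule subsetI, rule ccontr)
    fix u assume u: "u \<in> V'" "u \<notin> span ?s"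
    have "independent (insert u ?s)" by (rule independent_insertI[OF u(2) s])
    moreover have "insert u ?s \<subseteq> span ?t" using st u(1) t(1) by blast
    ultimately have "card (insert u ?s) \<le> card ?t"
      using independent_span_bound[of ?t "insert u ?s"] by simp
    moreover have "u \<notin> ?s" using u(2) span_base[of u ?s] by blast
    ultimately show False using inj t(2) by (simp add: card_image)
  qed
  have "V' \<subseteq> h ` V"
  proof
    fix u assume "u \<in> V'"
    then obtain z where "u = (\<Sum>i<r. z i *\<^sub>R h (e i))"
      using V' \<open>family_basis (span ?s) r _\<close> unfolding family_basis_def by blast
    also have "\<dots> = h (\<Sum>i<r. z i *\<^sub>R e i)"
      by (rule linear_on_subspace_sum[OF e(3,2), symmetric]) (use family_basis_mem[OF e(1)] in auto)
    finally show "u \<in> h ` V" using family_basis_sum_mem[OF e(1)] by blast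
  qed
  with assms(6) e(4) show ?thesis by (auto simp: bij_betw_def)
qed


section \<open>Vector bundles\<close>

context manifold
begin

definition smooth_coefficients ::
  "('m, 'e::real_vector) vbundle \<Rightarrow> 'm set \<Rightarrow> nat \<Rightarrow> (nat \<Rightarrow> 'm \<Rightarrow> 'e) \<Rightarrow> ('m \<Rightarrow> 'e) \<Rightarrow> bool"
  where "smooth_coefficients E U r e s \<longleftrightarrow>
    (\<exists>c. (\<forall>i<r. c i \<in> C_on U) \<and> (\<forall>q\<in>U. s q = (\<Sum>i<r. c i q *\<^sub>R e i q)))"

lemma vector_bundle_iff:
  "vector_bundle M E \<longleftrightarrow>
    (\<forall>p. subspace (fibre E p)) \<and> (\<forall>p. \<exists>U r e. p \<in> U \<and> local_frame E U r e) \<and>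
    (\<forall>s. s \<in> sections E \<longleftrightarrow> (\<forall>p. s p \<in> fibre E p) \<and>
      (\<forall>U r e. local_frame E U r e \<longrightarrow> smooth_coefficients E U r e s))"
  unfolding vector_bundle_def smooth_coefficients_def ..

lemma local_frameD:
  assumes "local_frame E U r e"
  shows "open U" "\<And>i. i < r \<Longrightarrow> e i \<in> sections E" "\<And>q. q \<in> U \<Longrightarrow> family_basis (fibre E q) r (\<lambda>i. e i q)"
  using assms unfolding local_frame_iff by blast+

text \<open>The coefficients of a section in one frame solve the linear system whose matrix is the change
  of frame, which is invertible; by Cramer's rule they are smooth if this holds in a frame that
  expresses all sections smoothly.\<close>

lemma smooth_coefficients_change_frame:
  assumes W: "local_frame E W n d" "\<And>s. s \<in> sections E \<Longrightarrow> smooth_coefficients E W n d s"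
    and U: "local_frame E U r e" and s: "s \<in> sections E" and p: "p \<in> U" "p \<in> W"
    and c: "\<And>q. q \<in> U \<Longrightarrow> s q = (\<Sum>i<r. c i q *\<^sub>R e i q)" and k: "k < r"
  shows "c k \<in> C_on (U \<inter> W)"
proof -
  have r: "r = n"
    using family_basis_length local_frameD(3)[OF U p(1)] local_frameD(3)[OF W(1) p(2)] by blast
  obtain a where a: "\<And>j. j < n \<Longrightarrow> a j \<in> C_on W" "\<And>q. q \<in> W \<Longrightarrow> s q = (\<Sum>j<n. a j q *\<^sub>R d j q)"
    using W(2)[OF s] unfolding smooth_coefficients_def by blast
  have "\<forall>i. \<exists>A. i < n \<longrightarrow> (\<forall>j<n. A j \<in> C_on W) \<and> (\<forall>q\<in>W. e i q = (\<Sum>j<n. A j q *\<^sub>R d j q))"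
    using W(2)[OF local_frameD(2)[OF U]] unfolding smooth_coefficients_def r by blast
  then obtain A where A: "\<And>i j. i < n \<Longrightarrow> j < n \<Longrightarrow> A i j \<in> C_on W"
    "\<And>i q. i < n \<Longrightarrow> q \<in> W \<Longrightarrow> e i q = (\<Sum>j<n. A i j q *\<^sub>R d j q)"
    by metis
  have comb: "(\<Sum>i<n. z i *\<^sub>R e i q) = (\<Sum>j<n. (\<Sum>i<n. A i j q * z i) *\<^sub>R d j q)" if q: "q \<in> W" for z q
  proof -
    have "(\<Sum>i<n. z i *\<^sub>R e i q) = (\<Sum>i<n. \<Sum>j<n. (A i j q * z i) *\<^sub>R d j q)"
      by (intro sum.cong refl) (simp add: A(2)[OF _ q] scaleR_sum_right mult.commute)
    also have "\<dots> = (\<Sum>j<n. \<Sum>i<n. (A i j q * z i) *\<^sub>R d j q)" by (rule sum.swap)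
    finally show ?thesis by (simp add: scaleR_sum_left)
  qed
  have openUW: "open (U \<inter> W)" using local_frameD(1)[OF U] local_frameD(1)[OF W(1)] by blast
  show ?thesis
  proof (rule smooth_linear_system[where A = "\<lambda>j i. A i j" and a = a and c = c and n = n, OF openUW])
    fix q j assume q: "q \<in> U \<inter> W" and j: "j < n"
    have "(\<Sum>j<n. (\<Sum>i<n. A i j q * c i q) *\<^sub>R d j q) = (\<Sum>j<n. a j q *\<^sub>R d j q)"
      using c[of q] a(2)[of q] comb[of q "\<lambda>i. c i q"] q by (simp add: r)
    from family_basis_unique[OF local_frameD(3)[OF W(1)] this j] q
    show "(\<Sum>i<n. A i j q * c i q) = a j q" by blast
  next
    fix q z i assume q: "q \<in> U \<inter> W" and z: "\<And>j. j < n \<Longrightarrow> (\<Sum>i<n. A i j q * z i) = 0" and i: "i < n"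
    have "(\<Sum>i<n. z i *\<^sub>R e i q) = 0" using comb[of q z] q z by simp
    then show "z i = 0"
      using family_basis_zero[OF local_frameD(3)[OF U]] q i unfolding r by blast
  qed (use A(1) a(1) k in \<open>auto intro: C_on_subset simp: r\<close>)
qed

text \<open>One frame near each point suffices: any other frame can be compared with it, and its coefficients
  extend locally to global functions.\<close>

theorem vector_bundleI:
  assumes sub: "\<And>p. subspace (fibre E p)"
    and fib: "\<And>s p. s \<in> sections E \<Longrightarrow> s p \<in> fibre E p"
    and zero: "(\<lambda>p. 0) \<in> sections E"
    and add: "\<And>s t. s \<in> sections E \<Longrightarrow> t \<in> sections E \<Longrightarrow> (\<lambda>p. s p + t p) \<in> sections E"
    and mult: "\<And>f s. f \<in> C \<Longrightarrow> s \<in> sections E \<Longrightarrow> (\<lambda>p. f p *\<^sub>R s p) \<in> sections E"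
    and glue: "\<And>s. (\<And>p. s p \<in> fibre E p) \<Longrightarrow>
      (\<And>p. \<exists>W t. open W \<and> p \<in> W \<and> t \<in> sections E \<and> (\<forall>q\<in>W. s q = t q)) \<Longrightarrow> s \<in> sections E"
    and frame: "\<And>p. \<exists>W n d. p \<in> W \<and> local_frame E W n d \<and>
      (\<forall>s\<in>sections E. smooth_coefficients E W n d s)"
  shows "vector_bundle M E"
  unfolding vector_bundle_iff
proof (intro conjI allI iffI impI)
  fix s U r e assume s: "s \<in> sections E" and U: "local_frame E U r e"
  define z where "z = (\<lambda>q. SOME z. s q = (\<Sum>i<r. z i *\<^sub>R e i q))"
  have z: "s q = (\<Sum>i<r. z q i *\<^sub>R e i q)" if "q \<in> U" for q
    unfolding z_def by (rule someI_ex[OF family_basis_expand[OF local_frameD(3)[OF U that] fib[OF s]]])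
  have "(\<lambda>q. z q i) \<in> C_on U" if i: "i < r" for i
  proof (rule C_on_localI)
    fix p assume p: "p \<in> U"
    obtain W n d where W: "p \<in> W" "local_frame E W n d" "\<forall>s\<in>sections E. smooth_coefficients E W n d s"
      using frame[of p] by blast
    have "(\<lambda>q. z q i) \<in> C_on (U \<inter> W)"
      by (rule smooth_coefficients_change_frame[OF W(2) bspec[OF W(3)] U s p W(1) z i])
    then show "\<exists>W'. open W' \<and> p \<in> W' \<and> (\<lambda>q. z q i) \<in> C_on W'"
      using p W(1) local_frameD(1)[OF U] local_frameD(1)[OF W(2)] by blast
  qed
  then show "smooth_coefficients E U r e s"
    unfolding smooth_coefficients_def by (intro exI[of _ "\<lambda>i q. z q i"]) (simp add: z)
next
  fix s assume s: "(\<forall>p. s p \<in> fibre E p) \<and> (\<forall>U r e. local_frame E U r e \<longrightarrow> smooth_coefficients E U r e s)"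
  show "s \<in> sections E"
  proof (rule glue)
    fix p
    obtain W n d where W: "p \<in> W" "local_frame E W n d" using frame[of p] by blast
    then obtain c where c: "\<And>i. i < n \<Longrightarrow> c i \<in> C_on W" "\<And>q. q \<in> W \<Longrightarrow> s q = (\<Sum>i<n. c i q *\<^sub>R d i q)"
      using s unfolding smooth_coefficients_def by blast
    obtain g W' where g: "\<And>i. i < n \<Longrightarrow> g i \<in> C" "open W'" "p \<in> W'" "W' \<subseteq> W" "\<And>i q. q \<in> W' \<Longrightarrow> g i q = c i q"
      using local_extension[OF local_frameD(1)[OF W(2)] W(1), of "{..<n}" c] c(1) by auto
    have "(\<lambda>q. \<Sum>i\<in>I. g i q *\<^sub>R d i q) \<in> sections E" if "I \<subseteq> {..<n}" for I
      using finite_subset[OF that finite_lessThan] that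
    proof (induction I rule: finite_induct)
      case (insert i I)
      then have i: "i < n" and IH: "(\<lambda>q. \<Sum>i\<in>I. g i q *\<^sub>R d i q) \<in> sections E" by simp_all
      have "(\<lambda>q. g i q *\<^sub>R d i q + (\<Sum>i\<in>I. g i q *\<^sub>R d i q)) \<in> sections E"
        by (rule add[OF mult[OF g(1)[OF i] local_frameD(2)[OF W(2) i]] IH])
      with insert show ?case by simp
    qed (simp add: zero)
    then have "(\<lambda>q. \<Sum>i<n. g i q *\<^sub>R d i q) \<in> sections E" by blast
    moreover have "s q = (\<Sum>i<n. g i q *\<^sub>R d i q)" if "q \<in> W'" for q
      using c(2)[of q] g(4) that by (auto simp: g(5)[OF that])
    ultimately show "\<exists>W t. open W \<and> p \<in> W \<and> t \<in> sections E \<and> (\<forall>q\<in>W. s q = t q)"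
      using g(2,3) by (intro exI[of _ W'] exI[of _ "\<lambda>q. \<Sum>i<n. g i q *\<^sub>R d i q"]) simp
  qed (use s in simp)
next
  show "\<exists>U r e. p \<in> U \<and> local_frame E U r e" for p using frame[of p] by blast
qed (rule sub fib, assumption?)+

lemma local_frame_image:
  assumes "bundle_morphism E F h" "\<And>p. bij_betw (h p) (fibre E p) (fibre F p)" "\<And>p. subspace (fibre E p)"
    and U: "local_frame E U r e"
  shows "local_frame F U r (\<lambda>i p. h p (e i p))"
  unfolding local_frame_iff
proof (intro conjI ballI allI impI local_frameD(1)[OF U])
  show "(\<lambda>p. h p (e i p)) \<in> sections F" if "i < r" for i
    using assms(1) local_frameD(2)[OF U that] unfolding bundle_morphism_def by blast
  show "family_basis (fibre F q) r (\<lambda>i. h q (e i q))" if "q \<in> U" for q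
    by (rule family_basis_image[OF local_frameD(3)[OF U that] assms(3) _ assms(2)])
      (use assms(1) in \<open>auto simp: bundle_morphism_def\<close>)
qed

text \<open>A fibrewise bijective morphism maps frames to frames and preserves coefficients, so its inverse
  preserves smoothness.\<close>

theorem bundle_isomorphismI:
  assumes E: "vector_bundle M E" and F: "vector_bundle M F" and h: "bundle_morphism E F h"
    and bij: "\<And>p. bij_betw (h p) (fibre E p) (fibre F p)"
  shows "bundle_isomorphism E F h"
proof -
  let ?g = "\<lambda>p. inv_into (fibre E p) (h p)"
  have lin: "linear_on_subspace (fibre E p) (h p)" for p using h unfolding bundle_morphism_def by blast
  have sub: "subspace (fibre E p)" for p using E unfolding vector_bundle_iff by blast
  have gE: "?g p u \<in> fibre E p" and hg: "h p (?g p u) = u" if "u \<in> fibre F p" for p u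
    using bij[of p] that by (auto simp: bij_betw_def inv_into_into f_inv_into_f)
  have gh: "?g p (h p u) = u" if "u \<in> fibre E p" for p u
    using bij[of p] that by (auto simp: bij_betw_def)
  have "linear_on_subspace (fibre F p) (?g p)" for p
    unfolding linear_on_subspace_def
  proof (intro conjI ballI allI)
    fix u v assume u: "u \<in> fibre F p" and v: "v \<in> fibre F p"
    have "h p (?g p u + ?g p v) = u + v"
      using lin[of p] gE[OF u] gE[OF v] hg[OF u] hg[OF v] unfolding linear_on_subspace_def by metis
    then show "?g p (u + v) = ?g p u + ?g p v"
      using gh[OF subspace_add[OF sub gE[OF u] gE[OF v]]] by simp
  next
    fix c u assume u: "u \<in> fibre F p"
    have "h p (c *\<^sub>R ?g p u) = c *\<^sub>R u"
      using lin[of p] gE[OF u] hg[OF u] unfolding linear_on_subspace_def by metis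
    then show "?g p (c *\<^sub>R u) = c *\<^sub>R ?g p u"
      using gh[OF subspace_scale[OF sub gE[OF u]], of c] by simp
  qed
  moreover have "(\<lambda>p. ?g p (t p)) \<in> sections E" if t: "t \<in> sections F" for t
  proof -
    have tF: "t p \<in> fibre F p" for p using F t unfolding vector_bundle_iff by blast
    have "smooth_coefficients E U r e (\<lambda>p. ?g p (t p))" if U: "local_frame E U r e" for U r e
    proof -
      have "smooth_coefficients F U r (\<lambda>i p. h p (e i p)) t"
        using F t local_frame_image[OF h bij sub U] unfolding vector_bundle_iff by blast
      then obtain c where c: "\<forall>i<r. c i \<in> C_on U" "\<And>q. q \<in> U \<Longrightarrow> t q = (\<Sum>i<r. c i q *\<^sub>R h q (e i q))"
        unfolding smooth_coefficients_def by blast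
      have "?g q (t q) = (\<Sum>i<r. c i q *\<^sub>R e i q)" if q: "q \<in> U" for q
      proof -
        note b = local_frameD(3)[OF U q]
        have "t q = h q (\<Sum>i<r. c i q *\<^sub>R e i q)"
          using linear_on_subspace_sum[OF lin[of q] sub, of "{..<r}" "\<lambda>i. e i q" "\<lambda>i. c i q"]
            family_basis_mem[OF b] c(2)[OF q] by simp
        then show ?thesis using gh[OF family_basis_sum_mem[OF b]] by simp
      qed
      with c(1) show ?thesis unfolding smooth_coefficients_def by blast
    qed
    then show ?thesis using E gE[OF tF] unfolding vector_bundle_iff by blast
  qed
  ultimately have "bundle_morphism F E ?g"
    unfolding bundle_morphism_def using gE by blast
  with h bij show ?thesis unfolding bundle_isomorphism_def by blast
qed


section \<open>The tangent and the cotangent bundle\<close>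

lemma tangent_subspace: "subspace (T p)"
proof (rule subspaceI)
  show "0 \<in> T p" by (auto intro: tangentI)
next
  fix v w assume "v \<in> T p" "w \<in> T p"
  then show "v + w \<in> T p"
    unfolding tangent_iff by (simp add: algebra_simps)
next
  fix c v assume "v \<in> T p"
  then show "c *\<^sub>R v \<in> T p"
    unfolding tangent_iff by (simp add: scaleR_fun_def algebra_simps)
qed

lemma vector_field_zero: "(\<lambda>p. 0) \<in> \<X>"
  by (rule vector_fieldI) (auto intro: subspace_0 tangent_subspace C_const)

lemma vector_field_add: "X \<in> \<X> \<Longrightarrow> Y \<in> \<X> \<Longrightarrow> (\<lambda>p. X p + Y p) \<in> \<X>"
  by (rule vector_fieldI, intro subspace_add tangent_subspace vector_fieldD) (simp_all add: C_add vector_fieldD)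

lemma vector_field_mult: "f \<in> C \<Longrightarrow> X \<in> \<X> \<Longrightarrow> (\<lambda>p. f p *\<^sub>R X p) \<in> \<X>"
  by (rule vector_fieldI, intro subspace_scale tangent_subspace vector_fieldD)
    (simp_all add: scaleR_fun_def C_mult vector_fieldD)

lemma coordinatesD:
  assumes "coordinates_on W x D"
  shows "open W" "\<And>i. i < DIM('b) \<Longrightarrow> x i \<in> C" "\<And>i. i < DIM('b) \<Longrightarrow> D i \<in> \<X>"
    "\<And>q i j. q \<in> W \<Longrightarrow> i < DIM('b) \<Longrightarrow> j < DIM('b) \<Longrightarrow> D i q (x j) = (if i = j then 1 else 0)"
    "\<And>q v. q \<in> W \<Longrightarrow> v \<in> T q \<Longrightarrow> v = (\<Sum>i<DIM('b). v (x i) *\<^sub>R D i q)"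
  using assms unfolding coordinates_on_def by blast+

lemma coordinates_tangent_basis:
  assumes "coordinates_on W x D" "q \<in> W"
  shows "family_basis (T q) (DIM('b)) (\<lambda>i. D i q)"
  unfolding family_basis_def
proof (intro conjI allI impI iffI)
  note co = coordinatesD[OF assms(1)]
  fix v
  show "v \<in> T q \<Longrightarrow> \<exists>z. v = (\<Sum>i<DIM('b). z i *\<^sub>R D i q)"
    by (rule exI[of _ "\<lambda>i. v (x i)"]) (rule co(5)[OF assms(2)])
  show "v \<in> T q" if "\<exists>z. v = (\<Sum>i<DIM('b). z i *\<^sub>R D i q)"
  proof -
    have "(\<Sum>i<DIM('b). z i *\<^sub>R D i q) \<in> T q" for z
      by (rule subspace_sum[OF tangent_subspace])
        (simp add: subspace_scale[OF tangent_subspace] vector_fieldD(1) co(3))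
    then show ?thesis using that by blast
  qed
next
  note co = coordinatesD[OF assms(1)]
  fix z j assume z: "(\<Sum>i<DIM('b). z i *\<^sub>R D i q) = 0" and j: "j < DIM('b)"
  have "(\<Sum>i<DIM('b). z i *\<^sub>R D i q) (x j) = z j"
  proof -
    have "(\<Sum>i<DIM('b). z i * D i q (x j)) = (\<Sum>i<DIM('b). if i = j then z i else 0)"
      by (intro sum.cong refl) (simp add: co(4)[OF assms(2) _ j])
    then show ?thesis unfolding sum_fun_eval using j by simp
  qed
  with z show "z j = 0" by simp
qed

theorem tangent_bundle_vector_bundle: "vector_bundle M (tangent_bundle M)"
proof (rule vector_bundleI, unfold tangent_bundle_def vbundle.simps)
  fix s assume s: "\<And>p. s p \<in> T p"
    and glue: "\<And>p. \<exists>W t. open W \<and> p \<in> W \<and> t \<in> \<X> \<and> (\<forall>q\<in>W. s q = t q)"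
  show "s \<in> \<X>"
  proof (rule vector_fieldI[OF s], rule C_localI)
    fix f p assume f: "f \<in> C"
    obtain W t where "open W" "p \<in> W" "t \<in> \<X>" "\<forall>q\<in>W. s q = t q" using glue by blast
    then show "\<exists>W g. open W \<and> p \<in> W \<and> g \<in> C_on W \<and> (\<forall>q\<in>W. s q f = g q)"
      using vector_fieldD(2)[OF _ f] by (intro exI[of _ W] exI[of _ "\<lambda>q. t q f"]) (auto intro: C_imp_C_on)
  qed
next
  fix p
  obtain W x D where p: "p \<in> W" and xD: "coordinates_on W x D" by (rule coordinates_exist)
  note co = coordinatesD[OF xD]
  have "local_frame \<lparr>fibre = T, sections = \<X>\<rparr> W (DIM('b)) D"
    unfolding local_frame_iff using co(1,3) coordinates_tangent_basis[OF xD] by simp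
  moreover have "smooth_coefficients \<lparr>fibre = T, sections = \<X>\<rparr> W (DIM('b)) D s" if s: "s \<in> \<X>" for s
    unfolding smooth_coefficients_def
    by (intro exI[of _ "\<lambda>i q. s q (x i)"] conjI allI impI ballI co(5)[OF _ vector_fieldD(1)[OF s]]
        C_imp_C_on vector_fieldD(2)[OF s] co(2))
  ultimately show "\<exists>W n d. p \<in> W \<and> local_frame \<lparr>fibre = T, sections = \<X>\<rparr> W n d \<and>
      (\<forall>s\<in>\<X>. smooth_coefficients \<lparr>fibre = T, sections = \<X>\<rparr> W n d s)"
    using p by blast
qed (assumption | rule tangent_subspace vector_fieldD(1) vector_field_zero vector_field_add vector_field_mult)+

lemma cotangent_iff:
  "a \<in> T' p \<longleftrightarrow> linear_on_subspace (T p) a \<and> (\<forall>v. v \<notin> T p \<longrightarrow> a v = 0)"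
  unfolding cotangent_space_def by simp

lemma cotangent_linear:
  assumes "a \<in> T' p"
  shows "v \<in> T p \<Longrightarrow> w \<in> T p \<Longrightarrow> a (v + w) = a v + a w" "v \<in> T p \<Longrightarrow> a (c *\<^sub>R v) = c * a v"
  using assms unfolding cotangent_iff linear_on_subspace_def by auto

lemma cotangent_outside: "a \<in> T' p \<Longrightarrow> v \<notin> T p \<Longrightarrow> a v = 0"
  unfolding cotangent_iff by blast

lemma cotangent_eqI:
  assumes "a \<in> T' p" "b \<in> T' p" "\<And>v. v \<in> T p \<Longrightarrow> a v = b v"
  shows "a = b"
proof
  fix v show "a v = b v"
    using assms by (cases "v \<in> T p") (auto simp: cotangent_outside)
qed

lemma cotangent_sum:
  fixes z :: "'i \<Rightarrow> real"
  assumes "a \<in> T' p" "\<And>i. i \<in> I \<Longrightarrow> v i \<in> T p"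
  shows "a (\<Sum>i\<in>I. z i *\<^sub>R v i) = (\<Sum>i\<in>I. z i * a (v i))"
  using linear_on_subspace_sum[OF _ tangent_subspace assms(2), where h = a and z = z] assms(1)
  unfolding cotangent_iff by auto

lemma cotangent_subspace: "subspace (T' p)"
  by (rule subspaceI) (auto simp: cotangent_iff linear_on_subspace_def scaleR_fun_def algebra_simps)

lemma one_formD: "\<alpha> \<in> \<Omega> \<Longrightarrow> \<alpha> p \<in> T' p" "\<alpha> \<in> \<Omega> \<Longrightarrow> X \<in> \<X> \<Longrightarrow> (\<lambda>p. \<alpha> p (X p)) \<in> C"
  unfolding one_forms_def by auto

lemma one_formI:
  "(\<And>p. \<alpha> p \<in> T' p) \<Longrightarrow> (\<And>X. X \<in> \<X> \<Longrightarrow> (\<lambda>p. \<alpha> p (X p)) \<in> C) \<Longrightarrow> \<alpha> \<in> \<Omega>"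
  unfolding one_forms_def by auto

lemma one_form_zero: "(\<lambda>p. 0) \<in> \<Omega>"
  by (rule one_formI) (auto intro: subspace_0 cotangent_subspace C_const)

lemma one_form_add: "\<alpha> \<in> \<Omega> \<Longrightarrow> \<beta> \<in> \<Omega> \<Longrightarrow> (\<lambda>p. \<alpha> p + \<beta> p) \<in> \<Omega>"
  by (rule one_formI, intro subspace_add cotangent_subspace one_formD) (simp_all add: C_add one_formD)

lemma one_form_diff: "\<alpha> \<in> \<Omega> \<Longrightarrow> \<beta> \<in> \<Omega> \<Longrightarrow> (\<lambda>p. \<alpha> p - \<beta> p) \<in> \<Omega>"
  by (rule one_formI, intro subspace_diff cotangent_subspace one_formD) (simp_all add: C_diff one_formD)

lemma one_form_mult: "f \<in> C \<Longrightarrow> \<alpha> \<in> \<Omega> \<Longrightarrow> (\<lambda>p. f p *\<^sub>R \<alpha> p) \<in> \<Omega>"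
  by (rule one_formI, intro subspace_scale cotangent_subspace one_formD)
    (simp_all add: scaleR_fun_def C_mult one_formD)

lemma differential_apply: "v \<in> T p \<Longrightarrow> differential M f p v = v f"
  unfolding differential_def by simp

lemma differential_one_form:
  assumes "f \<in> C" shows "differential M f \<in> \<Omega>"
proof (rule one_formI)
  show "differential M f p \<in> T' p" for p
    unfolding cotangent_iff linear_on_subspace_def
    using subspace_add[OF tangent_subspace[of p]] subspace_scale[OF tangent_subspace[of p]]
    by (auto simp: differential_def scaleR_fun_def)
  show "(\<lambda>p. differential M f p (X p)) \<in> C" if "X \<in> \<X>" for X
    using vector_fieldD[OF that] assms by (simp add: differential_apply)
qed

lemma one_form_coordinates:
  assumes xD: "coordinates_on W x D" and q: "q \<in> W" and a: "a \<in> T' q"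
  shows "a = (\<Sum>i<DIM('b). a (D i q) *\<^sub>R differential M (x i) q)"
proof (rule cotangent_eqI[OF a])
  note co = coordinatesD[OF xD]
  show "(\<Sum>i<DIM('b). a (D i q) *\<^sub>R differential M (x i) q) \<in> T' q"
    by (intro subspace_sum subspace_scale cotangent_subspace one_formD(1) differential_one_form co(2)) auto
  fix v assume v: "v \<in> T q"
  have "a v = a (\<Sum>i<DIM('b). v (x i) *\<^sub>R D i q)"
    using co(5)[OF q v] by simp
  also have "\<dots> = (\<Sum>i<DIM('b). v (x i) * a (D i q))"
    by (rule cotangent_sum[OF a]) (auto intro: vector_fieldD(1) co(3))
  also have "\<dots> = (\<Sum>i<DIM('b). a (D i q) *\<^sub>R differential M (x i) q) v"
    unfolding sum_fun_eval differential_apply[OF v] by (simp add: mult.commute)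
  finally show "a v = (\<Sum>i<DIM('b). a (D i q) *\<^sub>R differential M (x i) q) v" .
qed

lemma coordinates_cotangent_basis:
  assumes xD: "coordinates_on W x D" and q: "q \<in> W"
  shows "family_basis (T' q) (DIM('b)) (\<lambda>i. differential M (x i) q)"
  unfolding family_basis_def
proof (intro conjI allI impI iffI)
  fix a
  show "a \<in> T' q \<Longrightarrow> \<exists>z. a = (\<Sum>i<DIM('b). z i *\<^sub>R differential M (x i) q)"
    by (rule exI[of _ "\<lambda>i. a (D i q)"]) (rule one_form_coordinates[OF assms])
  show "a \<in> T' q" if "\<exists>z. a = (\<Sum>i<DIM('b). z i *\<^sub>R differential M (x i) q)"
  proof -
    have "(\<Sum>i<DIM('b). z i *\<^sub>R differential M (x i) q) \<in> T' q" for z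
      by (rule subspace_sum[OF cotangent_subspace])
        (simp add: subspace_scale[OF cotangent_subspace] one_formD(1) differential_one_form coordinatesD(2)[OF xD])
    then show ?thesis using that by blast
  qed
next
  note co = coordinatesD[OF xD]
  fix z j assume z: "(\<Sum>i<DIM('b). z i *\<^sub>R differential M (x i) q) = 0" and j: "j < DIM('b)"
  have "(\<Sum>i<DIM('b). z i *\<^sub>R differential M (x i) q) (D j q) = z j"
  proof -
    have "(\<Sum>i<DIM('b). z i * D j q (x i)) = (\<Sum>i<DIM('b). if i = j then z i else 0)"
      by (intro sum.cong refl) (simp add: co(4)[OF q j])
    then show ?thesis
      unfolding sum_fun_eval differential_apply[OF vector_fieldD(1)[OF co(3)[OF j]]] using j by simp
  qed
  with z show "z j = 0" by simp
qed

theorem cotangent_bundle_vector_bundle: "vector_bundle M (cotangent_bundle M)"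
proof (rule vector_bundleI, unfold cotangent_bundle_def vbundle.simps)
  fix s assume s: "\<And>p. s p \<in> T' p"
    and glue: "\<And>p. \<exists>W t. open W \<and> p \<in> W \<and> t \<in> \<Omega> \<and> (\<forall>q\<in>W. s q = t q)"
  show "s \<in> \<Omega>"
  proof (rule one_formI[OF s], rule C_localI)
    fix X p assume X: "X \<in> \<X>"
    obtain W t where "open W" "p \<in> W" "t \<in> \<Omega>" "\<forall>q\<in>W. s q = t q" using glue by blast
    then show "\<exists>W g. open W \<and> p \<in> W \<and> g \<in> C_on W \<and> (\<forall>q\<in>W. s q (X q) = g q)"
      using one_formD(2)[OF _ X] by (intro exI[of _ W] exI[of _ "\<lambda>q. t q (X q)"]) (auto intro: C_imp_C_on)
  qed
next
  fix p
  obtain W x D where p: "p \<in> W" and xD: "coordinates_on W x D" by (rule coordinates_exist)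
  note co = coordinatesD[OF xD]
  let ?d = "\<lambda>i. differential M (x i)"
  have "local_frame \<lparr>fibre = T', sections = \<Omega>\<rparr> W (DIM('b)) ?d"
    unfolding local_frame_iff using co(1,2) coordinates_cotangent_basis[OF xD] differential_one_form by simp
  moreover have "smooth_coefficients \<lparr>fibre = T', sections = \<Omega>\<rparr> W (DIM('b)) ?d s" if s: "s \<in> \<Omega>" for s
    unfolding smooth_coefficients_def
    by (intro exI[of _ "\<lambda>i q. s q (D i q)"] conjI allI impI ballI
        one_form_coordinates[OF xD _ one_formD(1)[OF s]] C_imp_C_on one_formD(2)[OF s] co(3))
  ultimately show "\<exists>W n d. p \<in> W \<and> local_frame \<lparr>fibre = T', sections = \<Omega>\<rparr> W n d \<and>
      (\<forall>s\<in>\<Omega>. smooth_coefficients \<lparr>fibre = T', sections = \<Omega>\<rparr> W n d s)"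
    using p by blast
qed (assumption | rule cotangent_subspace one_formD(1) one_form_zero one_form_add one_form_mult)+

end


section \<open>The Lie bracket and the Lie derivative\<close>

context manifold
begin

lemma tangent_eqI:
  assumes "v \<in> T p" "w \<in> T p" "\<And>f. f \<in> C \<Longrightarrow> v f = w f"
  shows "v = w"
proof
  fix f show "v f = w f"
    using assms(3) tangent_nonsmooth[OF assms(1)] tangent_nonsmooth[OF assms(2)] by (cases "f \<in> C") simp_all
qed

lemma vector_field_diff: "X \<in> \<X> \<Longrightarrow> Y \<in> \<X> \<Longrightarrow> (\<lambda>p. X p - Y p) \<in> \<X>"
  by (rule vector_fieldI, intro subspace_diff tangent_subspace vector_fieldD) (simp_all add: C_diff vector_fieldD)

lemma tangent_vector_extends:
  assumes "v \<in> T p"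
  obtains X where "X \<in> \<X>" "X p = v"
proof -
  obtain W x D where p: "p \<in> W" and xD: "coordinates_on W x D" by (rule coordinates_exist)
  note co = coordinatesD[OF xD]
  have "(\<lambda>q. \<Sum>i\<in>I. v (x i) *\<^sub>R D i q) \<in> \<X>" if "I \<subseteq> {..<DIM('b)}" for I
    using finite_subset[OF that finite_lessThan] that
  proof (induction I rule: finite_induct)
    case (insert i I)
    then have i: "i < DIM('b)" and IH: "(\<lambda>q. \<Sum>i\<in>I. v (x i) *\<^sub>R D i q) \<in> \<X>" by simp_all
    have "(\<lambda>q. v (x i) *\<^sub>R D i q + (\<Sum>i\<in>I. v (x i) *\<^sub>R D i q)) \<in> \<X>"
      by (rule vector_field_add[OF vector_field_mult[OF C_const co(3)[OF i]] IH])
    then show ?case unfolding sum.insert[OF insert.hyps(1,2)] .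
  qed (simp add: vector_field_zero)
  from this[OF subset_refl] show ?thesis
    by (rule that) (rule co(5)[OF p assms, symmetric])
qed

lemma lie_bracket_vector_field:
  assumes X: "X \<in> \<X>" and Y: "Y \<in> \<X>"
  shows "lie_bracket X Y \<in> \<X>"
proof (rule vector_fieldI)
  fix p
  note XT = vector_fieldD(1)[OF X] and YT = vector_fieldD(1)[OF Y]
    and XC = vector_fieldD(2)[OF X] and YC = vector_fieldD(2)[OF Y]
  show "lie_bracket X Y p \<in> T p"
  proof (rule tangentI)
    fix f g assume f: "f \<in> C" and g: "g \<in> C"
    show "lie_bracket X Y p (\<lambda>q. f q + g q) = lie_bracket X Y p f + lie_bracket X Y p g"
      unfolding lie_bracket_def tangent_add[OF XT f g] tangent_add[OF YT f g]
        tangent_add[OF XT YC[OF f] YC[OF g]] tangent_add[OF YT XC[OF f] XC[OF g]]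
      by simp
    show "lie_bracket X Y p (\<lambda>q. f q * g q) = f p * lie_bracket X Y p g + g p * lie_bracket X Y p f"
      unfolding lie_bracket_def tangent_mult[OF XT f g] tangent_mult[OF YT f g]
        tangent_add[OF XT C_mult[OF f YC[OF g]] C_mult[OF g YC[OF f]]]
        tangent_add[OF YT C_mult[OF f XC[OF g]] C_mult[OF g XC[OF f]]]
        tangent_mult[OF XT f YC[OF g]] tangent_mult[OF XT g YC[OF f]]
        tangent_mult[OF YT f XC[OF g]] tangent_mult[OF YT g XC[OF f]]
      by (simp add: algebra_simps)
  next
    fix c f assume f: "f \<in> C"
    show "lie_bracket X Y p (\<lambda>q. c * f q) = c * lie_bracket X Y p f"
      unfolding lie_bracket_def tangent_scale[OF XT f] tangent_scale[OF YT f]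
        tangent_scale[OF XT YC[OF f]] tangent_scale[OF YT XC[OF f]]
      by (simp add: algebra_simps)
  next
    fix f assume f: "f \<notin> C"
    show "lie_bracket X Y p f = 0"
      unfolding lie_bracket_def tangent_nonsmooth[OF XT f] tangent_nonsmooth[OF YT f]
        tangent_zero_fun[OF XT] tangent_zero_fun[OF YT] by simp
  qed
next
  fix f assume f: "f \<in> C"
  show "(\<lambda>p. lie_bracket X Y p f) \<in> C"
    unfolding lie_bracket_def
    by (rule C_diff[OF vector_fieldD(2)[OF X vector_fieldD(2)[OF Y f]] vector_fieldD(2)[OF Y vector_fieldD(2)[OF X f]]])
qed

lemma lie_bracket_skew: "lie_bracket X Y = - lie_bracket Y X"
  by (simp add: lie_bracket_def fun_eq_iff)

lemma lie_bracket_add_right: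
  assumes "X \<in> \<X>" "Y \<in> \<X>" "Z \<in> \<X>"
  shows "lie_bracket X (\<lambda>p. Y p + Z p) p = lie_bracket X Y p + lie_bracket X Z p"
proof (rule tangent_eqI)
  show "lie_bracket X (\<lambda>p. Y p + Z p) p \<in> T p"
    by (intro vector_fieldD(1) lie_bracket_vector_field vector_field_add assms)
  show "lie_bracket X Y p + lie_bracket X Z p \<in> T p"
    by (intro subspace_add[OF tangent_subspace] vector_fieldD(1) lie_bracket_vector_field assms)
  fix f assume f: "f \<in> C"
  show "lie_bracket X (\<lambda>p. Y p + Z p) p f = (lie_bracket X Y p + lie_bracket X Z p) f"
    unfolding lie_bracket_def plus_fun_def
      tangent_add[OF vector_fieldD(1)[OF assms(1)] vector_fieldD(2)[OF assms(2) f] vector_fieldD(2)[OF assms(3) f]]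
    by simp
qed

lemma lie_bracket_mult_right:
  assumes X: "X \<in> \<X>" and Y: "Y \<in> \<X>" and f: "f \<in> C"
  shows "lie_bracket X (\<lambda>p. f p *\<^sub>R Y p) p = f p *\<^sub>R lie_bracket X Y p + X p f *\<^sub>R Y p"
proof (rule tangent_eqI)
  show "lie_bracket X (\<lambda>p. f p *\<^sub>R Y p) p \<in> T p"
    by (intro vector_fieldD(1) lie_bracket_vector_field vector_field_mult assms)
  show "f p *\<^sub>R lie_bracket X Y p + X p f *\<^sub>R Y p \<in> T p"
    by (intro subspace_add[OF tangent_subspace] subspace_scale[OF tangent_subspace]
        vector_fieldD(1) lie_bracket_vector_field assms)
  fix g assume g: "g \<in> C"
  show "lie_bracket X (\<lambda>p. f p *\<^sub>R Y p) p g = (f p *\<^sub>R lie_bracket X Y p + X p f *\<^sub>R Y p) g"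
    unfolding lie_bracket_def plus_fun_def scaleR_fun_def real_scaleR_def
      tangent_mult[OF vector_fieldD(1)[OF X] f vector_fieldD(2)[OF Y g]]
    by (simp add: algebra_simps)
qed

lemma lie_bracket_jacobi:
  assumes X: "X \<in> \<X>" and Y: "Y \<in> \<X>" and Z: "Z \<in> \<X>"
  shows "lie_bracket X (lie_bracket Y Z) p + lie_bracket Y (lie_bracket Z X) p + lie_bracket Z (lie_bracket X Y) p = 0"
proof (rule tangent_eqI)
  show "lie_bracket X (lie_bracket Y Z) p + lie_bracket Y (lie_bracket Z X) p + lie_bracket Z (lie_bracket X Y) p \<in> T p"
    by (intro subspace_add[OF tangent_subspace] vector_fieldD(1) lie_bracket_vector_field assms)
  show "0 \<in> T p" by (rule subspace_0[OF tangent_subspace])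
  fix f assume f: "f \<in> C"
  have C2: "(\<lambda>q. A q (\<lambda>q. B q f)) \<in> C" if "A \<in> \<X>" "B \<in> \<X>" for A B
    by (rule vector_fieldD(2)[OF that(1) vector_fieldD(2)[OF that(2) f]])
  have "lie_bracket A (lie_bracket B D) p f =
      A p (\<lambda>q. B q (\<lambda>q. D q f)) - A p (\<lambda>q. D q (\<lambda>q. B q f)) -
      (B p (\<lambda>q. D q (\<lambda>q. A q f)) - D p (\<lambda>q. B q (\<lambda>q. A q f)))"
    if "A \<in> \<X>" "B \<in> \<X>" "D \<in> \<X>" for A B D
    unfolding lie_bracket_def
      tangent_diff[OF vector_fieldD(1)[OF that(1)] C2[OF that(2,3)] C2[OF that(3,2)]]
    by simp
  then show "(lie_bracket X (lie_bracket Y Z) p + lie_bracket Y (lie_bracket Z X) p + lie_bracket Z (lie_bracket X Y) p) f = 0 f"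
    using assms by simp
qed

text \<open>Multiplying \<open>X\<close> by a bump function turns its local coordinate expansion into a global one, so
  the value of \<open>F X\<close> at \<open>p\<close> depends on \<open>X p\<close> only.\<close>

lemma C_linear_local:
  assumes add: "\<And>X Y. X \<in> \<X> \<Longrightarrow> Y \<in> \<X> \<Longrightarrow> F (\<lambda>p. X p + Y p) p = F X p + F Y p"
    and mult: "\<And>f X. f \<in> C \<Longrightarrow> X \<in> \<X> \<Longrightarrow> F (\<lambda>p. f p *\<^sub>R X p) p = f p * F X p"
    and X: "X \<in> \<X>" and Y: "Y \<in> \<X>" and eq: "X p = Y p"
  shows "F X p = (F Y p :: real)"
proof -
  obtain W x D where p: "p \<in> W" and xD: "coordinates_on W x D" by (rule coordinates_exist)
  note co = coordinatesD[OF xD]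
  obtain \<kappa> K W' where k: "\<kappa> \<in> C" "closed K" "K \<subseteq> W" "\<And>q. q \<notin> K \<Longrightarrow> \<kappa> q = 0"
    "open W'" "p \<in> W'" "W' \<subseteq> W" "\<And>q. q \<in> W' \<Longrightarrow> \<kappa> q = 1"
    using bump_function[OF co(1) p] by metis
  have zero: "F (\<lambda>p. 0) p = 0"
    using mult[OF C_const vector_field_zero, of 0] by simp
  have sum: "(\<lambda>q. \<Sum>i\<in>I. f i q *\<^sub>R D i q) \<in> \<X> \<and> F (\<lambda>q. \<Sum>i\<in>I. f i q *\<^sub>R D i q) p = (\<Sum>i\<in>I. f i p * F (D i) p)"
    if "I \<subseteq> {..<DIM('b)}" and f: "\<And>i. i < DIM('b) \<Longrightarrow> f i \<in> C" for I f
    using finite_subset[OF that(1) finite_lessThan] that(1)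
  proof (induction I rule: finite_induct)
    case (insert i I)
    then have i: "i < DIM('b)" and IH: "(\<lambda>q. \<Sum>i\<in>I. f i q *\<^sub>R D i q) \<in> \<X>"
      "F (\<lambda>q. \<Sum>i\<in>I. f i q *\<^sub>R D i q) p = (\<Sum>i\<in>I. f i p * F (D i) p)" by simp_all
    note fD = vector_field_mult[OF f[OF i] co(3)[OF i]]
    show ?case
      unfolding sum.insert[OF insert.hyps(1,2)] add[OF fD IH(1)] IH(2) mult[OF f[OF i] co(3)[OF i]]
      using vector_field_add[OF fD IH(1)] by (rule conjI) (rule refl)
  qed (simp add: vector_field_zero zero)
  have expand: "F Z p = (\<Sum>i<DIM('b). Z p (x i) * F (D i) p)" if Z: "Z \<in> \<X>" for Z
  proof -
    have "\<kappa> q *\<^sub>R Z q = (\<Sum>i<DIM('b). (\<kappa> q * Z q (x i)) *\<^sub>R D i q)" for q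
    proof (cases "q \<in> W")
      case True
      have "\<kappa> q *\<^sub>R Z q = \<kappa> q *\<^sub>R (\<Sum>i<DIM('b). Z q (x i) *\<^sub>R D i q)"
        by (rule arg_cong[OF co(5)[OF True vector_fieldD(1)[OF Z]]])
      then show ?thesis by (simp add: scaleR_sum_right)
    next
      case False
      then have "\<kappa> q = 0" using k(3,4) by blast
      then show ?thesis by simp
    qed
    then have "F (\<lambda>q. \<kappa> q *\<^sub>R Z q) p = F (\<lambda>q. \<Sum>i<DIM('b). (\<kappa> q * Z q (x i)) *\<^sub>R D i q) p"
      by simp
    also have "\<dots> = (\<Sum>i<DIM('b). (\<kappa> p * Z p (x i)) * F (D i) p)"
      using sum[OF subset_refl, of "\<lambda>i q. \<kappa> q * Z q (x i)"] C_mult[OF k(1) vector_fieldD(2)[OF Z co(2)]] by simp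
    finally show ?thesis using mult[OF k(1) Z] k(8)[OF k(6)] by simp
  qed
  show ?thesis unfolding expand[OF X] expand[OF Y] eq ..
qed

text \<open>By the previous lemma \<open>F\<close> descends to tangent vectors, all of which extend to vector fields.\<close>

lemma C_linear_one_form:
  assumes F: "\<And>X. X \<in> \<X> \<Longrightarrow> F X \<in> C"
    and add: "\<And>X Y p. X \<in> \<X> \<Longrightarrow> Y \<in> \<X> \<Longrightarrow> F (\<lambda>p. X p + Y p) p = F X p + F Y p"
    and mult: "\<And>f X p. f \<in> C \<Longrightarrow> X \<in> \<X> \<Longrightarrow> F (\<lambda>p. f p *\<^sub>R X p) p = f p * F X p"
  obtains \<gamma> where "\<gamma> \<in> \<Omega>" "\<And>X p. X \<in> \<X> \<Longrightarrow> \<gamma> p (X p) = F X p"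
proof -
  define \<gamma> where "\<gamma> = (\<lambda>p v. if v \<in> T p then F (SOME X. X \<in> \<X> \<and> X p = v) p else 0)"
  have \<gamma>: "\<gamma> p (X p) = F X p" if X: "X \<in> \<X>" for X p
  proof -
    let ?Y = "SOME Y. Y \<in> \<X> \<and> Y p = X p"
    have "?Y \<in> \<X> \<and> ?Y p = X p" by (rule someI[of _ X]) (simp add: X)
    then have "F ?Y p = F X p" using C_linear_local[of F p ?Y X] add mult X by simp
    then show ?thesis using vector_fieldD(1)[OF X] by (simp add: \<gamma>_def)
  qed
  have "\<gamma> \<in> \<Omega>"
  proof (rule one_formI)
    fix p
    show "\<gamma> p \<in> T' p"
      unfolding cotangent_iff linear_on_subspace_def
    proof (intro conjI ballI allI impI)
      fix v w assume "v \<in> T p" "w \<in> T p"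
      then obtain X Y where X: "X \<in> \<X>" "X p = v" and Y: "Y \<in> \<X>" "Y p = w"
        by (metis tangent_vector_extends)
      show "\<gamma> p (v + w) = \<gamma> p v + \<gamma> p w"
        using \<gamma>[OF vector_field_add[OF X(1) Y(1)], of p] add[OF X(1) Y(1)] \<gamma>[OF X(1), of p] \<gamma>[OF Y(1), of p]
        by (simp add: X(2) Y(2))
    next
      fix c v assume "v \<in> T p"
      then obtain X where X: "X \<in> \<X>" "X p = v" by (rule tangent_vector_extends)
      show "\<gamma> p (c *\<^sub>R v) = c *\<^sub>R \<gamma> p v"
        using \<gamma>[OF vector_field_mult[OF C_const X(1)], of p c] mult[OF C_const X(1), of c] \<gamma>[OF X(1), of p]
        by (simp add: X(2))
    qed (simp add: \<gamma>_def)
  qed (simp add: \<gamma> F)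
  then show ?thesis using \<gamma> by (rule that)
qed

lemma one_form_eqI:
  assumes "\<alpha> \<in> \<Omega>" "\<beta> \<in> \<Omega>" "\<And>X p. X \<in> \<X> \<Longrightarrow> \<alpha> p (X p) = \<beta> p (X p)"
  shows "\<alpha> = \<beta>"
proof
  fix p
  show "\<alpha> p = \<beta> p"
  proof (rule cotangent_eqI[OF one_formD(1)[OF assms(1)] one_formD(1)[OF assms(2)]])
    fix v assume "v \<in> T p"
    then obtain X where "X \<in> \<X>" "X p = v" by (rule tangent_vector_extends)
    then show "\<alpha> p v = \<beta> p v" using assms(3)[of X p] by simp
  qed
qed

text \<open>The Leibniz rule prescribes the Lie derivative as a functional on vector fields, and this
  functional is linear over the smooth functions.\<close>

lemma lie_derivative:
  assumes X: "X \<in> \<X>" and \<beta>: "\<beta> \<in> \<Omega>"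
  shows "lie_derivative M X \<beta> \<in> \<Omega>"
    and "Y \<in> \<X> \<Longrightarrow> lie_derivative M X \<beta> p (Y p) = X p (\<lambda>q. \<beta> q (Y q)) - \<beta> p (lie_bracket X Y p)"
proof -
  note XT = vector_fieldD(1)[OF X] and br = vector_fieldD(1)[OF lie_bracket_vector_field[OF X]]
    and \<beta>T = cotangent_linear[OF one_formD(1)[OF \<beta>]] and \<beta>C = one_formD(2)[OF \<beta>]
  let ?F = "\<lambda>Y p. X p (\<lambda>q. \<beta> q (Y q)) - \<beta> p (lie_bracket X Y p)"
  obtain \<gamma> where \<gamma>: "\<gamma> \<in> \<Omega>" "\<And>Y p. Y \<in> \<X> \<Longrightarrow> \<gamma> p (Y p) = ?F Y p"
  proof (rule C_linear_one_form[of ?F, OF _ _ _ that])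
    fix Y assume Y: "Y \<in> \<X>"
    show "?F Y \<in> C"
      by (rule C_diff[OF vector_fieldD(2)[OF X \<beta>C[OF Y]] \<beta>C[OF lie_bracket_vector_field[OF X Y]]])
    fix Z p assume Z: "Z \<in> \<X>"
    have "(\<lambda>q. \<beta> q (Y q + Z q)) = (\<lambda>q. \<beta> q (Y q) + \<beta> q (Z q))"
      by (rule ext) (rule \<beta>T(1)[OF vector_fieldD(1)[OF Y] vector_fieldD(1)[OF Z]])
    then show "?F (\<lambda>p. Y p + Z p) p = ?F Y p + ?F Z p"
      by (simp add: tangent_add[OF XT \<beta>C[OF Y] \<beta>C[OF Z]] lie_bracket_add_right[OF X Y Z] \<beta>T(1)[OF br[OF Y] br[OF Z]])
  next
    fix f Y p assume f: "f \<in> C" and Y: "Y \<in> \<X>"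
    have "(\<lambda>q. \<beta> q (f q *\<^sub>R Y q)) = (\<lambda>q. f q * \<beta> q (Y q))"
      by (rule ext) (rule \<beta>T(2)[OF vector_fieldD(1)[OF Y]])
    moreover have "\<beta> p (lie_bracket X (\<lambda>p. f p *\<^sub>R Y p) p) = f p * \<beta> p (lie_bracket X Y p) + X p f * \<beta> p (Y p)"
      unfolding lie_bracket_mult_right[OF X Y f]
      by (simp add: \<beta>T br[OF Y] vector_fieldD(1)[OF Y] subspace_scale[OF tangent_subspace])
    ultimately show "?F (\<lambda>p. f p *\<^sub>R Y p) p = f p * ?F Y p"
      by (simp add: tangent_mult[OF XT f \<beta>C[OF Y]] algebra_simps)
  qed
  let ?P = "\<lambda>\<gamma>. \<gamma> \<in> \<Omega> \<and> (\<forall>Y\<in>\<X>. \<forall>p. X p (\<lambda>q. \<beta> q (Y q)) = \<gamma> p (Y p) + \<beta> p (lie_bracket X Y p))"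
  have "?P (lie_derivative M X \<beta>)"
    unfolding lie_derivative_def
  proof (rule theI[where P = ?P and a = \<gamma>])
    show "?P \<gamma>" using \<gamma> by simp
    fix \<delta> assume \<delta>: "?P \<delta>"
    show "\<delta> = \<gamma>"
    proof (rule one_form_eqI)
      show "\<delta> p (Y p) = \<gamma> p (Y p)" if "Y \<in> \<X>" for Y p
        using \<delta> \<gamma>(2)[OF that, of p] that by (simp add: algebra_simps)
    qed (use \<delta> \<gamma>(1) in simp_all)
  qed
  then show "lie_derivative M X \<beta> \<in> \<Omega>"
    and "Y \<in> \<X> \<Longrightarrow> lie_derivative M X \<beta> p (Y p) = X p (\<lambda>q. \<beta> q (Y q)) - \<beta> p (lie_bracket X Y p)"
    by simp_all
qed

end


section \<open>Lie algebroids isomorphic to the tangent algebroid\<close>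

context manifold
begin

lemma vector_bundle_section_mem:
  "vector_bundle M E \<Longrightarrow> s \<in> sections E \<Longrightarrow> s p \<in> fibre E p"
  unfolding vector_bundle_iff by blast

lemma vector_bundle_subspace: "vector_bundle M E \<Longrightarrow> subspace (fibre E p)"
  unfolding vector_bundle_iff by blast

lemma vector_bundle_sectionI:
  assumes "vector_bundle M E" "\<And>p. s p \<in> fibre E p"
    "\<And>U r e. local_frame E U r e \<Longrightarrow> smooth_coefficients E U r e s"
  shows "s \<in> sections E"
  using assms unfolding vector_bundle_iff by blast

lemma vector_bundle_coefficients:
  assumes "vector_bundle M E" "s \<in> sections E" "local_frame E U r e"
  obtains c where "\<And>i. i < r \<Longrightarrow> c i \<in> C_on U" "\<And>q. q \<in> U \<Longrightarrow> s q = (\<Sum>i<r. c i q *\<^sub>R e i q)"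
proof -
  have "smooth_coefficients E U r e s" using assms unfolding vector_bundle_iff by blast
  then show ?thesis using that unfolding smooth_coefficients_def by blast
qed

lemma section_add:
  assumes E: "vector_bundle M E" and s: "s \<in> sections E" and t: "t \<in> sections E"
  shows "(\<lambda>p. s p + t p) \<in> sections E"
proof (rule vector_bundle_sectionI[OF E])
  show "s p + t p \<in> fibre E p" for p
    by (intro subspace_add[OF vector_bundle_subspace[OF E]] vector_bundle_section_mem[OF E] s t)
  fix U r e assume U: "local_frame E U r e"
  obtain c where c: "\<And>i. i < r \<Longrightarrow> c i \<in> C_on U" "\<And>q. q \<in> U \<Longrightarrow> s q = (\<Sum>i<r. c i q *\<^sub>R e i q)"
    by (rule vector_bundle_coefficients[OF E s U that])
  obtain d where d: "\<And>i. i < r \<Longrightarrow> d i \<in> C_on U" "\<And>q. q \<in> U \<Longrightarrow> t q = (\<Sum>i<r. d i q *\<^sub>R e i q)"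
    by (rule vector_bundle_coefficients[OF E t U that])
  show "smooth_coefficients E U r e (\<lambda>p. s p + t p)"
    unfolding smooth_coefficients_def
  proof (intro exI[of _ "\<lambda>i q. c i q + d i q"] conjI allI impI ballI)
    show "(\<lambda>q. c i q + d i q) \<in> C_on U" if "i < r" for i
      by (rule C_on_add[OF local_frameD(1)[OF U] c(1)[OF that] d(1)[OF that]])
    show "s q + t q = (\<Sum>i<r. (c i q + d i q) *\<^sub>R e i q)" if "q \<in> U" for q
      by (simp add: c(2)[OF that] d(2)[OF that] scaleR_left_distrib sum.distrib)
  qed
qed

lemma section_mult:
  assumes E: "vector_bundle M E" and s: "s \<in> sections E" and f: "f \<in> C"
  shows "(\<lambda>p. f p *\<^sub>R s p) \<in> sections E"
proof (rule vector_bundle_sectionI[OF E])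
  show "f p *\<^sub>R s p \<in> fibre E p" for p
    by (intro subspace_scale[OF vector_bundle_subspace[OF E]] vector_bundle_section_mem[OF E] s)
  fix U r e assume U: "local_frame E U r e"
  obtain c where c: "\<And>i. i < r \<Longrightarrow> c i \<in> C_on U" "\<And>q. q \<in> U \<Longrightarrow> s q = (\<Sum>i<r. c i q *\<^sub>R e i q)"
    by (rule vector_bundle_coefficients[OF E s U that])
  show "smooth_coefficients E U r e (\<lambda>p. f p *\<^sub>R s p)"
    unfolding smooth_coefficients_def
  proof (intro exI[of _ "\<lambda>i q. f q * c i q"] conjI allI impI ballI)
    show "(\<lambda>q. f q * c i q) \<in> C_on U" if "i < r" for i
      by (rule C_on_mult[OF local_frameD(1)[OF U] C_imp_C_on[OF f] c(1)[OF that]])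
    show "f q *\<^sub>R s q = (\<Sum>i<r. (f q * c i q) *\<^sub>R e i q)" if "q \<in> U" for q
      by (simp add: c(2)[OF that] scaleR_sum_right)
  qed
qed

lemma section_scale: "vector_bundle M E \<Longrightarrow> s \<in> sections E \<Longrightarrow> (\<lambda>p. c *\<^sub>R s p) \<in> sections E"
  using section_mult[OF _ _ C_const] .

text \<open>All algebroid axioms, the Jacobi identity included, are equations between sections; an anchor
  that is injective on fibres and respects brackets reflects them from vector fields.\<close>

theorem lie_algebroid_by_anchor:
  assumes E: "vector_bundle M E" and iso: "bundle_isomorphism E (tangent_bundle M) \<rho>"
    and sec: "\<And>s t. s \<in> sections E \<Longrightarrow> t \<in> sections E \<Longrightarrow> br s t \<in> sections E"
    and hom: "\<And>s t p. s \<in> sections E \<Longrightarrow> t \<in> sections E \<Longrightarrow>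
      \<rho> p (br s t p) = lie_bracket (\<lambda>p. \<rho> p (s p)) (\<lambda>p. \<rho> p (t p)) p"
  shows "lie_algebroid M E \<rho> br" and "algebroid_isomorphism E \<rho> br (tangent_bundle M) (\<lambda>p v. v) lie_bracket \<rho>"
proof -
  have mor: "bundle_morphism E (tangent_bundle M) \<rho>" and inj: "inj_on (\<rho> p) (fibre E p)" for p
    using iso unfolding bundle_isomorphism_def bij_betw_def by blast+
  have lin: "linear_on_subspace (fibre E p) (\<rho> p)" for p
    using mor unfolding bundle_morphism_def by blast
  have \<rho>add: "\<rho> p (u + v) = \<rho> p u + \<rho> p v" if "u \<in> fibre E p" "v \<in> fibre E p" for p u v
    using lin[of p] that unfolding linear_on_subspace_def by blast
  have \<rho>scale: "\<rho> p (c *\<^sub>R u) = c *\<^sub>R \<rho> p u" if "u \<in> fibre E p" for p u c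
    using lin[of p] that unfolding linear_on_subspace_def by blast
  note sub = vector_bundle_subspace[OF E] and mem = vector_bundle_section_mem[OF E]
  have \<rho>X: "(\<lambda>p. \<rho> p (s p)) \<in> \<X>" if "s \<in> sections E" for s
    using mor that unfolding bundle_morphism_def tangent_bundle_def by simp
  have eqI: "u = v" if "u \<in> fibre E p" "v \<in> fibre E p" "\<rho> p u = \<rho> p v" for p u v
    by (rule inj_onD[OF inj that(3,1,2)])
  have \<rho>neg: "\<rho> p (- u) = - \<rho> p u" if "u \<in> fibre E p" for p u
    using \<rho>scale[OF that, of "-1"] by simp
  have skew: "br s t p = - br t s p" if "s \<in> sections E" "t \<in> sections E" for s t p
  proof (rule eqI[of _ p])
    show "\<rho> p (br s t p) = \<rho> p (- br t s p)"
      unfolding \<rho>neg[OF mem[OF sec[OF that(2,1)]]] hom[OF that] hom[OF that(2,1)]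
      by (simp add: lie_bracket_skew[of "\<lambda>p. \<rho> p (s p)"])
  qed (intro subspace_neg[OF sub] mem sec that)+
  have addr: "br s (\<lambda>p. t p + u p) p = br s t p + br s u p"
    if s: "s \<in> sections E" and t: "t \<in> sections E" and u: "u \<in> sections E" for s t u p
  proof (rule eqI[of _ p])
    show "\<rho> p (br s (\<lambda>p. t p + u p) p) = \<rho> p (br s t p + br s u p)"
      unfolding \<rho>add[OF mem[OF sec[OF s t]] mem[OF sec[OF s u]]] hom[OF s section_add[OF E t u]] hom[OF s t] hom[OF s u]
        \<rho>add[OF mem[OF t] mem[OF u]]
      by (rule lie_bracket_add_right[OF \<rho>X[OF s] \<rho>X[OF t] \<rho>X[OF u]])
  qed (intro subspace_add[OF sub] mem sec section_add[OF E] s t u)+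
  have leibniz: "br s (\<lambda>p. f p *\<^sub>R t p) p = f p *\<^sub>R br s t p + \<rho> p (s p) f *\<^sub>R t p"
    if s: "s \<in> sections E" and t: "t \<in> sections E" and f: "f \<in> C" for s t f p
  proof (rule eqI[of _ p])
    show "\<rho> p (br s (\<lambda>p. f p *\<^sub>R t p) p) = \<rho> p (f p *\<^sub>R br s t p + \<rho> p (s p) f *\<^sub>R t p)"
      unfolding \<rho>add[OF subspace_scale[OF sub mem[OF sec[OF s t]]] subspace_scale[OF sub mem[OF t]]]
        \<rho>scale[OF mem[OF sec[OF s t]]] \<rho>scale[OF mem[OF t]] hom[OF s section_mult[OF E t f]] hom[OF s t]
      by (rule lie_bracket_mult_right[OF \<rho>X[OF s] \<rho>X[OF t] f])
  qed (intro subspace_add[OF sub] subspace_scale[OF sub] mem sec section_mult[OF E] s t f)+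
  have scaler: "br s (\<lambda>p. c *\<^sub>R t p) p = c *\<^sub>R br s t p" if s: "s \<in> sections E" and t: "t \<in> sections E" for s t c p
    using leibniz[OF s t C_const, of c p] tangent_const[OF vector_fieldD(1)[OF \<rho>X[OF s]]] by simp
  have jacobi: "br s (br t u) p + br t (br u s) p + br u (br s t) p = 0"
    if s: "s \<in> sections E" and t: "t \<in> sections E" and u: "u \<in> sections E" for s t u p
  proof (rule eqI[of _ p])
    have b: "br s (br t u) p \<in> fibre E p" "br t (br u s) p \<in> fibre E p" "br u (br s t) p \<in> fibre E p"
      by (intro mem sec s t u)+
    have bb: "(\<lambda>p. \<rho> p (br t u p)) = lie_bracket (\<lambda>p. \<rho> p (t p)) (\<lambda>p. \<rho> p (u p))"
      if "t \<in> sections E" "u \<in> sections E" for t u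
      by (rule ext) (rule hom[OF that])
    have "\<rho> p 0 = 0" using \<rho>scale[OF subspace_0[OF sub], of p 0] by simp
    then show "\<rho> p (br s (br t u) p + br t (br u s) p + br u (br s t) p) = \<rho> p 0"
      unfolding \<rho>add[OF subspace_add[OF sub b(1,2)] b(3)] \<rho>add[OF b(1,2)]
        hom[OF s sec[OF t u]] hom[OF t sec[OF u s]] hom[OF u sec[OF s t]] bb[OF t u] bb[OF u s] bb[OF s t]
      by (simp only: lie_bracket_jacobi[OF \<rho>X[OF s] \<rho>X[OF t] \<rho>X[OF u]])
    show "br s (br t u) p + br t (br u s) p + br u (br s t) p \<in> fibre E p"
      by (intro subspace_add[OF sub] b)
    show "0 \<in> fibre E p" by (rule subspace_0[OF sub])
  qed
  have funs: "u + v = (\<lambda>p. u p + v p)" "c *\<^sub>R u = (\<lambda>p. c *\<^sub>R u p)" for u v :: "'m \<Rightarrow> 'a" and c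
    by (simp_all add: plus_fun_def scaleR_fun_def)
  have "skew_algebroid M E \<rho> br"
    unfolding skew_algebroid_def
  proof (intro conjI ballI E mor sec)
    show "br s t = - br t s" if "s \<in> sections E" "t \<in> sections E" for s t
      by (rule ext) (simp add: skew[OF that])
    show "linear_on_subspace (sections E) (br s)" if s: "s \<in> sections E" for s
      unfolding linear_on_subspace_def funs
      by (intro conjI ballI allI ext addr[OF s] scaler[OF s])
    show "linear_on_subspace (sections E) (\<lambda>s. br s t)" if t: "t \<in> sections E" for t
      unfolding linear_on_subspace_def funs
    proof (intro conjI ballI allI ext)
      show "br (\<lambda>p. u p + v p) t p = br u t p + br v t p" if u: "u \<in> sections E" and v: "v \<in> sections E" for u v p
        unfolding skew[OF section_add[OF E u v] t] skew[OF u t] skew[OF v t] addr[OF t u v] by simp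
      show "br (\<lambda>p. c *\<^sub>R u p) t p = c *\<^sub>R br u t p" if u: "u \<in> sections E" for c u p
        unfolding skew[OF section_scale[OF E u] t] skew[OF u t] scaler[OF t u] by simp
    qed
    show "br s (\<lambda>p. f p *\<^sub>R t p) = (\<lambda>p. f p *\<^sub>R br s t p + \<rho> p (s p) f *\<^sub>R t p)"
      if "s \<in> sections E" "t \<in> sections E" "f \<in> C" for s t f
      by (rule ext) (rule leibniz[OF that])
  qed
  then show "lie_algebroid M E \<rho> br"
    unfolding lie_algebroid_def
  proof (intro conjI ballI)
    fix s t u assume "s \<in> sections E" "t \<in> sections E" "u \<in> sections E"
    from jacobi[OF this] show "br s (br t u) + br t (br u s) + br u (br s t) = 0"
      by (simp add: fun_eq_iff)
  qed
  show "algebroid_isomorphism E \<rho> br (tangent_bundle M) (\<lambda>p v. v) lie_bracket \<rho>"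
    unfolding algebroid_isomorphism_def
    by (intro conjI iso allI ballI refl ext hom)
qed

corollary tangent_lie_algebroid: "lie_algebroid M (tangent_bundle M) (\<lambda>p v. v) lie_bracket"
proof (rule lie_algebroid_by_anchor(1)[OF tangent_bundle_vector_bundle])
  show "bundle_isomorphism (tangent_bundle M) (tangent_bundle M) (\<lambda>p v. v)"
  proof (rule bundle_isomorphismI[OF tangent_bundle_vector_bundle tangent_bundle_vector_bundle])
    show "bundle_morphism (tangent_bundle M) (tangent_bundle M) (\<lambda>p v. v)"
      unfolding bundle_morphism_def linear_on_subspace_def by simp
    show "bij_betw (\<lambda>v. v) (fibre (tangent_bundle M) p) (fibre (tangent_bundle M) p)" for p
      unfolding bij_betw_def by simp
  qed
qed (simp_all add: tangent_bundle_def lie_bracket_vector_field)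

end


section \<open>Locally conformally symplectic manifolds\<close>

locale lcs_manifold = manifold M
  for M :: "('m::{t2_space, second_countable_topology}, 'b::euclidean_space) atlas" +
  fixes \<omega> :: "'m \<Rightarrow> 'm tvec \<Rightarrow> 'm tvec \<Rightarrow> real" and \<theta> :: "'m \<Rightarrow> 'm cvec"
  assumes lcs: "lcs_structure M \<omega> \<theta>"
begin

abbreviation "flat \<equiv> flat_form M \<omega>"
abbreviation "sharp \<equiv> sharp_form M \<omega>"
abbreviation "\<pi> \<equiv> lcs_bivector M \<omega>"
abbreviation "\<xi> \<equiv> lcs_vector_field M \<omega> \<theta>"

lemma \<theta>_one_form: "\<theta> \<in> \<Omega>"
  and nondegenerate: "v \<in> T p \<Longrightarrow> (\<And>w. w \<in> T p \<Longrightarrow> \<omega> p v w = 0) \<Longrightarrow> v = 0"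
  and \<theta>_closed: "X \<in> \<X> \<Longrightarrow> Y \<in> \<X> \<Longrightarrow>
    \<theta> p (lie_bracket X Y p) = X p (\<lambda>q. \<theta> q (Y q)) - Y p (\<lambda>q. \<theta> q (X q))"
  and lcs_equation: "X \<in> \<X> \<Longrightarrow> Y \<in> \<X> \<Longrightarrow> Z \<in> \<X> \<Longrightarrow> ext_deriv2 \<omega> X Y Z p + wedge12 \<theta> \<omega> X Y Z p = 0"
  using lcs unfolding lcs_structure_def ext_deriv1_def by (blast, blast, simp, blast)

lemma \<omega>_two_form: "\<omega> \<in> two_forms M"
  using lcs unfolding lcs_structure_def by blast

lemma \<omega>_linear: "v \<in> T p \<Longrightarrow> linear_on_subspace (T p) (\<omega> p v)"
  and \<omega>_skew: "v \<in> T p \<Longrightarrow> w \<in> T p \<Longrightarrow> \<omega> p v w = - \<omega> p w v"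
  and \<omega>_smooth: "X \<in> \<X> \<Longrightarrow> Y \<in> \<X> \<Longrightarrow> (\<lambda>p. \<omega> p (X p) (Y p)) \<in> C"
  using \<omega>_two_form unfolding two_forms_def by (blast, blast, blast)

lemma \<omega>_add: "u \<in> T p \<Longrightarrow> v \<in> T p \<Longrightarrow> w \<in> T p \<Longrightarrow> \<omega> p (u + v) w = \<omega> p u w + \<omega> p v w"
  and \<omega>_scale: "u \<in> T p \<Longrightarrow> w \<in> T p \<Longrightarrow> \<omega> p (c *\<^sub>R u) w = c * \<omega> p u w"
proof -
  assume u: "u \<in> T p" and w: "w \<in> T p"
  have l: "\<omega> p w (u + v) = \<omega> p w u + \<omega> p w v" if "v \<in> T p" for v
    using \<omega>_linear[OF w] u that unfolding linear_on_subspace_def by blast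
  show "\<omega> p (c *\<^sub>R u) w = c * \<omega> p u w"
    using \<omega>_linear[OF w] u \<omega>_skew[OF subspace_scale[OF tangent_subspace u] w] \<omega>_skew[OF u w]
    unfolding linear_on_subspace_def by simp
  assume v: "v \<in> T p"
  show "\<omega> p (u + v) w = \<omega> p u w + \<omega> p v w"
    using l[OF v] \<omega>_skew[OF subspace_add[OF tangent_subspace u v] w] \<omega>_skew[OF u w] \<omega>_skew[OF v w] by simp
qed

lemma flat_apply: "w \<in> T p \<Longrightarrow> flat p v w = - \<omega> p v w"
  unfolding flat_form_def by simp

lemma flat_cotangent: "v \<in> T p \<Longrightarrow> flat p v \<in> T' p"
  unfolding cotangent_iff linear_on_subspace_def
  using \<omega>_linear[of v p] subspace_add[OF tangent_subspace[of p]] subspace_scale[OF tangent_subspace[of p]]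
  by (simp add: flat_form_def linear_on_subspace_def)

lemma flat_one_form: "X \<in> \<X> \<Longrightarrow> (\<lambda>p. flat p (X p)) \<in> \<Omega>"
  by (rule one_formI) (simp_all add: flat_cotangent vector_fieldD(1) flat_apply C_minus \<omega>_smooth)

lemma flat_morphism: "bundle_morphism (tangent_bundle M) (cotangent_bundle M) flat"
  unfolding bundle_morphism_def tangent_bundle_def cotangent_bundle_def vbundle.simps
proof (intro conjI allI ballI flat_one_form)
  fix p
  show "flat p ` T p \<subseteq> T' p" using flat_cotangent by blast
  show "linear_on_subspace (T p) (flat p)"
    unfolding linear_on_subspace_def
  proof (intro conjI ballI allI ext)
    fix u v w assume u: "u \<in> T p" and v: "v \<in> T p"
    show "flat p (u + v) w = (flat p u + flat p v) w"
      by (simp add: flat_form_def \<omega>_add[OF u v])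
  next
    fix c v w assume v: "v \<in> T p"
    have "flat p (c *\<^sub>R v) w = c * flat p v w"
    proof (cases "w \<in> T p")
      case True
      show ?thesis by (simp only: flat_apply[OF True] \<omega>_scale[OF v True] mult_minus_right)
    qed (simp add: flat_form_def)
    then show "flat p (c *\<^sub>R v) w = (c *\<^sub>R flat p v) w" by (simp only: scaleR_fun_def[of c "flat p v"] real_scaleR_def)
  qed
qed

lemma flat_inj: "inj_on (flat p) (T p)"
proof (rule inj_onI)
  fix v w assume v: "v \<in> T p" and w: "w \<in> T p" and eq: "flat p v = flat p w"
  have "\<omega> p (v + (-1) *\<^sub>R w) u = 0" if u: "u \<in> T p" for u
  proof -
    have "\<omega> p v u = \<omega> p w u" using fun_cong[OF eq, of u] by (simp add: flat_apply[OF u])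
    then show ?thesis
      by (simp only: \<omega>_add[OF v subspace_scale[OF tangent_subspace w] u] \<omega>_scale[OF w u])
  qed
  then have "v + (-1) *\<^sub>R w = 0"
    by (rule nondegenerate[OF subspace_add[OF tangent_subspace v subspace_scale[OF tangent_subspace w]]])
  then show "v = w" by simp
qed

lemma flat_bij: "bij_betw (flat p) (T p) (T' p)"
proof -
  obtain W x D where p: "p \<in> W" and xD: "coordinates_on W x D" by (rule coordinates_exist)
  show ?thesis
  proof (rule injective_imp_bijective[OF coordinates_tangent_basis[OF xD p] tangent_subspace _ flat_inj
        coordinates_cotangent_basis[OF xD p]])
    show "linear_on_subspace (T p) (flat p)" "flat p ` T p \<subseteq> T' p"
      using flat_morphism unfolding bundle_morphism_def tangent_bundle_def cotangent_bundle_def by simp_all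
  qed
qed

text \<open>Smoothness of \<open>sharp\<close> rests on Cramer's rule, through \<open>bundle_isomorphismI\<close> and the independence
  of smoothness from the frame.\<close>

lemma sharp_morphism: "bundle_morphism (cotangent_bundle M) (tangent_bundle M) sharp"
proof -
  have "bundle_isomorphism (tangent_bundle M) (cotangent_bundle M) flat"
    by (rule bundle_isomorphismI[OF tangent_bundle_vector_bundle cotangent_bundle_vector_bundle flat_morphism])
      (simp add: tangent_bundle_def cotangent_bundle_def flat_bij)
  then have "bundle_morphism (cotangent_bundle M) (tangent_bundle M) (\<lambda>p. inv_into (fibre (tangent_bundle M) p) (flat p))"
    unfolding bundle_isomorphism_def by blast
  then show ?thesis unfolding sharp_form_def[abs_def] tangent_bundle_def by simp
qed

lemma sharp_tangent: "a \<in> T' p \<Longrightarrow> sharp p a \<in> T p"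
  and flat_sharp: "a \<in> T' p \<Longrightarrow> flat p (sharp p a) = a"
  and sharp_flat: "v \<in> T p \<Longrightarrow> sharp p (flat p v) = v"
  using flat_bij[of p] unfolding sharp_form_def bij_betw_def
  by (auto simp: inv_into_into f_inv_into_f)

lemma sharp_vector_field: "\<alpha> \<in> \<Omega> \<Longrightarrow> (\<lambda>p. sharp p (\<alpha> p)) \<in> \<X>"
  using sharp_morphism unfolding bundle_morphism_def tangent_bundle_def cotangent_bundle_def by simp

lemma \<xi>_vector_field: "\<xi> \<in> \<X>"
  using sharp_vector_field[OF \<theta>_one_form] unfolding lcs_vector_field_def[abs_def] .

lemma flat_\<xi>: "flat p (\<xi> p) = \<theta> p"
  unfolding lcs_vector_field_def by (rule flat_sharp[OF one_formD(1)[OF \<theta>_one_form]])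

lemma \<omega>_\<xi>: assumes "v \<in> T p" shows "\<omega> p (\<xi> p) v = - \<theta> p v"
  using flat_apply[OF assms, of "\<xi> p"] by (simp add: flat_\<xi>)

lemma \<theta>_\<xi>: "\<theta> p (\<xi> p) = 0"
  using \<omega>_\<xi>[OF vector_fieldD(1)[OF \<xi>_vector_field], of p] \<omega>_skew[OF vector_fieldD(1)[OF \<xi>_vector_field] vector_fieldD(1)[OF \<xi>_vector_field], of p] by simp

lemma flat_at_\<xi>: "v \<in> T p \<Longrightarrow> flat p v (\<xi> p) = - \<theta> p v"
  using \<omega>_\<xi>[of v p] \<omega>_skew[OF _ vector_fieldD(1)[OF \<xi>_vector_field], of v p] by (simp add: flat_apply vector_fieldD(1)[OF \<xi>_vector_field])

lemma bivector_flat: "v \<in> T p \<Longrightarrow> w \<in> T p \<Longrightarrow> \<pi> p (flat p v) (flat p w) = \<omega> p v w"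
  unfolding lcs_bivector_def by (simp add: sharp_flat)

lemma sharp_biv_eq_sharp:
  assumes a: "a \<in> T' p" shows "sharp_biv M \<pi> p a = sharp p a"
  unfolding sharp_biv_def
proof (rule the_equality)
  have "b (sharp p a) = \<pi> p a b" if b: "b \<in> T' p" for b
  proof -
    have "b (sharp p a) = flat p (sharp p b) (sharp p a)" by (simp add: flat_sharp[OF b])
    then show ?thesis
      using \<omega>_skew[OF sharp_tangent[OF a] sharp_tangent[OF b]]
      by (simp add: flat_apply[OF sharp_tangent[OF a]] lcs_bivector_def)
  qed
  then show sa: "sharp p a \<in> T p \<and> (\<forall>b\<in>T' p. b (sharp p a) = \<pi> p a b)"
    using sharp_tangent[OF a] by simp
  fix v assume v: "v \<in> T p \<and> (\<forall>b\<in>T' p. b v = \<pi> p a b)"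
  show "v = sharp p a"
  proof (rule tangent_eqI[of _ p])
    fix f assume f: "f \<in> C"
    have "differential M f p \<in> T' p" by (rule one_formD(1)[OF differential_one_form[OF f]])
    then have "differential M f p v = differential M f p (sharp p a)" using v sa by simp
    then show "v f = sharp p a f" using v sa by (simp add: differential_apply)
  qed (use v sa in simp_all)
qed

lemma anchor_flat:
  assumes v: "v \<in> T p" shows "sharp_biv_vec M \<pi> \<xi> p (flat p v) = v - \<theta> p v *\<^sub>R \<xi> p"
  unfolding sharp_biv_vec_def sharp_biv_eq_sharp[OF flat_cotangent[OF v]] sharp_flat[OF v] flat_at_\<xi>[OF v]
  by simp

text \<open>Under the identification of covectors with vectors by \<open>flat\<close> the anchor becomes
  \<open>v \<mapsto> v - \<theta>(v) \<xi>\<close>. It preserves the value of \<open>\<theta>\<close> because \<open>\<theta>(\<xi>) = 0\<close>, hence it is injective.\<close>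

lemma anchor_isomorphism:
  "bundle_isomorphism (cotangent_bundle M) (tangent_bundle M) (sharp_biv_vec M \<pi> \<xi>)"
proof -
  let ?h = "sharp_biv_vec M \<pi> \<xi>"
  note \<xi>T = vector_fieldD(1)[OF \<xi>_vector_field]
  have h: "?h p a = sharp p a + a (\<xi> p) *\<^sub>R \<xi> p" if "a \<in> T' p" for p a
    unfolding sharp_biv_vec_def sharp_biv_eq_sharp[OF that] ..
  have mem: "?h p a \<in> T p" if a: "a \<in> T' p" for p a
    unfolding h[OF a] by (intro subspace_add subspace_scale tangent_subspace \<xi>T sharp_tangent a)
  have sharp_lin: "linear_on_subspace (T' p) (sharp p)" for p
    using sharp_morphism unfolding bundle_morphism_def cotangent_bundle_def by simp
  have lin: "linear_on_subspace (T' p) (?h p)" for p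
    unfolding linear_on_subspace_def
  proof (intro conjI ballI allI)
    fix a b assume a: "a \<in> T' p" and b: "b \<in> T' p"
    have "sharp p (a + b) = sharp p a + sharp p b"
      using sharp_lin[of p] a b unfolding linear_on_subspace_def by blast
    then show "?h p (a + b) = ?h p a + ?h p b"
      unfolding h[OF a] h[OF b] h[OF subspace_add[OF cotangent_subspace a b]]
      by (simp only: plus_fun_apply scaleR_left_distrib add.assoc add.left_commute)
  next
    fix c a assume a: "a \<in> T' p"
    have "sharp p (c *\<^sub>R a) = c *\<^sub>R sharp p a"
      using sharp_lin[of p] a unfolding linear_on_subspace_def by blast
    then show "?h p (c *\<^sub>R a) = c *\<^sub>R ?h p a"
      unfolding h[OF a] h[OF subspace_scale[OF cotangent_subspace a]]
      by (simp only: scaleR_fun_def[of c a] scaleR_right_distrib real_scaleR_def scaleR_scaleR)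
  qed
  show ?thesis
  proof (rule bundle_isomorphismI[OF cotangent_bundle_vector_bundle tangent_bundle_vector_bundle])
    show "bundle_morphism (cotangent_bundle M) (tangent_bundle M) ?h"
      unfolding bundle_morphism_def cotangent_bundle_def tangent_bundle_def vbundle.simps
    proof (intro conjI allI ballI lin)
      show "?h p ` T' p \<subseteq> T p" for p using mem by blast
      fix \<alpha> assume \<alpha>: "\<alpha> \<in> \<Omega>"
      show "(\<lambda>p. ?h p (\<alpha> p)) \<in> \<X>"
        unfolding h[OF one_formD(1)[OF \<alpha>]]
        by (rule vector_field_add[OF sharp_vector_field[OF \<alpha>] vector_field_mult[OF one_formD(2)[OF \<alpha> \<xi>_vector_field] \<xi>_vector_field]])
    qed
    fix p
    obtain W x D where p: "p \<in> W" and xD: "coordinates_on W x D" by (rule coordinates_exist)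
    have inj: "inj_on (?h p) (T' p)"
    proof (rule inj_onI)
      fix a b assume a: "a \<in> T' p" and b: "b \<in> T' p" and eq: "?h p a = ?h p b"
      let ?v = "sharp p a" and ?w = "sharp p b"
      note v = sharp_tangent[OF a] and w = sharp_tangent[OF b]
      note lin\<theta> = cotangent_linear[OF one_formD(1)[OF \<theta>_one_form]]
      have vw: "?v - \<theta> p ?v *\<^sub>R \<xi> p = ?w - \<theta> p ?w *\<^sub>R \<xi> p"
        using eq anchor_flat[OF v] anchor_flat[OF w] by (simp only: flat_sharp[OF a] flat_sharp[OF b])
      have th: "\<theta> p (u - \<theta> p u *\<^sub>R \<xi> p) = \<theta> p u" if u: "u \<in> T p" for u
        using lin\<theta>(1)[OF u subspace_scale[OF tangent_subspace \<xi>T], of "- \<theta> p u"] lin\<theta>(2)[OF \<xi>T, where c = "- \<theta> p u"] \<theta>_\<xi>[of p]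
        by simp
      have \<theta>vw: "\<theta> p ?v = \<theta> p ?w" using arg_cong[OF vw, of "\<theta> p"] by (simp only: th[OF v] th[OF w])
      have "?v = ?w" using arg_cong[OF vw, of "\<lambda>u. u + \<theta> p ?w *\<^sub>R \<xi> p"]
        by (simp only: \<theta>vw diff_add_cancel)
      from arg_cong[OF this, of "flat p"] show "a = b" by (simp only: flat_sharp[OF a] flat_sharp[OF b])
    qed
    show "bij_betw (?h p) (fibre (cotangent_bundle M) p) (fibre (tangent_bundle M) p)"
      unfolding cotangent_bundle_def tangent_bundle_def vbundle.simps
      by (rule injective_imp_bijective[OF coordinates_cotangent_basis[OF xD p] cotangent_subspace lin inj
          coordinates_tangent_basis[OF xD p]]) (use mem in blast)
  qed
qed

end


section \<open>The bracket in terms of vector fields\<close>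

context lcs_manifold
begin

abbreviation "flat_field X \<equiv> \<lambda>p. flat p (X p)"

lemma sharp_biv_flat_field: "X \<in> \<X> \<Longrightarrow> (\<lambda>p. sharp_biv M \<pi> p (flat_field X p)) = X"
  by (rule ext) (simp add: sharp_biv_eq_sharp flat_cotangent sharp_flat vector_fieldD(1))

lemma lcs_equation':
  assumes "X \<in> \<X>" "Y \<in> \<X>" "Z \<in> \<X>"
  shows "X p (\<lambda>q. \<omega> q (Y q) (Z q)) - Y p (\<lambda>q. \<omega> q (X q) (Z q)) + Z p (\<lambda>q. \<omega> q (X q) (Y q))
    - \<omega> p (lie_bracket X Y p) (Z p) + \<omega> p (lie_bracket X Z p) (Y p) - \<omega> p (lie_bracket Y Z p) (X p)
    + (\<theta> p (X p) * \<omega> p (Y p) (Z p) - \<theta> p (Y p) * \<omega> p (X p) (Z p) + \<theta> p (Z p) * \<omega> p (X p) (Y p)) = 0"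
  using lcs_equation[OF assms, of p] unfolding ext_deriv2_def wedge12_def .

lemma lie_derivative_flat:
  assumes X: "X \<in> \<X>" and Y: "Y \<in> \<X>" and Z: "Z \<in> \<X>"
  shows "lie_derivative M X (flat_field Y) p (Z p) =
    - X p (\<lambda>q. \<omega> q (Y q) (Z q)) - \<omega> p (lie_bracket X Z p) (Y p)"
proof -
  have "(\<lambda>q. flat q (Y q) (Z q)) = (\<lambda>q. - \<omega> q (Y q) (Z q))"
    by (rule ext) (rule flat_apply[OF vector_fieldD(1)[OF Z]])
  then show ?thesis
    unfolding lie_derivative(2)[OF X flat_one_form[OF Y] Z]
    by (simp add: tangent_minus[OF vector_fieldD(1)[OF X] \<omega>_smooth[OF Y Z]]
        flat_apply[OF vector_fieldD(1)[OF lie_bracket_vector_field[OF X Z]]]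
        \<omega>_skew[OF vector_fieldD(1)[OF Y] vector_fieldD(1)[OF lie_bracket_vector_field[OF X Z]]])
qed

text \<open>Infinitesimally \<open>\<xi>\<close> preserves \<open>\<omega>\<close>: \<open>\<L>\<^sub>\<xi> \<omega> = d (i\<^sub>\<xi> \<omega>) + i\<^sub>\<xi> d\<omega> = - d\<theta> - i\<^sub>\<xi> (\<theta> \<and> \<omega>) = 0\<close>.
  Therefore \<open>\<L>\<^sub>\<xi>\<close> commutes with the musical isomorphism.\<close>

lemma lie_derivative_\<xi>_flat:
  assumes Y: "Y \<in> \<X>"
  shows "lie_derivative M \<xi> (flat_field Y) = flat_field (lie_bracket \<xi> Y)"
proof (rule one_form_eqI)
  show "lie_derivative M \<xi> (flat_field Y) \<in> \<Omega>"
    by (rule lie_derivative(1)[OF \<xi>_vector_field flat_one_form[OF Y]])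
  show "flat_field (lie_bracket \<xi> Y) \<in> \<Omega>"
    by (rule flat_one_form[OF lie_bracket_vector_field[OF \<xi>_vector_field Y]])
  fix Z p assume Z: "Z \<in> \<X>"
  have \<omega>\<xi>: "(\<lambda>q. \<omega> q (\<xi> q) (V q)) = (\<lambda>q. - \<theta> q (V q))" if "V \<in> \<X>" for V
    by (rule ext) (rule \<omega>_\<xi>[OF vector_fieldD(1)[OF that]])
  have "\<omega> p (lie_bracket Y Z p) (\<xi> p) = \<theta> p (lie_bracket Y Z p)"
    using \<omega>_\<xi>[of "lie_bracket Y Z p" p] \<omega>_skew[of "lie_bracket Y Z p" p "\<xi> p"]
    by (simp add: vector_fieldD(1) lie_bracket_vector_field Y Z \<xi>_vector_field)
  moreover have "\<omega> p (\<xi> p) (Y p) = - \<theta> p (Y p)" "\<omega> p (\<xi> p) (Z p) = - \<theta> p (Z p)"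
    by (intro \<omega>_\<xi> vector_fieldD(1) Y Z)+
  moreover have "Y p (\<lambda>q. - \<theta> q (Z q)) = - Y p (\<lambda>q. \<theta> q (Z q))" "Z p (\<lambda>q. - \<theta> q (Y q)) = - Z p (\<lambda>q. \<theta> q (Y q))"
    by (intro tangent_minus[OF vector_fieldD(1)] one_formD(2)[OF \<theta>_one_form] Y Z)+
  ultimately have "\<xi> p (\<lambda>q. \<omega> q (Y q) (Z q)) =
      \<omega> p (lie_bracket \<xi> Y p) (Z p) - \<omega> p (lie_bracket \<xi> Z p) (Y p)"
    using lcs_equation'[OF \<xi>_vector_field Y Z, of p] \<theta>_closed[OF Y Z, of p]
    unfolding \<omega>\<xi>[OF Y] \<omega>\<xi>[OF Z] \<theta>_\<xi> by simp
  then show "lie_derivative M \<xi> (flat_field Y) p (Z p) = flat_field (lie_bracket \<xi> Y) p (Z p)"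
    unfolding lie_derivative_flat[OF \<xi>_vector_field Y Z] flat_apply[OF vector_fieldD(1)[OF Z]] by simp
qed

text \<open>In the symplectic case \<open>[\<cdot>, \<cdot>]\<^sub>\<pi>\<close> corresponds to the Lie bracket of vector fields. In general
  the defect is \<open>- i\<^sub>Y i\<^sub>X d\<omega> = i\<^sub>Y i\<^sub>X (\<theta> \<and> \<omega>)\<close>.\<close>

lemma bracket_biv_flat:
  assumes X: "X \<in> \<X>" and Y: "Y \<in> \<X>" and Z: "Z \<in> \<X>"
  shows "bracket_biv M \<pi> (flat_field X) (flat_field Y) p (Z p) =
    - \<omega> p (lie_bracket X Y p) (Z p)
    + \<theta> p (X p) * \<omega> p (Y p) (Z p) - \<theta> p (Y p) * \<omega> p (X p) (Z p) + \<theta> p (Z p) * \<omega> p (X p) (Y p)"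
proof -
  have \<pi>: "(\<lambda>p. \<pi> p (flat p (X p)) (flat p (Y p))) = (\<lambda>p. \<omega> p (X p) (Y p))"
    by (rule ext) (rule bivector_flat[OF vector_fieldD(1)[OF X] vector_fieldD(1)[OF Y]])
  have "bracket_biv M \<pi> (flat_field X) (flat_field Y) p (Z p) =
      lie_derivative M X (flat_field Y) p (Z p) - lie_derivative M Y (flat_field X) p (Z p)
      - Z p (\<lambda>q. \<omega> q (X q) (Y q))"
    unfolding bracket_biv_def sharp_biv_flat_field[OF X] sharp_biv_flat_field[OF Y] \<pi>
    by (simp add: differential_apply[OF vector_fieldD(1)[OF Z]])
  then show ?thesis
    using lcs_equation'[OF X Y Z, of p] unfolding lie_derivative_flat[OF X Y Z] lie_derivative_flat[OF Y X Z] by linarith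
qed

text \<open>The algebroid bracket of 1-forms, transported to vector fields by the musical isomorphism.\<close>

definition jacobi_bracket :: "('m \<Rightarrow> 'm tvec) \<Rightarrow> ('m \<Rightarrow> 'm tvec) \<Rightarrow> 'm \<Rightarrow> 'm tvec"
  where "jacobi_bracket X Y = (\<lambda>p. lie_bracket X Y p
    + ((- \<theta> p (X p)) *\<^sub>R lie_bracket \<xi> Y p + \<theta> p (Y p) *\<^sub>R lie_bracket \<xi> X p))"

lemma jacobi_bracket_vector_field: "X \<in> \<X> \<Longrightarrow> Y \<in> \<X> \<Longrightarrow> jacobi_bracket X Y \<in> \<X>"
  unfolding jacobi_bracket_def
  by (intro vector_field_add vector_field_mult lie_bracket_vector_field C_minus one_formD(2)[OF \<theta>_one_form] \<xi>_vector_field)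

text \<open>The terms \<open>\<theta> \<and> \<omega>\<close> of the previous lemma cancel against the terms of order zero in the
  definition of the bracket.\<close>

lemma bracket_flat:
  assumes X: "X \<in> \<X>" and Y: "Y \<in> \<X>"
  shows "bracket_biv_vec M \<pi> \<xi> \<theta> (flat_field X) (flat_field Y) = flat_field (jacobi_bracket X Y)"
proof (rule one_form_eqI)
  note XT = vector_fieldD(1)[OF X] and YT = vector_fieldD(1)[OF Y]
  note LX = lie_derivative_\<xi>_flat[OF X] and LY = lie_derivative_\<xi>_flat[OF Y]
  note br = lie_bracket_vector_field
  have \<pi>: "\<pi> p (flat p (X p)) (flat p (Y p)) = \<omega> p (X p) (Y p)" for p
    by (rule bivector_flat[OF XT YT])
  have expand: "bracket_biv_vec M \<pi> \<xi> \<theta> (flat_field X) (flat_field Y) = (\<lambda>p.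
      bracket_biv M \<pi> (flat_field X) (flat_field Y) p
      + (- \<theta> p (X p)) *\<^sub>R (flat p (lie_bracket \<xi> Y p) - flat p (Y p))
      - (- \<theta> p (Y p)) *\<^sub>R (flat p (lie_bracket \<xi> X p) - flat p (X p))
      - \<omega> p (X p) (Y p) *\<^sub>R \<theta> p)"
    unfolding bracket_biv_vec_def LX LY flat_at_\<xi>[OF XT] flat_at_\<xi>[OF YT] \<pi> ..
  have "bracket_biv M \<pi> (flat_field X) (flat_field Y) \<in> \<Omega>"
  proof -
    have "bracket_biv M \<pi> (flat_field X) (flat_field Y) = (\<lambda>p.
        lie_derivative M X (flat_field Y) p - lie_derivative M Y (flat_field X) p
        - differential M (\<lambda>p. \<omega> p (X p) (Y p)) p)"
      unfolding bracket_biv_def sharp_biv_flat_field[OF X] sharp_biv_flat_field[OF Y] \<pi> by (rule ext) simp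
    also have "\<dots> \<in> \<Omega>"
      by (intro one_form_diff lie_derivative(1) X Y flat_one_form differential_one_form \<omega>_smooth)
    finally show ?thesis .
  qed
  then show "bracket_biv_vec M \<pi> \<xi> \<theta> (flat_field X) (flat_field Y) \<in> \<Omega>"
    unfolding expand
    by (intro one_form_diff one_form_add one_form_mult C_minus one_formD(2)[OF \<theta>_one_form] X Y \<xi>_vector_field br
        flat_one_form \<omega>_smooth \<theta>_one_form)
  show "flat_field (jacobi_bracket X Y) \<in> \<Omega>"
    by (rule flat_one_form[OF jacobi_bracket_vector_field[OF X Y]])
  fix Z p assume Z: "Z \<in> \<X>"
  note ZT = vector_fieldD(1)[OF Z, of p]
  note b = vector_fieldD(1)[OF br[OF X Y], of p] vector_fieldD(1)[OF br[OF \<xi>_vector_field Y], of p]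
    vector_fieldD(1)[OF br[OF \<xi>_vector_field X], of p]
  note sc = subspace_scale[OF tangent_subspace]
  have "bracket_biv_vec M \<pi> \<xi> \<theta> (flat_field X) (flat_field Y) p (Z p) =
      bracket_biv M \<pi> (flat_field X) (flat_field Y) p (Z p)
      - \<theta> p (X p) * (- \<omega> p (lie_bracket \<xi> Y p) (Z p) + \<omega> p (Y p) (Z p))
      + \<theta> p (Y p) * (- \<omega> p (lie_bracket \<xi> X p) (Z p) + \<omega> p (X p) (Z p))
      - \<omega> p (X p) (Y p) * \<theta> p (Z p)"
    unfolding expand by (simp add: scaleR_fun_def flat_apply[OF ZT])
  also have "\<dots> = - (\<omega> p (lie_bracket X Y p) (Z p)
      + (- \<theta> p (X p) * \<omega> p (lie_bracket \<xi> Y p) (Z p) + \<theta> p (Y p) * \<omega> p (lie_bracket \<xi> X p) (Z p)))"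
    unfolding bracket_biv_flat[OF X Y Z] by (simp add: algebra_simps)
  also have "\<dots> = - \<omega> p (jacobi_bracket X Y p) (Z p)"
    unfolding jacobi_bracket_def \<omega>_add[OF b(1) subspace_add[OF tangent_subspace sc[OF b(2)] sc[OF b(3)]] ZT]
      \<omega>_add[OF sc[OF b(2)] sc[OF b(3)] ZT] \<omega>_scale[OF b(2) ZT] \<omega>_scale[OF b(3) ZT] ..
  finally show "bracket_biv_vec M \<pi> \<xi> \<theta> (flat_field X) (flat_field Y) p (Z p) = flat_field (jacobi_bracket X Y) p (Z p)"
    unfolding flat_apply[OF ZT] .
qed

text \<open>Expanding the right-hand side by the Leibniz rule gives \<open>jacobi_bracket X Y\<close> plus a multiple of
  \<open>\<xi>\<close>; since \<open>d\<theta> = 0\<close> and \<open>\<theta>(\<xi>) = 0\<close>, the coefficient is \<open>- \<theta> (jacobi_bracket X Y)\<close>.\<close>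

lemma anchor_jacobi_bracket:
  assumes X: "X \<in> \<X>" and Y: "Y \<in> \<X>"
  shows "jacobi_bracket X Y p - \<theta> p (jacobi_bracket X Y p) *\<^sub>R \<xi> p =
    lie_bracket (\<lambda>p. X p - \<theta> p (X p) *\<^sub>R \<xi> p) (\<lambda>p. Y p - \<theta> p (Y p) *\<^sub>R \<xi> p) p"
    (is "?l = ?r")
proof (rule tangent_eqI[of _ p])
  let ?a = "\<lambda>q. \<theta> q (X q)" and ?b = "\<lambda>q. \<theta> q (Y q)"
  note br = lie_bracket_vector_field
  have a: "?a \<in> C" and b: "?b \<in> C" by (intro one_formD(2)[OF \<theta>_one_form] X Y)+
  show "?l \<in> T p"
    by (intro subspace_diff[OF tangent_subspace] subspace_scale[OF tangent_subspace]
        vector_fieldD(1) jacobi_bracket_vector_field X Y \<xi>_vector_field)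
  show "?r \<in> T p"
    by (intro vector_fieldD(1) br vector_field_diff vector_field_mult X Y \<xi>_vector_field a b)
  fix f assume f: "f \<in> C"
  note \<xi>C = vector_fieldD(2)[OF \<xi>_vector_field f]
  have D: "U p (\<lambda>q. V q f - c q * \<xi> q f) = U p (\<lambda>q. V q f) - (c p * U p (\<lambda>q. \<xi> q f) + \<xi> p f * U p c)"
    if U: "U \<in> \<X>" and V: "V \<in> \<X>" and c: "c \<in> C" for U V c
    by (simp only: tangent_diff[OF vector_fieldD(1)[OF U] vector_fieldD(2)[OF V f] C_mult[OF c \<xi>C]]
        tangent_mult[OF vector_fieldD(1)[OF U] c \<xi>C])
  have eval: "(u - c *\<^sub>R v) g = u g - c * v g" for c :: real and u v :: "'m tvec" and g
    by (simp add: scaleR_fun_def)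
  have r: "?r f = (X p (\<lambda>q. Y q f) - (?b p * X p (\<lambda>q. \<xi> q f) + \<xi> p f * X p ?b))
      - ?a p * (\<xi> p (\<lambda>q. Y q f) - (?b p * \<xi> p (\<lambda>q. \<xi> q f) + \<xi> p f * \<xi> p ?b))
      - ((Y p (\<lambda>q. X q f) - (?a p * Y p (\<lambda>q. \<xi> q f) + \<xi> p f * Y p ?a))
      - ?b p * (\<xi> p (\<lambda>q. X q f) - (?a p * \<xi> p (\<lambda>q. \<xi> q f) + \<xi> p f * \<xi> p ?a)))"
    by (simp only: lie_bracket_def eval D[OF X Y b] D[OF \<xi>_vector_field Y b] D[OF Y X a] D[OF \<xi>_vector_field X a])
  note bT = vector_fieldD(1)[OF br[OF X Y], of p] vector_fieldD(1)[OF br[OF \<xi>_vector_field Y], of p]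
    vector_fieldD(1)[OF br[OF \<xi>_vector_field X], of p]
  note sc = subspace_scale[OF tangent_subspace] and lin = cotangent_linear[OF one_formD(1)[OF \<theta>_one_form]]
  have closed_\<xi>: "\<theta> p (lie_bracket \<xi> V p) = \<xi> p (\<lambda>q. \<theta> q (V q))" if V: "V \<in> \<X>" for V
    unfolding \<theta>_closed[OF \<xi>_vector_field V] \<theta>_\<xi> tangent_zero_fun[OF vector_fieldD(1)[OF V]] by simp
  have \<theta>Z: "\<theta> p (jacobi_bracket X Y p) = X p ?b - Y p ?a + (- ?a p * \<xi> p ?b + ?b p * \<xi> p ?a)"
    unfolding jacobi_bracket_def lin(1)[OF bT(1) subspace_add[OF tangent_subspace sc[OF bT(2)] sc[OF bT(3)]]]
      lin(1)[OF sc[OF bT(2)] sc[OF bT(3)]] lin(2)[OF bT(2)] lin(2)[OF bT(3)]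
      \<theta>_closed[OF X Y] closed_\<xi>[OF X] closed_\<xi>[OF Y] ..
  have Zf: "jacobi_bracket X Y p f = X p (\<lambda>q. Y q f) - Y p (\<lambda>q. X q f)
      + (- ?a p * (\<xi> p (\<lambda>q. Y q f) - Y p (\<lambda>q. \<xi> q f)) + ?b p * (\<xi> p (\<lambda>q. X q f) - X p (\<lambda>q. \<xi> q f)))"
    by (simp add: jacobi_bracket_def lie_bracket_def scaleR_fun_def)
  have l: "?l f = jacobi_bracket X Y p f - \<theta> p (jacobi_bracket X Y p) * \<xi> p f"
    by (rule eval)
  show "?l f = ?r f"
    unfolding l unfolding r Zf \<theta>Z by (simp add: algebra_simps)
qed

theorem lcs_cotangent_algebroid:
  shows "lie_algebroid M (cotangent_bundle M) (sharp_biv_vec M \<pi> \<xi>) (bracket_biv_vec M \<pi> \<xi> \<theta>)"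
    and "algebroid_isomorphism (cotangent_bundle M) (sharp_biv_vec M \<pi> \<xi>) (bracket_biv_vec M \<pi> \<xi> \<theta>)
      (tangent_bundle M) (\<lambda>p v. v) lie_bracket (sharp_biv_vec M \<pi> \<xi>)"
proof -
  let ?h = "sharp_biv_vec M \<pi> \<xi>"
  have sec: "sections (cotangent_bundle M) = \<Omega>" by (simp add: cotangent_bundle_def)
  have flat: "\<exists>X\<in>\<X>. \<alpha> = flat_field X" if "\<alpha> \<in> \<Omega>" for \<alpha>
  proof (rule bexI[OF _ sharp_vector_field[OF that]])
    show "\<alpha> = (\<lambda>p. flat p (sharp p (\<alpha> p)))"
      by (rule ext) (rule flat_sharp[OF one_formD(1)[OF that], symmetric])
  qed
  have br: "bracket_biv_vec M \<pi> \<xi> \<theta> \<alpha> \<beta> \<in> sections (cotangent_bundle M)"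
    and hom: "?h p (bracket_biv_vec M \<pi> \<xi> \<theta> \<alpha> \<beta> p) = lie_bracket (\<lambda>p. ?h p (\<alpha> p)) (\<lambda>p. ?h p (\<beta> p)) p"
    if "\<alpha> \<in> sections (cotangent_bundle M)" "\<beta> \<in> sections (cotangent_bundle M)" for \<alpha> \<beta> p
  proof -
    note sections = that[unfolded sec]
    obtain X where X: "X \<in> \<X>" "\<alpha> = flat_field X" using flat[OF sections(1)] by (rule bexE)
    obtain Y where Y: "Y \<in> \<X>" "\<beta> = flat_field Y" using flat[OF sections(2)] by (rule bexE)
    note Z = jacobi_bracket_vector_field[OF X(1) Y(1)]
    show "bracket_biv_vec M \<pi> \<xi> \<theta> \<alpha> \<beta> \<in> sections (cotangent_bundle M)"
      unfolding sec X(2) Y(2) bracket_flat[OF X(1) Y(1)] by (rule flat_one_form[OF Z])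
    show "?h p (bracket_biv_vec M \<pi> \<xi> \<theta> \<alpha> \<beta> p) = lie_bracket (\<lambda>p. ?h p (\<alpha> p)) (\<lambda>p. ?h p (\<beta> p)) p"
      unfolding X(2) Y(2) bracket_flat[OF X(1) Y(1)] anchor_flat[OF vector_fieldD(1)[OF Z]]
        anchor_flat[OF vector_fieldD(1)[OF X(1)]] anchor_flat[OF vector_fieldD(1)[OF Y(1)]]
      by (rule anchor_jacobi_bracket[OF X(1) Y(1)])
  qed
  show "lie_algebroid M (cotangent_bundle M) ?h (bracket_biv_vec M \<pi> \<xi> \<theta>)"
    by (rule lie_algebroid_by_anchor(1)[where br = "bracket_biv_vec M \<pi> \<xi> \<theta>", OF cotangent_bundle_vector_bundle anchor_isomorphism br hom])
  show "algebroid_isomorphism (cotangent_bundle M) ?h (bracket_biv_vec M \<pi> \<xi> \<theta>) (tangent_bundle M) (\<lambda>p v. v) lie_bracket ?h"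
    by (rule lie_algebroid_by_anchor(2)[where br = "bracket_biv_vec M \<pi> \<xi> \<theta>", OF cotangent_bundle_vector_bundle anchor_isomorphism br hom])
qed

end

theorem proposition1p3:
  fixes M :: "('m::{t2_space, second_countable_topology}, 'b::euclidean_space) atlas"
    and \<omega> :: "'m \<Rightarrow> 'm tvec \<Rightarrow> 'm tvec \<Rightarrow> real"
    and \<theta> :: "'m \<Rightarrow> 'm cvec"
    and \<pi> :: "'m \<Rightarrow> 'm cvec \<Rightarrow> 'm cvec \<Rightarrow> real"
    and \<xi> :: "'m \<Rightarrow> 'm tvec"
  assumes "smooth_manifold M"
    and "lcs_structure M \<omega> \<theta>"
    and "\<pi> = lcs_bivector M \<omega>"
    and "\<xi> = lcs_vector_field M \<omega> \<theta>"
  shows "lie_algebroid M (cotangent_bundle M) (sharp_biv_vec M \<pi> \<xi>) (bracket_biv_vec M \<pi> \<xi> \<theta>) \<and>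
    lie_algebroid M (tangent_bundle M) (\<lambda>p v. v) lie_bracket \<and>
    (\<exists>h. algebroid_isomorphism
      (cotangent_bundle M) (sharp_biv_vec M \<pi> \<xi>) (bracket_biv_vec M \<pi> \<xi> \<theta>)
      (tangent_bundle M) (\<lambda>p v. v) lie_bracket h)"
proof -
  interpret lcs_manifold M \<omega> \<theta>
    by unfold_locales (rule assms)+
  show ?thesis
    unfolding assms(3,4)
    by (intro conjI exI[of _ "sharp_biv_vec M (lcs_bivector M \<omega>) (lcs_vector_field M \<omega> \<theta>)"]
        lcs_cotangent_algebroid tangent_lie_algebroid)
qed

end
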